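(* Suppose that $\rho$ is an $\mathcal{A}_p$ norm on $\mathbb{R}^n$ for some $1<p\le\infty$. Fix $G\in L^p_{\mathcal{K}}(\mathbb{R}^n,\rho)$ and define $$\mathcal{R}G(x)=\sum_{k=0}^\infty 2^{-k}\|M\|_\rho^{-k}M^kG(x).$$ Then this series converges in $L^p_{\mathcal{K}}(\mathbb{R}^n,\rho)$ and $\mathcal{R}G:\mathbb{R}^n\to\mathcal{K}_{bcs}(\mathbb{R}^d)$ is a measurable mapping. Moreover, it has the following properties: (1) $G(x)\subset\mathcal{R}G(x)$ for a.e. $x$; (2) $\|\mathcal{R}G\|_{L^p_{\mathcal{K}}(\mathbb{R}^n,\rho)}\le2\|G\|_{L^p_{\mathcal{K}}(\mathbb{R}^n,\rho)}$; (3) $\mathcal{R}G\in\mathcal{A}_1^{\mathcal{K}}$, and $M(\mathcal{R}G)(x)\subset2\|M\|_\rho\,\mathcal{R}G(x)$ for a.e. $x$.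
   Context: $\mathcal{K}_{bcs}(\mathbb{R}^d)$: nonempty closed, bounded, convex, symmetric ($-K=K$) subsets of $\mathbb{R}^d$; sums of sets are Minkowski sums. $F:\mathbb{R}^n\to\mathcal{K}_{bcs}(\mathbb{R}^d)$ is measurable if $\{x:F(x)\cap U\ne\emptyset\}$ is measurable for each open $U$. A norm function is $\rho:\mathbb{R}^n\times\mathbb{R}^d\to[0,\infty)$ with $\rho(\cdot,v)$ measurable for all $v$ and $\rho_x=\rho(x,\cdot)$ a norm for all $x$; throughout $\int_Q\rho_x(v)\,dx<\infty$ for all cubes $Q$ (sides parallel to the axes) and all $v$. Dual norm: $p^*(v)=\sup_{w\neq0}|\langle v,w\rangle|/p(w)$, $\rho^*_x=(\rho_x)^*$. $\langle\rho\rangle_{p,Q}(v)=\big(\frac{1}{|Q|}\int_Q\rho_x(v)^pdx\big)^{1/p}$ for $p<\infty$, $\langle\rho\rangle_{\infty,Q}(v)=\operatorname{ess\,sup}_{x\in Q}\rho_x(v)$ (assumed finite for all $Q$, $v$). $\rho$ is an $\mathcal{A}_p$ norm if there is a constant $C$ with $\langle\rho^*\rangle_{p',Q}(v)\le C\,(\langle\rho\rangle_{p,Q})^*(v)$ for all cubes $Q$ and $v\in\mathbb{R}^d$, $1/p+1/p'=1$. For a set $K$, $\rho_x(K)=\sup\{\rho_x(v):v\in K\}$. $L^p_{\mathcal{K}}(\mathbb{R}^n,\rho)$ is the set of measurable $F:\mathbb{R}^n\to\mathcal{K}_{bcs}(\mathbb{R}^d)$ (identified when equal a.e.) with $\|F\|=\big(\int\rho_x(F(x))^pdx\big)^{1/p}<\infty$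 (ess sup of $\rho_x(F(x))$ if $p=\infty$). It carries the metric $d_p(F,G)=\big(\int d_{H,x}(F(x),G(x))^pdx\big)^{1/p}$ (ess sup if $p=\infty$), where $d_{H,x}(K_1,K_2)=\max\{\sup_{v\in K_1}\inf_{w\in K_2}\rho_x(v-w),\ \sup_{v\in K_2}\inf_{w\in K_1}\rho_x(v-w)\}$; convergence is with respect to $d_p$. Aumann integral: $\int_QF\,dy=\{\int_Qf\,dy:f\in L^1(Q,\mathbb{R}^d),\ f(y)\in F(y)\text{ a.e.}\}$. $A_QF(x)=\frac{1}{|Q|}\int_QF\,dy$ if $x\in Q$, $\{0\}$ otherwise; $MF(x)=\overline{\mathrm{conv}}(\bigcup_QA_QF(x))$ (closed convex hull over all cubes). $\|M\|_\rho$ is the infimum of $C$ with $\|MF\|_{L^p_{\mathcal{K}}(\mathbb{R}^n,\rho)}\le C\|F\|_{L^p_{\mathcal{K}}(\mathbb{R}^n,\rho)}$ for all $F$ (finite for $\mathcal{A}_p$ norms). $M^0G=G$, $M^k=M\circ\cdots\circ M$ ($k$ times). $F\in\mathcal{A}_1^{\mathcal{K}}$ means $F$ is locally integrably bounded ($F(x)\subset k(x)\mathbf{B}$ a.e. for some nonnegative $k\in L^1_{loc}$, $\mathbf{B}$ the open unit ball) and there is $C$ with $MF(x)\subset CF(x)$ for a.e. $x$. *)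

theory Defs
  imports
    "HOL-Analysis.Analysis"
    "HOL-Library.Set_Algebras"
    "HOL-Probability.Essential_Supremum"
begin

section \<open>Convex bodies and set-valued maps\<close>

text \<open>On sets, \<open>- K\<close> is the complement and \<open>K + L\<close> (from \<^theory>\<open>HOL-Library.Set_Algebras\<close>)
  is the Minkowski sum, with neutral element \<open>0 = {0}\<close>; hence \<open>sum\<close> applied to sets is the finite
  Minkowski sum.\<close>

definition Kbcs :: "('a::euclidean_space) set set" where
  "Kbcs = {K. K \<noteq> {} \<and> closed K \<and> bounded K \<and> convex K \<and> uminus ` K = K}"

definition set_scale :: "real \<Rightarrow> 'a::real_vector set \<Rightarrow> 'a set" where
  "set_scale c K = (\<lambda>v. c *\<^sub>R v) ` K"

definition Kbcs_measurable :: "('x::euclidean_space \<Rightarrow> ('a::euclidean_space) set) \<Rightarrow> bool" where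
  "Kbcs_measurable F \<longleftrightarrow>
     (\<forall>x. F x \<in> Kbcs) \<and> (\<forall>U. open U \<longrightarrow> {x. F x \<inter> U \<noteq> {}} \<in> sets lebesgue)"

text \<open>Cubes are taken open. The convention does not matter: faces are null sets, and the
  averages over closed cubes are limits of averages over slightly larger open cubes (extend a
  selection by 0), so that the maximal operator below is the same for closed cubes.\<close>

definition cubes :: "(real^'n) set set" where
  "cubes = {box a (\<chi> i. a $ i + l) | a l. 0 < l}"


section \<open>Powers and Lebesgue norms of extended nonnegative functions\<close>

text \<open>Only used with positive real exponents.\<close>

definition ennreal_powr :: "ennreal \<Rightarrow> real \<Rightarrow> ennreal" where
  "ennreal_powr x r = (if x = \<infinity> then \<infinity> else ennreal (enn2real x powr r))"

text \<open>The solution \<open>q\<close> of \<open>1/p + 1/q = 1\<close> for \<open>1 \<le> p \<le> \<infinity>\<close>; with the conventions of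
  \<^typ>\<open>ennreal\<close>, \<open>p = \<infinity>\<close> gives \<open>q = 1\<close> and \<open>p = 1\<close> gives \<open>q = \<infinity>\<close>.\<close>

definition conj_exponent :: "ennreal \<Rightarrow> ennreal" where
  "conj_exponent p = inverse (1 - inverse p)"

definition Lp_norm :: "ennreal \<Rightarrow> (real^'n \<Rightarrow> ennreal) \<Rightarrow> ennreal" where
  "Lp_norm p f =
     (if p = \<infinity> then esssup lebesgue f
      else ennreal_powr (\<integral>\<^sup>+x. ennreal_powr (f x) (enn2real p) \<partial>lebesgue) (1 / enn2real p))"

definition Lp_avg :: "ennreal \<Rightarrow> (real^'n) set \<Rightarrow> (real^'n \<Rightarrow> ennreal) \<Rightarrow> ennreal" where
  "Lp_avg p Q f =
     (if p = \<infinity> then esssup (restrict_space lebesgue Q) f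
      else ennreal_powr
             ((\<integral>\<^sup>+x\<in>Q. ennreal_powr (f x) (enn2real p) \<partial>lebesgue) / emeasure lebesgue Q)
             (1 / enn2real p))"


section \<open>Norm functions\<close>

definition is_norm :: "('a::real_vector \<Rightarrow> real) \<Rightarrow> bool" where
  "is_norm q \<longleftrightarrow>
     (\<forall>v. 0 \<le> q v) \<and> (\<forall>v. q v = 0 \<longleftrightarrow> v = 0) \<and>
     (\<forall>c v. q (c *\<^sub>R v) = \<bar>c\<bar> * q v) \<and> (\<forall>v w. q (v + w) \<le> q v + q w)"

text \<open>Local integrability of every \<open>\<rho>(\<cdot>, v)\<close>, a standing assumption of the theory, is included.\<close>

definition norm_function :: "(real^'n \<Rightarrow> real^'d \<Rightarrow> real) \<Rightarrow> bool" where
  "norm_function \<rho> \<longleftrightarrow>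
     (\<forall>v. (\<lambda>x. \<rho> x v) \<in> borel_measurable lebesgue) \<and>
     (\<forall>x. is_norm (\<rho> x)) \<and>
     (\<forall>Q\<in>cubes. \<forall>v. (\<integral>\<^sup>+x\<in>Q. ennreal (\<rho> x v) \<partial>lebesgue) < \<infinity>)"

definition dual_norm :: "(real^'d \<Rightarrow> ennreal) \<Rightarrow> real^'d \<Rightarrow> ennreal" where
  "dual_norm q v = (SUP w\<in>- {0}. ennreal \<bar>v \<bullet> w\<bar> / q w)"

definition avg_norm ::
    "ennreal \<Rightarrow> (real^'n) set \<Rightarrow> (real^'n \<Rightarrow> real^'d \<Rightarrow> ennreal) \<Rightarrow> real^'d \<Rightarrow> ennreal" where
  "avg_norm p Q \<rho> v = Lp_avg p Q (\<lambda>x. \<rho> x v)"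

text \<open>The finiteness of the averages \<open>\<langle>\<rho>\<rangle>\<^sub>p\<^sub>,\<^sub>Q\<close> (which makes them norms) is part of the definition.\<close>

definition Ap_norm :: "ennreal \<Rightarrow> (real^'n \<Rightarrow> real^'d \<Rightarrow> real) \<Rightarrow> bool" where
  "Ap_norm p \<rho> \<longleftrightarrow>
     norm_function \<rho> \<and>
     (\<forall>Q\<in>cubes. \<forall>v. avg_norm p Q (\<lambda>x w. ennreal (\<rho> x w)) v < \<infinity>) \<and>
     (\<exists>C::real. \<forall>Q\<in>cubes. \<forall>v.
        avg_norm (conj_exponent p) Q (\<lambda>x. dual_norm (\<lambda>w. ennreal (\<rho> x w))) v
          \<le> ennreal C * dual_norm (avg_norm p Q (\<lambda>x w. ennreal (\<rho> x w))) v)"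


section \<open>The space of set-valued functions\<close>

definition norm_of_set :: "(real^'d \<Rightarrow> real) \<Rightarrow> (real^'d) set \<Rightarrow> ennreal" where
  "norm_of_set q K = (SUP v\<in>K. ennreal (q v))"

definition hausdorff_dist :: "(real^'d \<Rightarrow> real) \<Rightarrow> (real^'d) set \<Rightarrow> (real^'d) set \<Rightarrow> ennreal" where
  "hausdorff_dist q K L =
     max (SUP v\<in>K. INF w\<in>L. ennreal (q (v - w))) (SUP v\<in>L. INF w\<in>K. ennreal (q (v - w)))"

definition LpK_norm ::
    "ennreal \<Rightarrow> (real^'n \<Rightarrow> real^'d \<Rightarrow> real) \<Rightarrow> (real^'n \<Rightarrow> (real^'d) set) \<Rightarrow> ennreal" where
  "LpK_norm p \<rho> F = Lp_norm p (\<lambda>x. norm_of_set (\<rho> x) (F x))"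

text \<open>Elements are identified when equal almost everywhere. Thus membership only requires that
  the function agree a.e. with a measurable \<^const>\<open>Kbcs\<close>-valued one; this matters for the maximal
  operator, which may take unbounded values on a null set.\<close>

definition LpK ::
    "ennreal \<Rightarrow> (real^'n \<Rightarrow> real^'d \<Rightarrow> real) \<Rightarrow> (real^'n \<Rightarrow> (real^'d) set) set" where
  "LpK p \<rho> = {F. (\<exists>F'. Kbcs_measurable F' \<and> (AE x in lebesgue. F x = F' x)) \<and> LpK_norm p \<rho> F < \<infinity>}"

definition LpK_dist ::
    "ennreal \<Rightarrow> (real^'n \<Rightarrow> real^'d \<Rightarrow> real) \<Rightarrow>
     (real^'n \<Rightarrow> (real^'d) set) \<Rightarrow> (real^'n \<Rightarrow> (real^'d) set) \<Rightarrow> ennreal" where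
  "LpK_dist p \<rho> F G = Lp_norm p (\<lambda>x. hausdorff_dist (\<rho> x) (F x) (G x))"

definition LpK_sums ::
    "ennreal \<Rightarrow> (real^'n \<Rightarrow> real^'d \<Rightarrow> real) \<Rightarrow>
     (nat \<Rightarrow> real^'n \<Rightarrow> (real^'d) set) \<Rightarrow> (real^'n \<Rightarrow> (real^'d) set) \<Rightarrow> bool" where
  "LpK_sums p \<rho> F S \<longleftrightarrow>
     (\<forall>N. (\<lambda>x. \<Sum>k<N. F k x) \<in> LpK p \<rho>) \<and> S \<in> LpK p \<rho> \<and>
     (\<lambda>N. LpK_dist p \<rho> (\<lambda>x. \<Sum>k<N. F k x) S) \<longlonglongrightarrow> 0"


section \<open>The convex-set valued maximal operator\<close>

definition aumann_integral :: "(real^'n) set \<Rightarrow> (real^'n \<Rightarrow> (real^'d) set) \<Rightarrow> (real^'d) set" where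
  "aumann_integral Q F =
     {(LINT y:Q|lebesgue. f y) | f.
        set_integrable lebesgue Q f \<and> (AE y in lebesgue. y \<in> Q \<longrightarrow> f y \<in> F y)}"

definition avg_op ::
    "(real^'n) set \<Rightarrow> (real^'n \<Rightarrow> (real^'d) set) \<Rightarrow> real^'n \<Rightarrow> (real^'d) set" where
  "avg_op Q F x =
     (if x \<in> Q then set_scale (1 / measure lebesgue Q) (aumann_integral Q F) else {0})"

definition maximal_op :: "(real^'n \<Rightarrow> (real^'d) set) \<Rightarrow> real^'n \<Rightarrow> (real^'d) set" where
  "maximal_op F x = closure (convex hull (\<Union>Q\<in>cubes. avg_op Q F x))"

definition maximal_op_norm :: "ennreal \<Rightarrow> (real^'n \<Rightarrow> real^'d \<Rightarrow> real) \<Rightarrow> ennreal" where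
  "maximal_op_norm p \<rho> =
     Inf {C. \<forall>F\<in>LpK p \<rho>. LpK_norm p \<rho> (maximal_op F) \<le> C * LpK_norm p \<rho> F}"

definition locally_integrably_bounded :: "(real^'n \<Rightarrow> (real^'d) set) \<Rightarrow> bool" where
  "locally_integrably_bounded F \<longleftrightarrow>
     (\<exists>k :: real^'n \<Rightarrow> real. (\<forall>x. 0 \<le> k x) \<and> (\<forall>S. compact S \<longrightarrow> set_integrable lebesgue S k) \<and>
        (AE x in lebesgue. F x \<subseteq> set_scale (k x) (ball 0 1)))"

definition A1K :: "(real^'n \<Rightarrow> (real^'d) set) set" where
  "A1K = {F. Kbcs_measurable F \<and> locally_integrably_bounded F \<and>
     (\<exists>C::real. AE x in lebesgue. maximal_op F x \<subseteq> set_scale C (F x))}"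

text \<open>The terms of the Rubio de Francia iteration. The operator norm is finite for
  \<open>\<A>\<^sub>p\<close> norms with \<open>p > 1\<close>, so \<^const>\<open>enn2real\<close> does not lose information.\<close>

definition rdf_term ::
    "ennreal \<Rightarrow> (real^'n \<Rightarrow> real^'d \<Rightarrow> real) \<Rightarrow> (real^'n \<Rightarrow> (real^'d) set) \<Rightarrow>
     nat \<Rightarrow> real^'n \<Rightarrow> (real^'d) set" where
  "rdf_term p \<rho> G k x =
     set_scale (1 / (2 ^ k * enn2real (maximal_op_norm p \<rho>) ^ k)) ((maximal_op ^^ k) G x)"

end

theory Submission
  imports Defs
begin

text \<open>
  The terms \<open>T\<^sub>k = 2\<^bsup>-k\<^esup>\<parallel>M\<parallel>\<^bsup>-k\<^esup> M\<^bsup>k\<^esup>G\<close> have norm at most \<open>2\<^bsup>-k\<^esup>\<parallel>G\<parallel>\<close>, so their Minkowski sums increase to a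
  limit of norm at most \<open>2\<parallel>G\<parallel>\<close>, and \<open>M (\<Sum>T\<^sub>k) \<subseteq> \<Sum>M T\<^sub>k\<close> follows by comparing support functions.

  The substance is that \<open>\<parallel>M\<parallel>\<close> is finite. One may replace \<open>F(y)\<close> by the ball \<open>{\<rho>\<^sub>y \<le> h(y)}\<close> with
  \<open>h \<in> L\<^sup>p\<close> positive; averages of \<open>F\<close> over \<open>Q\<close> then lie in the polar body \<open>K\<^sub>Q\<close> of the norm
  \<open>N\<^sub>Q(w) = \<langle>h \<rho>\<^sup>*(w)\<rangle>\<^sub>Q\<close>. By the one-third trick only the cells of finitely many dyadic grids
  matter. Stop at the maximal cells \<open>Q' \<subset> Q\<close> for which \<open>N\<^bsub>Q'\<^esub> \<le> 2d N\<^sub>Q\<close> fails; an Auerbach basis of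
  \<open>N\<^sub>Q\<close> and the weak type estimate show that they cover at most half of \<open>Q\<close>. It remains to sum
  \<open>\<integral>\<^sub>Q \<rho>\<^sub>x(K\<^sub>Q)\<^sup>p\<close> over the stopping cells. This integral is controlled by \<open>\<langle>h \<rho>\<^sup>*(w\<^sub>i)\<rangle>\<^sub>Q\<^sup>p |Q|\<close> for vectors
  \<open>w\<^sub>i\<close> with \<open>\<langle>\<rho>\<^sup>*(w\<^sub>i)\<rangle>\<^bsub>p',Q\<^esub> \<le> C\<close>. No reverse Hoelder inequality is needed: by the \<open>A\<^sub>p\<close> condition,
  the mass of the weights \<open>\<rho>\<^sup>*(w)\<^bsup>p'\<^esup>\<close> decays geometrically along the generations of stopping cells,
  so Hoelder's inequality with a geometric weight makes the sum converge.
\<close>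

section \<open>Lebesgue norms\<close>

text \<open>The obstacle is that an average of convex bodies is not governed by one scalar weight:
  all directions must be controlled at once. Finite dimension enters through Auerbach bases, in two
  roles. For \<open>N_Q\<close> the basis replaces the failure in some unknown direction by a single
  scalar function, to which a weak type bound applies. For the average of \<open>\<rho>\<close> over
  \<open>Q\<close> the basis and its dual vectors have norm at most 1 simultaneously, which is the
  form in which the \<open>A\<^sub>p\<close> condition is used. A grid has a coarsest mesh
  \<open>L\<close> and sees only cubes of side below \<open>L / 3\<close>. All constants are
  therefore chosen before \<open>L\<close>, and Fatou's lemma removes the restriction. For
  \<open>p = \<infinity>\<close> the conjugate exponent is 1 and the polar bodies are bounded cell
  by cell, without stopping. Maximal functions may be unbounded on null sets, so the iterates are
  handled through representatives with values in \<open>Kbcs\<close>; limits are unique almost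
  everywhere, which carries the properties of one limit to all of them. The inclusion for the series
  needs selections that nearly realise the support function, because the Aumann integral is defined
  by selections.\<close>

lemma ennreal_powr_ennreal: "0 \<le> x \<Longrightarrow> ennreal_powr (ennreal x) r = ennreal (x powr r)"
  by (simp add: ennreal_powr_def)

lemma ennreal_powr_top [simp]: "ennreal_powr top r = top"
  by (simp add: ennreal_powr_def)

lemma ennreal_powr_0 [simp]: "ennreal_powr 0 r = 0"
  by (simp add: ennreal_powr_def)

lemma ennreal_powr_eq_0_iff [simp]: "ennreal_powr x r = 0 \<longleftrightarrow> x = 0"
  by (cases x) (auto simp: ennreal_powr_def ennreal_eq_0_iff powr_def)

lemma ennreal_powr_eq_top_iff [simp]: "ennreal_powr x r = top \<longleftrightarrow> x = top"
  by (cases x) (auto simp: ennreal_powr_def)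

lemma ennreal_powr_less_top_iff [simp]: "ennreal_powr x r < top \<longleftrightarrow> x < top"
  by (metis ennreal_powr_eq_top_iff less_top)

lemma ennreal_powr_1 [simp]: "ennreal_powr x 1 = x"
  by (cases x) (auto simp: ennreal_powr_def)

lemma ennreal_powr_1_left [simp]: "ennreal_powr 1 r = 1"
  using ennreal_powr_ennreal[of 1 r] by simp

lemma ennreal_powr_mono: "0 \<le> r \<Longrightarrow> x \<le> y \<Longrightarrow> ennreal_powr x r \<le> ennreal_powr y r"
  by (cases x; cases y) (auto simp: ennreal_powr_def top_unique intro!: ennreal_leI powr_mono2)

lemma ennreal_powr_mult: "ennreal_powr (x * y) r = ennreal_powr x r * ennreal_powr y r"
proof (cases "x = top \<or> y = top")
  case True
  then show ?thesis
    by (cases "x = 0"; cases "y = 0") (auto simp: ennreal_mult_top ennreal_top_mult)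
next
  case False
  then show ?thesis
    by (cases x; cases y) (auto simp: ennreal_powr_ennreal powr_mult simp flip: ennreal_mult)
qed

lemma ennreal_powr_powr: "ennreal_powr (ennreal_powr x r) s = ennreal_powr x (r * s)"
  by (cases x) (auto simp: ennreal_powr_ennreal powr_powr)

lemma ennreal_powr_le_iff:
  assumes "0 < r" shows "ennreal_powr x r \<le> y \<longleftrightarrow> x \<le> ennreal_powr y (1 / r)"
proof
  assume "ennreal_powr x r \<le> y"
  from ennreal_powr_mono[OF _ this, of "1 / r"] assms
  show "x \<le> ennreal_powr y (1 / r)" by (simp add: ennreal_powr_powr)
next
  assume "x \<le> ennreal_powr y (1 / r)"
  from ennreal_powr_mono[OF _ this, of r] assms
  show "ennreal_powr x r \<le> y" by (simp add: ennreal_powr_powr)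
qed

lemma measurable_ennreal_powr [measurable]:
  assumes [measurable]: "f \<in> borel_measurable M"
  shows "(\<lambda>x. ennreal_powr (f x) r) \<in> borel_measurable M"
  unfolding ennreal_powr_def by measurable

lemma ennreal_powr_add_le:
  assumes "0 < r" shows "ennreal_powr (x + y) r \<le> ennreal_powr 2 r * (ennreal_powr x r + ennreal_powr y r)"
proof -
  have "ennreal_powr (x + y) r \<le> ennreal_powr (2 * max x y) r"
    using assms by (intro ennreal_powr_mono) (auto simp: mult_2 intro!: add_mono)
  also have "\<dots> = ennreal_powr 2 r * ennreal_powr (max x y) r" by (rule ennreal_powr_mult)
  also have "\<dots> \<le> ennreal_powr 2 r * (ennreal_powr x r + ennreal_powr y r)"
    by (intro mult_left_mono) (auto simp: max_def)
  finally show ?thesis .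
qed

lemma ennreal_powr_SUP:
  fixes f :: "nat \<Rightarrow> ennreal"
  assumes r: "0 < r"
  shows "ennreal_powr (SUP n. f n) r = (SUP n. ennreal_powr (f n) r)"
proof (rule antisym)
  have "f n \<le> ennreal_powr (SUP n. ennreal_powr (f n) r) (1 / r)" for n
    by (simp flip: ennreal_powr_le_iff[OF r]) (rule SUP_upper, simp)
  then show "ennreal_powr (SUP n. f n) r \<le> (SUP n. ennreal_powr (f n) r)"
    using r by (simp add: SUP_least ennreal_powr_le_iff)
next
  show "(SUP n. ennreal_powr (f n) r) \<le> ennreal_powr (SUP n. f n) r"
    using r by (intro SUP_least ennreal_powr_mono) (auto intro: SUP_upper)
qed

lemma ennreal_powr_convex:
  fixes x y :: ennreal
  assumes r: "1 \<le> r" and ab: "0 \<le> a" "0 \<le> b" "a + b = 1"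
  shows "ennreal_powr (ennreal a * x + ennreal b * y) r
       \<le> ennreal a * ennreal_powr x r + ennreal b * ennreal_powr y r"
proof (cases "(a > 0 \<and> x = top) \<or> (b > 0 \<and> y = top)")
  case True
  then have "ennreal a * ennreal_powr x r + ennreal b * ennreal_powr y r = top"
    using ab by (auto simp: ennreal_mult_eq_top_iff)
  then show ?thesis by (simp only: top_greatest)
next
  case False
  show ?thesis
  proof (cases "a = 0 \<or> b = 0")
    case True
    then show ?thesis using ab by auto
  next
    case ne: False
    with False ab have fin: "x \<noteq> top" "y \<noteq> top" by auto
    then obtain u v where uv: "x = ennreal u" "y = ennreal v" "0 \<le> u" "0 \<le> v"
      by (metis ennreal_cases)
    have "((a * u + b * v) powr r) \<le> a * u powr r + b * v powr r"
    proof -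
      have conv: "convex_on {0<..} (\<lambda>x::real. x powr r)" using r by (rule powr_convex)
      \<comment> \<open>Convexity is used on the open half-line only. If one of the two arguments is
        0, the claim reduces to this inequality for the other coefficient.\<close>
      have le: "c powr r \<le> c" if "0 < c" "c \<le> 1" for c :: real
        using that r powr_mono'[of 1 r c] by simp
      have "a < 1" "b < 1" "0 < a" "0 < b" using ne ab by auto
      note abl = this
      show ?thesis
      proof (cases "u = 0 \<or> v = 0")
        case True
        then show ?thesis using abl uv le[of a] le[of b]
          by (auto simp: powr_mult intro!: mult_right_mono)
      next
        case False
        then show ?thesis using conv uv ab by (auto simp: convex_on_def)
      qed
    qed
    then show ?thesis using uv ab
      by (simp add: ennreal_powr_ennreal ennreal_leI flip: ennreal_mult ennreal_plus)
  qed
qed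

text \<open>Convexity of the power is applied after both functions are normalised to norm 1; norms 0
  and infinity, where this is impossible, are split off.\<close>

lemma nn_integral_Minkowski:
  assumes r: "1 \<le> r" and [measurable]: "f \<in> borel_measurable M" "g \<in> borel_measurable M"
  shows "ennreal_powr (\<integral>\<^sup>+x. ennreal_powr (f x + g x) r \<partial>M) (1 / r)
    \<le> ennreal_powr (\<integral>\<^sup>+x. ennreal_powr (f x) r \<partial>M) (1 / r)
     + ennreal_powr (\<integral>\<^sup>+x. ennreal_powr (g x) r \<partial>M) (1 / r)"
proof -
  define A where "A = ennreal_powr (\<integral>\<^sup>+x. ennreal_powr (f x) r \<partial>M) (1 / r)"
  define B where "B = ennreal_powr (\<integral>\<^sup>+x. ennreal_powr (g x) r \<partial>M) (1 / r)"
  have Ar: "(\<integral>\<^sup>+x. ennreal_powr (f x) r \<partial>M) = ennreal_powr A r"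
    and Br: "(\<integral>\<^sup>+x. ennreal_powr (g x) r \<partial>M) = ennreal_powr B r"
    using r by (simp_all add: A_def B_def ennreal_powr_powr)
  consider "A = top \<or> B = top" | "A = 0" | "B = 0" | "A \<noteq> top" "B \<noteq> top" "A \<noteq> 0" "B \<noteq> 0" by blast
  then have "ennreal_powr (\<integral>\<^sup>+x. ennreal_powr (f x + g x) r \<partial>M) (1 / r) \<le> A + B"
  proof cases
    case 1 then show ?thesis by auto
  next
    case 2
    then have "AE x in M. f x = 0"
      using Ar nn_integral_0_iff_AE[of "\<lambda>x. ennreal_powr (f x) r" M] by simp
    then have "(\<integral>\<^sup>+x. ennreal_powr (f x + g x) r \<partial>M) = (\<integral>\<^sup>+x. ennreal_powr (g x) r \<partial>M)"
      by (intro nn_integral_cong_AE) auto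
    then show ?thesis using 2 by (simp add: B_def)
  next
    case 3
    then have "AE x in M. g x = 0"
      using Br nn_integral_0_iff_AE[of "\<lambda>x. ennreal_powr (g x) r" M] by simp
    then have "(\<integral>\<^sup>+x. ennreal_powr (f x + g x) r \<partial>M) = (\<integral>\<^sup>+x. ennreal_powr (f x) r \<partial>M)"
      by (intro nn_integral_cong_AE) auto
    then show ?thesis using 3 by (simp add: A_def)
  next
    case 4
    then obtain a b where ab: "A = ennreal a" "B = ennreal b" "0 < a" "0 < b"
      by (metis ennreal_cases ennreal_0 less_eq_real_def)
    define t where "t = a / (a + b)"
    have t: "0 \<le> t" "0 \<le> 1 - t" "1 - t = b / (a + b)" using ab by (auto simp: t_def field_simps)
    have eq: "f x + g x = ennreal (a + b) * (ennreal t * (ennreal (1/a) * f x) + ennreal (1-t) * (ennreal (1/b) * g x))" for x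
    proof -
      have "ennreal (a + b) * (ennreal t * (ennreal (1/a) * f x)) = ennreal ((a + b) * t * (1/a)) * f x"
        using t(1) ab by (simp only: mult.assoc ennreal_mult ennreal_mult' less_imp_le add_nonneg_nonneg
            zero_le_divide_1_iff mult_nonneg_nonneg)
      also have "(a + b) * t * (1/a) = 1" using ab by (simp add: t_def)
      finally have 1: "ennreal (a + b) * (ennreal t * (ennreal (1/a) * f x)) = f x" by simp
      have "ennreal (a + b) * (ennreal (1-t) * (ennreal (1/b) * g x)) = ennreal ((a + b) * (1-t) * (1/b)) * g x"
        using t(2) ab by (simp only: mult.assoc ennreal_mult ennreal_mult' less_imp_le add_nonneg_nonneg
            zero_le_divide_1_iff mult_nonneg_nonneg)
      also have "(a + b) * (1-t) * (1/b) = 1" using ab by (simp add: t(3))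
      finally have 2: "ennreal (a + b) * (ennreal (1-t) * (ennreal (1/b) * g x)) = g x" by simp
      show ?thesis by (simp add: distrib_left 1 2)
    qed
    have le: "ennreal_powr (f x + g x) r \<le> ennreal_powr (ennreal (a + b)) r *
        (ennreal t * (ennreal_powr (ennreal (1/a)) r * ennreal_powr (f x) r)
         + ennreal (1-t) * (ennreal_powr (ennreal (1/b)) r * ennreal_powr (g x) r))" for x
      unfolding eq ennreal_powr_mult[of "ennreal (a + b)"]
      by (intro mult_left_mono order.trans[OF ennreal_powr_convex])
         (use r t in \<open>auto simp: ennreal_powr_mult\<close>)
    have "(\<integral>\<^sup>+x. ennreal_powr (f x + g x) r \<partial>M) \<le> (\<integral>\<^sup>+x. ennreal_powr (ennreal (a + b)) r *
        (ennreal t * (ennreal_powr (ennreal (1/a)) r * ennreal_powr (f x) r)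
         + ennreal (1-t) * (ennreal_powr (ennreal (1/b)) r * ennreal_powr (g x) r)) \<partial>M)"
      by (intro nn_integral_mono le)
    also have "\<dots> = ennreal_powr (ennreal (a + b)) r *
       (ennreal t * (ennreal_powr (ennreal (1/a)) r * ennreal_powr A r)
         + ennreal (1-t) * (ennreal_powr (ennreal (1/b)) r * ennreal_powr B r))"
      by (simp add: nn_integral_cmult nn_integral_add Ar Br)
    also have "\<dots> = ennreal_powr (ennreal (a + b)) r"
    proof -
      have "ennreal t + ennreal (1 - t) = 1" using t(1,2) by (simp flip: ennreal_plus)
      moreover have "ennreal (1/a) * ennreal a = 1" "ennreal (1/b) * ennreal b = 1"
        using ab by (simp_all flip: ennreal_mult)
      ultimately show ?thesis unfolding ab ennreal_powr_mult[symmetric] by simp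
    qed
    finally have "ennreal_powr (\<integral>\<^sup>+x. ennreal_powr (f x + g x) r \<partial>M) (1 / r)
      \<le> ennreal_powr (ennreal_powr (ennreal (a + b)) r) (1 / r)"
      using r by (intro ennreal_powr_mono) auto
    then show ?thesis using r ab by (simp add: ennreal_powr_powr)
  qed
  then show ?thesis by (simp add: A_def B_def)
qed

lemma Young_ennreal:
  assumes "1 < p" "1 < q" "1 / p + 1 / q = 1"
  shows "x * y \<le> ennreal (1/p) * ennreal_powr x p + ennreal (1/q) * ennreal_powr y q"
proof (cases "x = top \<or> y = top")
  case True
  then have "ennreal (1/p) * ennreal_powr x p + ennreal (1/q) * ennreal_powr y q = top"
    using assms by (auto simp: ennreal_mult_eq_top_iff)
  then show ?thesis by (simp only: top_greatest)
next
  case False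
  then obtain u v where uv: "x = ennreal u" "y = ennreal v" "0 \<le> u" "0 \<le> v"
    by (metis ennreal_cases)
  have "u * v \<le> u powr p / p + v powr q / q"
    using assms uv by (intro Youngs_inequality) auto
  then have "u * v \<le> (1 / p) * u powr p + (1 / q) * v powr q" by simp
  then show ?thesis using uv assms
    by (simp add: ennreal_powr_ennreal ennreal_leI del: times_divide_eq_left flip: ennreal_mult ennreal_plus)
qed

text \<open>Young's inequality for the normalised functions. If one norm is 0, the product vanishes
  almost everywhere.\<close>

lemma nn_integral_Hoelder:
  assumes pq: "1 < p" "1 < q" "1 / p + 1 / q = 1"
    and [measurable]: "f \<in> borel_measurable M" "g \<in> borel_measurable M"
  shows "(\<integral>\<^sup>+x. f x * g x \<partial>M)
    \<le> ennreal_powr (\<integral>\<^sup>+x. ennreal_powr (f x) p \<partial>M) (1 / p)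
     * ennreal_powr (\<integral>\<^sup>+x. ennreal_powr (g x) q \<partial>M) (1 / q)"
proof -
  define A where "A = ennreal_powr (\<integral>\<^sup>+x. ennreal_powr (f x) p \<partial>M) (1 / p)"
  define B where "B = ennreal_powr (\<integral>\<^sup>+x. ennreal_powr (g x) q \<partial>M) (1 / q)"
  have Ar: "(\<integral>\<^sup>+x. ennreal_powr (f x) p \<partial>M) = ennreal_powr A p"
    and Br: "(\<integral>\<^sup>+x. ennreal_powr (g x) q \<partial>M) = ennreal_powr B q"
    using pq by (simp_all add: A_def B_def ennreal_powr_powr)
  consider "A = 0 \<or> B = 0" | "A \<noteq> 0" "B \<noteq> 0" "A = top \<or> B = top"
    | "A \<noteq> top" "B \<noteq> top" "A \<noteq> 0" "B \<noteq> 0" by blast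
  then have "(\<integral>\<^sup>+x. f x * g x \<partial>M) \<le> A * B"
  proof cases
    case 1
    then have "AE x in M. f x * g x = 0"
    proof
      assume "A = 0"
      then have "AE x in M. f x = 0"
        using Ar nn_integral_0_iff_AE[of "\<lambda>x. ennreal_powr (f x) p" M] by simp
      then show ?thesis by auto
    next
      assume "B = 0"
      then have "AE x in M. g x = 0"
        using Br nn_integral_0_iff_AE[of "\<lambda>x. ennreal_powr (g x) q" M] by simp
      then show ?thesis by auto
    qed
    then have "(\<integral>\<^sup>+x. f x * g x \<partial>M) = 0" by (simp add: nn_integral_0_iff_AE)
    then show ?thesis by simp
  next
    case 2
    then have "A * B = top" by (auto simp: ennreal_mult_eq_top_iff)
    then show ?thesis by simp
  next
    case 3
    then obtain a b where ab: "A = ennreal a" "B = ennreal b" "0 < a" "0 < b"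
      by (metis ennreal_cases ennreal_0 less_eq_real_def)
    have le: "f x * g x \<le> ennreal (a * b) * (ennreal (1/p) * (ennreal_powr (ennreal (1/a)) p * ennreal_powr (f x) p)
       + ennreal (1/q) * (ennreal_powr (ennreal (1/b)) q * ennreal_powr (g x) q))" for x
    proof -
      have "ennreal (a * b) * ((ennreal (1/a) * f x) * (ennreal (1/b) * g x))
          = ennreal (a * b * (1/a) * (1/b)) * (f x * g x)"
        using ab by (simp only: ennreal_mult' ennreal_mult'' mult.assoc mult.left_commute less_imp_le
            mult_nonneg_nonneg zero_le_divide_1_iff)
      also have "a * b * (1/a) * (1/b) = 1" using ab by simp
      finally have "f x * g x = ennreal (a * b) * ((ennreal (1/a) * f x) * (ennreal (1/b) * g x))" by simp
      also have "\<dots> \<le> ennreal (a * b) * (ennreal (1/p) * ennreal_powr (ennreal (1/a) * f x) p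
        + ennreal (1/q) * ennreal_powr (ennreal (1/b) * g x) q)"
        by (intro mult_left_mono Young_ennreal pq) auto
      finally show ?thesis by (simp add: ennreal_powr_mult)
    qed
    have "(\<integral>\<^sup>+x. f x * g x \<partial>M) \<le> (\<integral>\<^sup>+x. ennreal (a * b) * (ennreal (1/p) * (ennreal_powr (ennreal (1/a)) p * ennreal_powr (f x) p)
       + ennreal (1/q) * (ennreal_powr (ennreal (1/b)) q * ennreal_powr (g x) q)) \<partial>M)"
      by (intro nn_integral_mono le)
    also have "\<dots> = ennreal (a * b) * (ennreal (1/p) * (ennreal_powr (ennreal (1/a)) p * ennreal_powr A p)
       + ennreal (1/q) * (ennreal_powr (ennreal (1/b)) q * ennreal_powr B q))"
      by (simp add: nn_integral_cmult nn_integral_add Ar Br)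
    also have "\<dots> = ennreal (a * b)"
    proof -
      have "ennreal (1/p) + ennreal (1/q) = 1"
        using pq by (simp flip: ennreal_plus)
      moreover have "ennreal (1/a) * ennreal a = 1" "ennreal (1/b) * ennreal b = 1"
        using ab by (simp_all flip: ennreal_mult)
      ultimately show ?thesis unfolding ab ennreal_powr_mult[symmetric] by simp
    qed
    finally show ?thesis using ab by (simp add: ennreal_mult)
  qed
  then show ?thesis by (simp add: A_def B_def)
qed


lemma exponent_real:
  fixes p :: ennreal
  assumes "1 < p" "p \<noteq> top" shows "1 < enn2real p"
  using assms by (cases p) (auto simp: ennreal_less_iff simp flip: ennreal_1)

lemma Lp_norm_mono_AE:
  assumes "1 < p" "f \<in> borel_measurable lebesgue" "AE x in lebesgue. f x \<le> g x"
  shows "Lp_norm p f \<le> Lp_norm p g"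
proof (cases "p = top")
  case True
  then show ?thesis using assms by (simp add: Lp_norm_def esssup_AE_mono)
next
  case False
  have "(\<integral>\<^sup>+x. ennreal_powr (f x) (enn2real p) \<partial>lebesgue) \<le> (\<integral>\<^sup>+x. ennreal_powr (g x) (enn2real p) \<partial>lebesgue)"
    using assms(3) by (intro nn_integral_mono_AE; eventually_elim) (rule ennreal_powr_mono; simp)
  then show ?thesis using False by (simp add: Lp_norm_def ennreal_powr_mono)
qed

lemma Lp_norm_cong_AE:
  assumes "1 < p" "f \<in> borel_measurable lebesgue" "g \<in> borel_measurable lebesgue"
    "AE x in lebesgue. f x = g x"
  shows "Lp_norm p f = Lp_norm p g"
  by (intro antisym Lp_norm_mono_AE) (use assms in auto)

lemma Lp_norm_triangle:
  assumes p: "1 < p" and [measurable]: "f \<in> borel_measurable lebesgue" "g \<in> borel_measurable lebesgue"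
  shows "Lp_norm p (\<lambda>x. f x + g x) \<le> Lp_norm p f + Lp_norm p g"
proof (cases "p = top")
  case True
  have "AE x in lebesgue. f x + g x \<le> esssup lebesgue f + esssup lebesgue g"
    using esssup_AE[of f lebesgue] esssup_AE[of g lebesgue] by eventually_elim (rule add_mono)
  then show ?thesis using True by (simp add: Lp_norm_def esssup_I)
next
  case False
  then show ?thesis using nn_integral_Minkowski[of "enn2real p" f lebesgue g] exponent_real[of p] p
    by (simp add: Lp_norm_def)
qed

lemma Lp_norm_cmult_le:
  assumes p: "1 < p" and [measurable]: "f \<in> borel_measurable lebesgue"
  shows "Lp_norm p (\<lambda>x. c * f x) \<le> c * Lp_norm p f"
proof (cases "p = top")
  case True
  have "AE x in lebesgue. c * f x \<le> c * esssup lebesgue f"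
    using esssup_AE[of f lebesgue] by eventually_elim (rule mult_left_mono, auto)
  then show ?thesis using True by (simp add: Lp_norm_def esssup_I)
next
  case False
  then show ?thesis using exponent_real[of p] p
    by (simp add: Lp_norm_def ennreal_powr_mult nn_integral_cmult ennreal_powr_powr)
qed

lemma Lp_norm_0 [simp]: "1 < p \<Longrightarrow> Lp_norm p (\<lambda>x. 0) = 0"
  using Lp_norm_cmult_le[of p "\<lambda>x. 0" 0] by simp

lemma Lp_norm_finite_AE:
  assumes p: "1 < p" and [measurable]: "f \<in> borel_measurable lebesgue" and fin: "Lp_norm p f < top"
  shows "AE x in lebesgue. f x < top"
proof (cases "p = top")
  case True
  then show ?thesis using esssup_AE[of f lebesgue] fin by (auto simp: Lp_norm_def)
next
  case False
  then have "(\<integral>\<^sup>+x. ennreal_powr (f x) (enn2real p) \<partial>lebesgue) \<noteq> \<infinity>"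
    using fin by (simp add: Lp_norm_def less_top[symmetric])
  then have "AE x in lebesgue. ennreal_powr (f x) (enn2real p) \<noteq> \<infinity>"
    by (intro nn_integral_PInf_AE) auto
  then show ?thesis by (auto simp: less_top)
qed

lemma Lp_norm_eq_0_AE:
  assumes p: "1 < p" and [measurable]: "f \<in> borel_measurable lebesgue" and z: "Lp_norm p f = 0"
  shows "AE x in lebesgue. f x = 0"
proof (cases "p = top")
  case True
  then show ?thesis using esssup_AE[of f lebesgue] z by (auto simp: Lp_norm_def)
next
  case False
  then have "(\<integral>\<^sup>+x. ennreal_powr (f x) (enn2real p) \<partial>lebesgue) = 0"
    using z by (auto simp: Lp_norm_def)
  then have "AE x in lebesgue. ennreal_powr (f x) (enn2real p) = 0"
    by (subst (asm) nn_integral_0_iff_AE) auto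
  then show ?thesis by simp
qed

text \<open>Monotone convergence for finite exponents; for the exponent infinity, a countable union
  of null sets. This is what extends the triangle inequality to infinite sums.\<close>

lemma Lp_norm_SUP_le:
  assumes p: "1 < p" and [measurable]: "\<And>n::nat. f n \<in> borel_measurable lebesgue"
    and inc: "incseq f" and le: "\<And>n. Lp_norm p (f n) \<le> A"
  shows "Lp_norm p (\<lambda>x. SUP n. f n x) \<le> A"
proof (cases "p = top")
  case True
  have "AE x in lebesgue. \<forall>n. f n x \<le> esssup lebesgue (f n)"
    using esssup_AE by (subst AE_all_countable) auto
  then have "AE x in lebesgue. (SUP n. f n x) \<le> A"
  proof eventually_elim
    case (elim x)
    then show ?case using le True by (intro SUP_least) (auto simp: Lp_norm_def intro: order.trans)
  qed
  then show ?thesis using True by (simp add: Lp_norm_def esssup_I)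
next
  case False
  then have r: "1 < enn2real p" using p by (intro exponent_real)
  have "(\<integral>\<^sup>+x. ennreal_powr (SUP n. f n x) (enn2real p) \<partial>lebesgue)
    = (SUP n. \<integral>\<^sup>+x. ennreal_powr (f n x) (enn2real p) \<partial>lebesgue)"
    using r inc by (subst nn_integral_monotone_convergence_SUP[symmetric])
      (auto simp: ennreal_powr_SUP incseq_def le_fun_def intro!: ennreal_powr_mono)
  also have "ennreal_powr \<dots> (1 / enn2real p)
    = (SUP n. ennreal_powr (\<integral>\<^sup>+x. ennreal_powr (f n x) (enn2real p) \<partial>lebesgue) (1 / enn2real p))"
    using r by (intro ennreal_powr_SUP) auto
  finally show ?thesis using False le by (simp add: Lp_norm_def SUP_least)
qed

lemma Lp_norm_sum_le:
  assumes p: "1 < p" and [measurable]: "\<And>k. f k \<in> borel_measurable lebesgue"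
  shows "Lp_norm p (\<lambda>x. \<Sum>k<N::nat. f k x) \<le> (\<Sum>k<N. Lp_norm p (f k))"
proof (induction N)
  case 0
  then show ?case using p by simp
next
  case (Suc N)
  have "Lp_norm p (\<lambda>x. (\<Sum>k<N. f k x) + f N x) \<le> Lp_norm p (\<lambda>x. \<Sum>k<N. f k x) + Lp_norm p (f N)"
    using p by (intro Lp_norm_triangle) auto
  then show ?case using Suc by (simp add: add_right_mono order.trans)
qed

lemma Lp_norm_suminf_le:
  assumes p: "1 < p" and [measurable]: "\<And>k. f k \<in> borel_measurable lebesgue"
  shows "Lp_norm p (\<lambda>x. \<Sum>k. f k x) \<le> (\<Sum>k. Lp_norm p (f k))"
proof -
  have "Lp_norm p (\<lambda>x. SUP N. \<Sum>k<N. f k x) \<le> (\<Sum>k. Lp_norm p (f k))"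
  proof (rule Lp_norm_SUP_le[OF p])
    show "incseq (\<lambda>N x. \<Sum>k<N. f k x)"
      by (auto simp: incseq_def le_fun_def intro!: sum_mono2)
    show "Lp_norm p (\<lambda>x. \<Sum>k<N. f k x) \<le> (\<Sum>k. Lp_norm p (f k))" for N
      using Lp_norm_sum_le[OF p, of f N] sum_le_suminf[of "\<lambda>k. Lp_norm p (f k)" "{..<N}"]
      by (auto intro: order.trans)
  qed auto
  then show ?thesis by (simp add: suminf_eq_SUP)
qed

section \<open>Norms on Euclidean space and Auerbach bases\<close>

lemma is_normD:
  assumes "is_norm q"
  shows "0 \<le> q v" "q v = 0 \<longleftrightarrow> v = 0" "q (c *\<^sub>R v) = \<bar>c\<bar> * q v" "q (v + w) \<le> q v + q w"
    "q 0 = 0" "q (- v) = q v" "q (v - w) \<le> q v + q w" "v \<noteq> 0 \<Longrightarrow> 0 < q v"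
proof -
  show 1: "0 \<le> q v" and 2: "q v = 0 \<longleftrightarrow> v = 0" and "q (c *\<^sub>R v) = \<bar>c\<bar> * q v"
    and 3: "q (v + w) \<le> q v + q w" and "q 0 = 0"
    using assms by (auto simp: is_norm_def)
  have m: "q (- v) = q v" for v
    using assms unfolding is_norm_def by (metis abs_minus_cancel abs_one mult_1 scaleR_minus1_left)
  then show "q (- v) = q v" .
  show "q (v - w) \<le> q v + q w"
    using assms m[of w] unfolding is_norm_def by (metis diff_conv_add_uminus)
  show "v \<noteq> 0 \<Longrightarrow> 0 < q v" using 1 2 by (simp add: less_le)
qed

lemma is_norm_sum_le:
  assumes "is_norm q" "finite I"
  shows "q (\<Sum>i\<in>I. f i) \<le> (\<Sum>i\<in>I. q (f i))"
  using assms(2) by (induction I) (auto simp: is_normD[OF assms(1)] intro: order.trans[OF is_normD(4)[OF assms(1)]])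

lemma is_norm_le_axis:
  fixes q :: "real^'d \<Rightarrow> real"
  assumes "is_norm q" shows "q v \<le> (\<Sum>i\<in>UNIV. q (axis i 1)) * norm v"
proof -
  have "q v = q (\<Sum>i\<in>UNIV. v $ i *\<^sub>R axis i 1)"
    by (simp add: basis_expansion flip: scalar_mult_eq_scaleR)
  also have "\<dots> \<le> (\<Sum>i\<in>UNIV. q (v $ i *\<^sub>R axis i 1))"
    by (rule is_norm_sum_le[OF assms]) simp
  also have "\<dots> = (\<Sum>i\<in>UNIV. \<bar>v $ i\<bar> * q (axis i 1))"
    by (simp add: is_normD(3)[OF assms])
  also have "\<dots> \<le> (\<Sum>i\<in>UNIV. norm v * q (axis i 1))"
    by (intro sum_mono mult_right_mono component_le_norm_cart is_normD(1)[OF assms])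
  finally show ?thesis by (simp add: sum_distrib_left mult.commute)
qed

lemma is_norm_continuous_on:
  fixes q :: "real^'d \<Rightarrow> real"
  assumes "is_norm q" shows "continuous_on S q"
proof -
  define C where "C = (\<Sum>i\<in>UNIV. q (axis i (1::real) :: real^'d))"
  have C: "0 \<le> C" by (simp add: C_def sum_nonneg is_normD(1)[OF assms])
  have "\<bar>q v - q w\<bar> \<le> C * norm (v - w)" for v w
  proof -
    have "q v \<le> q w + q (v - w)" "q w \<le> q v + q (v - w)"
      using is_normD(4)[OF assms, of w "v - w"] is_normD(7)[OF assms, of v "v - w"] by simp_all
    then show ?thesis using is_norm_le_axis[OF assms, of "v - w"] by (simp add: C_def)
  qed
  then have "C-lipschitz_on S q"
    using C by (intro lipschitz_onI) (auto simp: dist_norm)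
  then show ?thesis by (rule lipschitz_on_continuous_on)
qed

text \<open>The constant is the minimum of \<open>q\<close> on the compact Euclidean unit
  sphere.\<close>

lemma is_norm_ge:
  fixes q :: "real^'d \<Rightarrow> real"
  assumes "is_norm q" obtains c where "0 < c" "\<And>v. c * norm v \<le> q v"
proof -
  have "\<exists>x\<in>sphere 0 1. \<forall>y\<in>sphere 0 1. q x \<le> q y"
    by (rule continuous_attains_inf) (auto intro: is_norm_continuous_on[OF assms])
  then obtain x where x: "norm x = 1" "\<And>y. norm y = 1 \<Longrightarrow> q x \<le> q y"
    by (auto simp: dist_norm)
  have "q x * norm v \<le> q v" for v
  proof (cases "v = 0")
    case False
    then have "q x \<le> q ((1 / norm v) *\<^sub>R v)" by (intro x) simp
    with False show ?thesis by (simp add: is_normD(3)[OF assms] field_simps)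
  qed (simp add: is_normD(1)[OF assms])
  moreover have "0 < q x" using x by (intro is_normD(8)[OF assms]) auto
  ultimately show ?thesis using that by blast
qed

text \<open>A family of vectors of norm at most 1 with maximal determinant; Cramer's rule expresses the
  coordinates as quotients of determinants.\<close>

theorem Auerbach:
  fixes q :: "real^'d \<Rightarrow> real"
  assumes q: "is_norm q"
  obtains e w :: "'d \<Rightarrow> real^'d"
    where "\<And>i. q (e i) \<le> 1" "\<And>i v. \<bar>v \<bullet> w i\<bar> \<le> q v" "\<And>v. v = (\<Sum>i\<in>UNIV. (v \<bullet> w i) *\<^sub>R e i)"
proof -
  obtain c where c: "0 < c" "\<And>v. c * norm v \<le> q v" by (rule is_norm_ge[OF q]) blast
  define S where "S = {A :: real^'d^'d. \<forall>i. q (column i A) \<le> 1}"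
  have cont: "continuous_on UNIV (\<lambda>A :: real^'d^'d. q (column i A))" for i
    by (rule continuous_on_compose2[OF is_norm_continuous_on[OF q, of UNIV]])
       (auto simp: column_def intro!: continuous_intros)
  have "closed S"
    unfolding S_def by (intro closed_Collect_all closed_Collect_le cont continuous_intros)
  moreover have "bounded S"
  proof -
    have "norm A \<le> (\<Sum>i\<in>(UNIV::'d set). \<Sum>j\<in>(UNIV::'d set). 1 / c)" if "A \<in> S" for A :: "real^'d^'d"
    proof -
      have "norm A \<le> (\<Sum>i\<in>UNIV. norm (A $ i))" by (simp add: norm_vec_def L2_set_le_sum)
      also have "\<dots> \<le> (\<Sum>i\<in>UNIV. \<Sum>j\<in>UNIV. \<bar>A $ i $ j\<bar>)" by (intro sum_mono norm_le_l1_cart)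
      also have "\<dots> \<le> (\<Sum>i\<in>(UNIV::'d set). \<Sum>j\<in>(UNIV::'d set). 1 / c)"
      proof (intro sum_mono)
        fix i j
        have "\<bar>A $ i $ j\<bar> \<le> norm (column j A)"
          using component_le_norm_cart[of "column j A" i] by (simp add: column_def)
        also have "c * \<dots> \<le> 1" using c(2)[of "column j A"] that by (auto simp: S_def intro: order.trans)
        finally show "\<bar>A $ i $ j\<bar> \<le> 1 / c" using c(1) by (simp add: field_simps)
      qed
      finally show ?thesis .
    qed
    then show ?thesis by (auto simp: bounded_iff)
  qed
  ultimately have "compact S" by (simp add: compact_eq_bounded_closed)
  moreover have "column i (0 :: real^'d^'d) = 0" for i by (simp add: column_def vec_eq_iff)
  then have "0 \<in> S" by (simp add: S_def is_normD(5)[OF q])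
  then have "S \<noteq> {}" by blast
  moreover have "continuous_on S (\<lambda>A. \<bar>det A\<bar>)"
    unfolding det_def by (intro continuous_intros)
  ultimately obtain B where B: "B \<in> S" "\<And>A. A \<in> S \<Longrightarrow> \<bar>det A\<bar> \<le> \<bar>det B\<bar>"
    using continuous_attains_sup[of S "\<lambda>A. \<bar>det A\<bar>"] by blast
  \<comment> \<open>A number above the norms of all unit vectors: then \<open>1 / m\<close> times
    the identity matrix competes in the maximisation, which forces the maximal determinant to be
    nonzero.\<close>
  define m where "m = 1 + (\<Sum>i\<in>UNIV. q (axis i (1::real) :: real^'d))"
  have m: "0 < m" "q (axis i 1) \<le> m" for i
  proof -
    show "0 < m" by (simp add: m_def add_pos_nonneg sum_nonneg is_normD(1)[OF q])
    have "q (axis i 1) \<le> (\<Sum>i\<in>UNIV. q (axis i (1::real) :: real^'d))"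
      by (rule member_le_sum) (simp_all add: is_normD(1)[OF q])
    then show "q (axis i 1) \<le> m" by (simp add: m_def)
  qed
  have "(\<chi> i j. if i = j then 1 / m else 0) \<in> S"
  proof -
    have "column i (\<chi> i j. if i = j then 1 / m else 0) = (1 / m) *\<^sub>R (axis i 1 :: real^'d)" for i
      by (simp add: vec_eq_iff column_def axis_def)
    then show ?thesis using m by (auto simp: S_def is_normD(3)[OF q] field_simps)
  qed
  from B(2)[OF this] have "det B \<noteq> 0"
    using m(1) zero_less_power[of "1 / m" "CARD('d)"] by (subst (asm) det_diagonal) (auto simp: not_le[symmetric] simp del: zero_less_power)
  then obtain B' where inv: "B ** B' = mat 1"
    using invertible_det_nz[of B] invertible_right_inverse[of B] by blast
  \<comment> \<open>The rows of the inverse matrix are the coordinate functionals belonging to the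
    columns of \<open>B\<close>.\<close>
  define w where "w i = row i (B')" for i
  have wi: "v \<bullet> w i = (B' *v v) $ i" for v i
    by (simp add: w_def row_def matrix_vector_mult_def inner_vec_def mult.commute)
  have Bv: "B *v (B' *v v) = v" for v
    by (simp add: matrix_vector_mul_assoc inv)
  show ?thesis
  proof
    show "q (column i B) \<le> 1" for i using B(1) by (simp add: S_def)
    show "v = (\<Sum>i\<in>UNIV. (v \<bullet> w i) *\<^sub>R column i B)" for v
      using Bv[of v] by (simp add: wi matrix_mult_sum scalar_mult_eq_scaleR)
    fix i v
    have le1: "\<bar>v \<bullet> w i\<bar> \<le> 1" if v: "q v \<le> 1" for v
    proof -
      \<comment> \<open>Replacing column \<open>i\<close> of \<open>B\<close> by a vector of norm at
        most 1 stays inside \<open>S\<close>, so the determinant cannot grow in absolute value; the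
        coordinate is the quotient of the two determinants.\<close>
      define A where "A = (\<chi> k j. if j = i then v $ k else B $ k $ j)"
      have "column j A = (if j = i then v else column j B)" for j
        by (simp add: A_def column_def vec_eq_iff)
      then have "A \<in> S" using v B(1) by (auto simp: S_def)
      then have "\<bar>det A\<bar> \<le> \<bar>det B\<bar>" by (rule B)
      moreover have "B' *v v = (\<chi> k. det (\<chi> i j. if j = k then v $ i else B $ i $ j) / det B)"
        using cramer[OF \<open>det B \<noteq> 0\<close>, of "B' *v v" v] Bv by simp
      then have "v \<bullet> w i = det A / det B" by (simp add: wi A_def)
      ultimately show ?thesis using \<open>det B \<noteq> 0\<close> by (simp add: abs_divide)
    qed
    show "\<bar>v \<bullet> w i\<bar> \<le> q v"
    proof (cases "v = 0")
      case False
      then have pos: "0 < q v" by (rule is_normD(8)[OF q])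
      have "\<bar>((1 / q v) *\<^sub>R v) \<bullet> w i\<bar> \<le> 1"
        by (rule le1) (use pos in \<open>simp add: is_normD(3)[OF q]\<close>)
      then show ?thesis using pos by (simp add: field_simps)
    qed (simp add: is_normD(5)[OF q])
  qed
qed

section \<open>A maximal inequality on a filtration by cells\<close>

text \<open>\<open>ix k\<close> numbers the cells of level \<open>k\<close>, so the cells are its
  level sets and each level has only countably many. Dyadic geometry is absent on purpose: stopping
  needs only nested cells of positive finite measure.\<close>

locale filtration =
  fixes M :: "'x measure" and ix :: "nat \<Rightarrow> 'x \<Rightarrow> nat"
  assumes space_UNIV [simp]: "space M = UNIV"
    and measurable_ix [measurable]: "\<And>k. ix k \<in> measurable M (count_space UNIV)"
    and ix_nested: "\<And>k x y. ix (Suc k) x = ix (Suc k) y \<Longrightarrow> ix k x = ix k y"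
    and cell_pos': "\<And>k x. 0 < emeasure M {y. ix k y = ix k x}"
    and cell_fin': "\<And>k x. emeasure M {y. ix k y = ix k x} < \<infinity>"
begin

definition cell :: "nat \<Rightarrow> 'x \<Rightarrow> 'x set" where
  "cell k x = {y. ix k y = ix k x}"

lemma cell_sets [measurable, simp]: "cell k x \<in> sets M"
proof -
  have "{y \<in> space M. ix k y = ix k x} \<in> sets M" by measurable
  then show ?thesis by (simp add: cell_def)
qed

lemma cell_pos: "0 < emeasure M (cell k x)" and cell_fin: "emeasure M (cell k x) < \<infinity>"
  using cell_pos' cell_fin' by (auto simp: cell_def)

lemma cell_self [simp]: "x \<in> cell k x" by (simp add: cell_def)

lemma cell_eq: "y \<in> cell k x \<Longrightarrow> cell k y = cell k x" by (auto simp: cell_def)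

lemma ix_nested_le: "k \<le> l \<Longrightarrow> ix l x = ix l y \<Longrightarrow> ix k x = ix k y"
  by (induction l rule: dec_induct) (auto dest: ix_nested)

lemma cell_mono: "k \<le> l \<Longrightarrow> cell l x \<subseteq> cell k x"
  by (auto simp: cell_def dest: ix_nested_le)

text \<open>A saturated set is a countable disjoint union of cells, so the inequality may be checked
  cell by cell.\<close>

lemma cells_integral_le:
  assumes [measurable]: "A \<in> sets M" "f \<in> borel_measurable M" "g \<in> borel_measurable M"
    and sat: "\<And>y. y \<in> A \<Longrightarrow> cell l y \<subseteq> A"
    and le: "\<And>y. y \<in> A \<Longrightarrow> (\<integral>\<^sup>+z\<in>cell l y. f z \<partial>M) \<le> (\<integral>\<^sup>+z\<in>cell l y. g z \<partial>M)"
  shows "(\<integral>\<^sup>+z\<in>A. f z \<partial>M) \<le> (\<integral>\<^sup>+z\<in>A. g z \<partial>M)"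
proof -
  define B where "B n = {y \<in> space M. y \<in> A \<and> ix l y = n}" for n
  have B [measurable]: "B n \<in> sets M" for n unfolding B_def by measurable
  have A: "A = (\<Union>n. B n)" by (auto simp: B_def)
  have disj: "disjoint_family B" by (auto simp: disjoint_family_on_def B_def)
  have Bn: "(\<integral>\<^sup>+z\<in>B n. f z \<partial>M) \<le> (\<integral>\<^sup>+z\<in>B n. g z \<partial>M)" for n
  proof (cases "B n = {}")
    case False
    then obtain y where y: "y \<in> A" "ix l y = n" by (auto simp: B_def)
    then have "B n = cell l y" using sat[of y] by (auto simp: B_def cell_def)
    then show ?thesis using le[OF y(1)] by simp
  qed simp
  show ?thesis unfolding A
    by (subst (1 2) nn_integral_disjoint_family) (auto intro!: suminf_le Bn simp: disj)
qed

lemma cell_integral_le_subcells: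
  assumes [measurable]: "f \<in> borel_measurable M" "g \<in> borel_measurable M"
    and le: "\<And>y. y \<in> cell k x \<Longrightarrow> (\<integral>\<^sup>+z\<in>cell (Suc k) y. f z \<partial>M) \<le> (\<integral>\<^sup>+z\<in>cell (Suc k) y. g z \<partial>M)"
  shows "(\<integral>\<^sup>+z\<in>cell k x. f z \<partial>M) \<le> (\<integral>\<^sup>+z\<in>cell k x. g z \<partial>M)"
proof (rule cells_integral_le[where l = "Suc k"])
  show "cell (Suc k) y \<subseteq> cell k x" if "y \<in> cell k x" for y
    using cell_mono[of k "Suc k" y] cell_eq[OF that] by simp
qed (use le in auto)

lemma cell_fun_measurable:
  assumes "\<And>x y. ix k x = ix k y \<Longrightarrow> F x = F y"
  shows "F \<in> measurable M (count_space UNIV)"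
proof -
  define G where "G n = F (SOME x. ix k x = n)" for n
  have "F x = G (ix k x)" for x
    unfolding G_def by (rule assms) (metis (mono_tags) someI)
  then have "F = (\<lambda>x. G (ix k x))" by auto
  moreover have "(\<lambda>x. G (ix k x)) \<in> measurable M (count_space UNIV)" by measurable
  ultimately show ?thesis by simp
qed

text \<open>Downward induction on the level takes the place of selecting maximal bad cells. A bad
  cell is paid for as a whole by its own integral; in a cell that is not bad, every bad ancestor of
  a point lies at a finer level, and the bounds for the subcells add up.\<close>

lemma weak_type:
  assumes [measurable]: "g \<in> borel_measurable M" and "k \<le> m"
  shows "lam * emeasure M {y \<in> cell k x. \<exists>l\<in>{k..m}. lam * emeasure M (cell l y) < (\<integral>\<^sup>+z\<in>cell l y. g z \<partial>M)}
    \<le> (\<integral>\<^sup>+z\<in>cell k x. g z \<partial>M)"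
proof -
  define P where "P l y \<longleftrightarrow> lam * emeasure M (cell l y) < (\<integral>\<^sup>+z\<in>cell l y. g z \<partial>M)" for l y
  have Pm [measurable]: "Measurable.pred M (P l)" for l
    by (rule cell_fun_measurable[of l]) (auto simp: P_def cell_def)
  define W where "W k = {y. \<exists>l\<in>{k..m}. P l y}" for k
  have W [measurable]: "W k \<in> sets M" for k
  proof -
    have "{y \<in> space M. \<exists>l\<in>{k..m}. P l y} \<in> sets M" by measurable
    then show ?thesis by (simp add: W_def)
  qed
  have eq: "lam * emeasure M (cell k x \<inter> W k) = (\<integral>\<^sup>+z\<in>cell k x. lam * indicator (W k) z \<partial>M)" for k x
  proof -
    have "(\<integral>\<^sup>+z\<in>cell k x. lam * indicator (W k) z \<partial>M) = (\<integral>\<^sup>+z. lam * indicator (cell k x \<inter> W k) z \<partial>M)"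
      by (intro nn_integral_cong) (auto split: split_indicator)
    then show ?thesis by (simp add: nn_integral_cmult_indicator)
  qed
  have "(\<integral>\<^sup>+z\<in>cell k x. lam * indicator (W k) z \<partial>M) \<le> (\<integral>\<^sup>+z\<in>cell k x. g z \<partial>M)"
    using \<open>k \<le> m\<close>
  proof (induction k arbitrary: x rule: inc_induct)
    case base
    show ?case
    proof (cases "P m x")
      case True
      have "lam * emeasure M (cell m x \<inter> W m) \<le> lam * emeasure M (cell m x)"
        by (intro mult_left_mono emeasure_mono) auto
      then show ?thesis using True unfolding eq P_def by simp
    next
      case False
      have "P m z = P m x" if "z \<in> cell m x" for z using cell_eq[OF that] by (simp add: P_def)
      then have "cell m x \<inter> W m = {}" using False by (auto simp: W_def)
      then show ?thesis unfolding eq[symmetric] by simp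
    qed
  next
    case (step k)
    show ?case
    proof (cases "P k x")
      case True
      have "lam * emeasure M (cell k x \<inter> W k) \<le> lam * emeasure M (cell k x)"
        by (intro mult_left_mono emeasure_mono) auto
      then show ?thesis using True unfolding eq P_def by simp
    next
      case False
      have Pk: "\<not> P k z" if "z \<in> cell k x" for z using False cell_eq[OF that] by (simp add: P_def)
      show ?thesis
      proof (rule cell_integral_le_subcells)
        fix y assume y: "y \<in> cell k x"
        have "z \<in> cell k x" if "z \<in> cell (Suc k) y" for z
          using that y cell_mono[of k "Suc k" y] cell_eq[OF y] by auto
        then have "z \<in> W k \<longleftrightarrow> z \<in> W (Suc k)" if "z \<in> cell (Suc k) y" for z
        proof -
          have "{k..m} = insert k {Suc k..m}" using step.hyps by auto
          then show ?thesis using that Pk[of z] \<open>\<And>z. z \<in> cell (Suc k) y \<Longrightarrow> z \<in> cell k x\<close> by (auto simp: W_def)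
        qed
        then have "(\<integral>\<^sup>+z\<in>cell (Suc k) y. lam * indicator (W k) z \<partial>M)
            = (\<integral>\<^sup>+z\<in>cell (Suc k) y. lam * indicator (W (Suc k)) z \<partial>M)"
          by (intro nn_integral_cong) (auto split: split_indicator)
        then show "(\<integral>\<^sup>+z\<in>cell (Suc k) y. lam * indicator (W k) z \<partial>M) \<le> (\<integral>\<^sup>+z\<in>cell (Suc k) y. g z \<partial>M)"
          using step.IH[of y] by simp
      qed auto
    qed
  qed
  moreover have "{y \<in> cell k x. \<exists>l\<in>{k..m}. P l y} = cell k x \<inter> W k" by (auto simp: W_def)
  ultimately show ?thesis unfolding P_def[symmetric] by (simp add: eq)
qed

end

section \<open>Stopping cells of the averaged norms\<close>

lemma sum_powr_le:
  fixes a :: "'d::finite \<Rightarrow> real"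
  assumes "0 \<le> p" "\<And>i. 0 \<le> a i"
  shows "(\<Sum>i\<in>UNIV. a i) powr p \<le> real CARD('d) powr p * (\<Sum>i\<in>UNIV. a i powr p)"
proof -
  define b where "b = Max (range a)"
  have "b \<in> range a" unfolding b_def by (rule Max_in) auto
  then obtain j where j: "b = a j" by auto
  have "(\<Sum>i\<in>UNIV. a i) \<le> (\<Sum>i\<in>(UNIV::'d set). b)" by (intro sum_mono) (simp add: b_def)
  then have "(\<Sum>i\<in>UNIV. a i) powr p \<le> (real CARD('d) * b) powr p"
    using assms by (intro powr_mono2) (auto simp: sum_nonneg)
  also have "\<dots> = real CARD('d) powr p * a j powr p" using assms by (simp add: powr_mult j)
  also have "\<dots> \<le> real CARD('d) powr p * (\<Sum>i\<in>UNIV. a i powr p)"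
    by (intro mult_left_mono member_le_sum) auto
  finally show ?thesis .
qed

text \<open>\<open>rho\<close> and \<open>D\<close> play a norm function and its dual; what ties
  them together is \<open>basis\<close>, which gives for each cell a basis with averages of
  \<open>rho\<close> at most 1 and a dual family with averages of \<open>D\<close> bounded by
  \<open>C\<close>. \<open>Ainf\<close> says that a set filling half of a cell carries a fixed
  proportion \<open>c\<close> of its mass, for all directions with the same \<open>c\<close>.
  \<open>lam\<close> is the stopping threshold, twice the dimension.\<close>

locale weighted_filtration = filtration M ix
  for M :: "'x measure" and ix :: "nat \<Rightarrow> 'x \<Rightarrow> nat" +
  fixes rho D :: "'x \<Rightarrow> real^'d \<Rightarrow> real" and h :: "'x \<Rightarrow> real" and p q C c lam :: real
  assumes lam_def: "lam = 2 * real CARD('d)"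
    and pq: "1 < p" "1 < q" "1 / p + 1 / q = 1"
    and rho_norm: "\<And>x. is_norm (rho x)" and D_norm: "\<And>x. is_norm (D x)"
    and rho_meas [measurable]: "\<And>v. (\<lambda>x. rho x v) \<in> borel_measurable M"
    and D_meas [measurable]: "\<And>v. (\<lambda>x. D x v) \<in> borel_measurable M"
    and h_meas [measurable]: "h \<in> borel_measurable M" and h_pos: "\<And>x. 0 < h x"
    and h_int: "(\<integral>\<^sup>+x. ennreal (h x powr p) \<partial>M) < \<infinity>"
    and D_int: "\<And>k x v. (\<integral>\<^sup>+y\<in>cell k x. ennreal (D y v powr q) \<partial>M) < \<infinity>"
    and basis: "\<And>k x. \<exists>e w :: 'd \<Rightarrow> real^'d. (\<forall>u. u = (\<Sum>i\<in>UNIV. (u \<bullet> w i) *\<^sub>R e i)) \<and>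
       (\<forall>i. (\<integral>\<^sup>+y\<in>cell k x. ennreal (rho y (e i) powr p) \<partial>M) \<le> emeasure M (cell k x)) \<and>
       (\<forall>i. (\<integral>\<^sup>+y\<in>cell k x. ennreal (D y (w i) powr q) \<partial>M) \<le> ennreal C * emeasure M (cell k x))"
    and C: "0 \<le> C" and c: "0 < c" "c \<le> 1"
    and Ainf: "\<And>k x E v. E \<in> sets M \<Longrightarrow> E \<subseteq> cell k x \<Longrightarrow> emeasure M (cell k x) \<le> 2 * emeasure M E \<Longrightarrow>
       ennreal c * (\<integral>\<^sup>+y\<in>cell k x. ennreal (D y v powr q) \<partial>M) \<le> (\<integral>\<^sup>+y\<in>E. ennreal (D y v powr q) \<partial>M)"
begin

abbreviation \<sigma> :: "'x set \<Rightarrow> real^'d \<Rightarrow> ennreal" where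
  "\<sigma> A v \<equiv> \<integral>\<^sup>+y\<in>A. ennreal (D y v powr q) \<partial>M"

definition I :: "nat \<Rightarrow> 'x \<Rightarrow> real^'d \<Rightarrow> ennreal" where
  "I k x v = (\<integral>\<^sup>+y\<in>cell k x. ennreal (h y * D y v) \<partial>M)"

text \<open>The norm called \<open>N_Q\<close> in the overview, for \<open>Q = cell k x\<close>.
  Taking real values loses nothing by \<open>I_fin\<close>, which is Hoelder's inequality.\<close>

definition N :: "nat \<Rightarrow> 'x \<Rightarrow> real^'d \<Rightarrow> real" where
  "N k x v = enn2real (I k x v) / measure M (cell k x)"

lemma D_nn [simp]: "0 \<le> D y v" by (rule is_normD(1)[OF D_norm])
lemma rho_nn [simp]: "0 \<le> rho y v" by (rule is_normD(1)[OF rho_norm])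
lemma h_nn [simp]: "0 \<le> h y" using h_pos[of y] by simp

lemma measure_cell_pos: "0 < measure M (cell k x)"
  using cell_pos[of k x] cell_fin[of k x] by (simp add: measure_def enn2real_positive_iff)

lemma emeasure_cell: "emeasure M (cell k x) = ennreal (measure M (cell k x))"
  using cell_fin[of k x] by (intro emeasure_eq_ennreal_measure) auto

lemma I_fin: "I k x v < \<infinity>"
proof -
  have "I k x v = (\<integral>\<^sup>+y. ennreal (h y) * (ennreal (D y v) * indicator (cell k x) y) \<partial>M)"
    unfolding I_def by (intro nn_integral_cong) (auto simp: ennreal_mult split: split_indicator)
  also have "\<dots> \<le> ennreal_powr (\<integral>\<^sup>+y. ennreal_powr (ennreal (h y)) p \<partial>M) (1 / p)
     * ennreal_powr (\<integral>\<^sup>+y. ennreal_powr (ennreal (D y v) * indicator (cell k x) y) q \<partial>M) (1 / q)"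
    by (intro nn_integral_Hoelder pq) auto
  also have "(\<integral>\<^sup>+y. ennreal_powr (ennreal (D y v) * indicator (cell k x) y) q \<partial>M)
      = (\<sigma> (cell k x) v)"
    by (intro nn_integral_cong) (auto simp: ennreal_powr_ennreal split: split_indicator)
  also have "ennreal_powr (\<integral>\<^sup>+y. ennreal_powr (ennreal (h y)) p \<partial>M) (1 / p) * ennreal_powr \<dots> (1 / q) < \<infinity>"
    using D_int[of v k x] h_int by (auto simp: ennreal_mult_less_top ennreal_powr_ennreal)
  finally show ?thesis .
qed

lemma I_eq: "I k x v = ennreal (N k x v * measure M (cell k x))"
  using I_fin[of k x v] measure_cell_pos[of k x] by (simp add: N_def)

lemma N_cong: "ix k x = ix k y \<Longrightarrow> N k x = N k y"
  by (auto simp: N_def I_def cell_def fun_eq_iff)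

text \<open>Only definiteness needs an argument, and it is the reason for a strictly positive
  \<open>h\<close>: a zero average would make \<open>h * D\<close> vanish almost everywhere on a
  cell of positive measure.\<close>

lemma N_norm: "is_norm (N k x)"
proof -
  have nn: "0 \<le> N k x v" for v by (simp add: N_def)
  have sc: "N k x (a *\<^sub>R v) = \<bar>a\<bar> * N k x v" for a v
  proof -
    have "I k x (a *\<^sub>R v) = ennreal \<bar>a\<bar> * I k x v"
      unfolding I_def
      by (subst nn_integral_cmult[symmetric])
         (auto intro!: nn_integral_cong simp: is_normD(3)[OF D_norm] mult.left_commute[of _ "\<bar>a\<bar>"] ennreal_mult' split: split_indicator)
    then show ?thesis by (simp add: N_def enn2real_mult)
  qed
  have tri: "N k x (v + w) \<le> N k x v + N k x w" for v w
  proof -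
    have "I k x (v + w) \<le> I k x v + I k x w"
      unfolding I_def
      by (subst nn_integral_add[symmetric])
         (auto intro!: nn_integral_mono ennreal_leI mult_left_mono is_normD(4)[OF D_norm]
           simp: distrib_left[symmetric] split: split_indicator simp flip: ennreal_plus)
    then have "ennreal (N k x (v + w) * measure M (cell k x)) \<le> ennreal ((N k x v + N k x w) * measure M (cell k x))"
      using nn by (simp add: I_eq distrib_right)
    then show ?thesis
      using nn measure_cell_pos[of k x] by (simp add: ennreal_le_iff)
  qed
  have "v = 0" if "N k x v = 0" for v
  proof (rule ccontr)
    assume "v \<noteq> 0"
    have "I k x v = 0" using that by (simp add: I_eq)
    then have "AE y in M. ennreal (h y * D y v) * indicator (cell k x) y = 0"
      unfolding I_def by (subst (asm) nn_integral_0_iff_AE) auto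
    then have "AE y in M. y \<notin> cell k x"
    proof eventually_elim
      case (elim y)
      have "0 < h y * D y v" using is_normD(8)[OF D_norm \<open>v \<noteq> 0\<close>] h_pos by simp
      then show ?case using elim by (auto split: split_indicator_asm simp: ennreal_eq_0_iff)
    qed
    then have "emeasure M (cell k x) = 0"
      by (subst (asm) AE_iff_measurable[of "cell k x"]) auto
    then show False using cell_pos[of k x] by simp
  qed
  moreover have "N k x 0 = 0" using sc[of 0 0] by simp
  ultimately show ?thesis unfolding is_norm_def using nn sc tri by blast
qed

lemma N_nn [simp]: "0 \<le> N k x v" by (rule is_normD(1)[OF N_norm])

lemma lam: "2 \<le> lam" "0 < lam" "1 \<le> lam"
proof -
  have "1 \<le> real CARD('d)" by (simp add: Suc_leI)
  then show "2 \<le> lam" "0 < lam" "1 \<le> lam" unfolding lam_def by linarith+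
qed

text \<open>\<open>s k x\<close> is the last stopping level up to \<open>k\<close> on the branch of \<open>x\<close>, and \<open>n k x\<close> counts the
  stopping levels after level 0. The cell of \<open>x\<close> at level \<open>k\<close> is a stopping cell iff \<open>s k x = k\<close>.\<close>

primrec s :: "nat \<Rightarrow> 'x \<Rightarrow> nat" where
  "s 0 x = 0"
| "s (Suc k) x = (if \<exists>v. lam * N (s k x) x v < N (Suc k) x v then Suc k else s k x)"

primrec n :: "nat \<Rightarrow> 'x \<Rightarrow> nat" where
  "n 0 x = 0"
| "n (Suc k) x = (if \<exists>v. lam * N (s k x) x v < N (Suc k) x v then Suc (n k x) else n k x)"

lemma s_le: "s k x \<le> k"
  by (induction k) auto

lemma s_n_cong: "ix k x = ix k y \<Longrightarrow> s k x = s k y \<and> n k x = n k y"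
proof (induction k)
  case (Suc k)
  have "ix k x = ix k y" by (rule ix_nested) (rule Suc.prems)
  then have IH: "s k x = s k y" "n k x = n k y" using Suc.IH by auto
  have "ix (s k x) x = ix (s k x) y"
    using \<open>ix k x = ix k y\<close> s_le ix_nested_le by blast
  then have "N (s k x) x = N (s k x) y" "N (Suc k) x = N (Suc k) y"
    using Suc.prems by (auto intro: N_cong)
  then show ?case using IH by simp
qed simp

lemma s_cong: "y \<in> cell k x \<Longrightarrow> s k y = s k x" and n_cong: "y \<in> cell k x \<Longrightarrow> n k y = n k x"
  using s_n_cong[of k y x] by (auto simp: cell_def)

lemma s_meas [measurable]: "s k \<in> measurable M (count_space UNIV)"
  and n_meas [measurable]: "n k \<in> measurable M (count_space UNIV)"
  by (rule cell_fun_measurable[of k]; use s_n_cong in blast)+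

lemma n_borel [measurable]: "n k \<in> borel_measurable M"
  using measurable_compose[OF n_meas, of "\<lambda>x. x" borel k] by simp

lemma n_mono: "k \<le> l \<Longrightarrow> n k x \<le> n l x"
  by (induction l rule: dec_induct) auto

lemma n_eq_s_eq: "k \<le> l \<Longrightarrow> n l x = n k x \<Longrightarrow> s l x = s k x"
proof (induction l rule: dec_induct)
  case (step l)
  have "n k x \<le> n l x" using step by (intro n_mono)
  then have "n l x = n k x" "\<not> (\<exists>v. lam * N (s l x) x v < N (Suc l) x v)"
    using step.prems by (auto split: if_splits)
  then show ?case using step.IH by simp
qed simp

lemma s_s: "s (s k x) x = s k x"
  by (induction k) auto

text \<open>A new stop is made exactly when this bound would fail relative to the previous stopping
  level; at a stopping level itself it holds because \<open>lam \<ge> 1\<close>.\<close>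

lemma N_le_stop: "N k x v \<le> lam * N (s k x) x v"
proof -
  have *: "N k x v \<le> lam * N k x v"
    using mult_right_mono[OF lam(3), of "N k x v"] by simp
  show ?thesis
  proof (cases k)
    case (Suc j)
    then show ?thesis using * by (auto simp: not_less)
  qed (use * in simp)
qed

text \<open>If the norm at a finer level \<open>l\<close> exceeds \<open>lam * N k x\<close> in the
  direction \<open>v\<close>, expanding \<open>v\<close> in an Auerbach basis of
  \<open>N k x\<close> gives that the sum of \<open>N l y (e i)\<close> exceeds \<open>lam\<close>,
  twice the dimension. On the large cell the same sum is at most the dimension. The weak type bound
  for \<open>g\<close>, whose cell averages are these sums, yields the factor 1/2.\<close>

lemma stopped_measure:
  assumes "s k x = k" "k \<le> m"
  shows "2 * emeasure M {y \<in> cell k x. n k x < n m y} \<le> emeasure M (cell k x)"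
proof -
  obtain e w :: "'d \<Rightarrow> real^'d" where ew: "\<And>i. N k x (e i) \<le> 1" "\<And>i v. \<bar>v \<bullet> w i\<bar> \<le> N k x v"
      "\<And>v. v = (\<Sum>i\<in>UNIV. (v \<bullet> w i) *\<^sub>R e i)"
    by (rule Auerbach[OF N_norm]) blast
  define g where "g y = (\<Sum>i\<in>UNIV. ennreal (h y * D y (e i)))" for y
  have g [measurable]: "g \<in> borel_measurable M" unfolding g_def by measurable
  have gI: "(\<integral>\<^sup>+z\<in>cell l y. g z \<partial>M) = ennreal ((\<Sum>i\<in>UNIV. N l y (e i)) * measure M (cell l y))" for l y
  proof -
    have "(\<integral>\<^sup>+z\<in>cell l y. g z \<partial>M) = (\<Sum>i\<in>UNIV. I l y (e i))"
      unfolding g_def I_def sum_distrib_right by (subst nn_integral_sum) auto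
    then show ?thesis using measure_cell_pos[of l y]
      by (simp add: I_eq sum_distrib_right sum_ennreal less_imp_le)
  qed
  have sub: "{y \<in> cell k x. n k x < n m y}
    \<subseteq> {y \<in> cell k x. \<exists>l\<in>{k..m}. ennreal lam * emeasure M (cell l y) < (\<integral>\<^sup>+z\<in>cell l y. g z \<partial>M)}"
  proof safe
    fix y assume y: "y \<in> cell k x" and "n k x < n m y"
    then have ny: "n k y < n m y" using n_cong[OF y] by simp
    \<comment> \<open>At the first level where the count rises, the reference level of the stopping
      rule is still \<open>k\<close>; the violated inequality therefore compares with
      \<open>N k\<close>.\<close>
    define l where "l = (LEAST l. n k y < n l y)"
    have l: "n k y < n l y" "l \<le> m" unfolding l_def using ny by (auto intro: LeastI Least_le)
    then have "k < l" using n_mono[of l k y] by (meson leD leI)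
    then obtain j where j: "l = Suc j" "k \<le> j" by (cases l) auto
    have "\<not> n k y < n j y" using j(1) unfolding l_def using not_less_Least by (metis lessI)
    then have nj: "n j y = n k y" using n_mono[OF j(2), of y] by simp
    then have "s j y = k" using n_eq_s_eq[OF j(2)] s_cong[OF y] assms(1) by simp
    then obtain v where v: "lam * N k y v < N l y v"
      using l(1) nj by (auto simp: j(1) split: if_splits)
    have Nky: "N k y = N k x" using y by (intro N_cong) (simp add: cell_def)
    have "N l y v = N l y (\<Sum>i\<in>UNIV. (v \<bullet> w i) *\<^sub>R e i)" using ew(3)[of v] by simp
    also have "\<dots> \<le> (\<Sum>i\<in>UNIV. N l y ((v \<bullet> w i) *\<^sub>R e i))" by (rule is_norm_sum_le[OF N_norm]) simp
    also have "\<dots> = (\<Sum>i\<in>UNIV. \<bar>v \<bullet> w i\<bar> * N l y (e i))" by (simp add: is_normD(3)[OF N_norm])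
    also have "\<dots> \<le> (\<Sum>i\<in>UNIV. N k x v * N l y (e i))"
      by (intro sum_mono mult_right_mono ew) simp
    finally have "lam * N k x v < N k x v * (\<Sum>i\<in>UNIV. N l y (e i))"
      using v by (simp add: Nky sum_distrib_left)
    then have "lam < (\<Sum>i\<in>UNIV. N l y (e i))"
      by (metis N_nn mult.commute mult_left_mono not_le)
    then have "lam * measure M (cell l y) < (\<Sum>i\<in>UNIV. N l y (e i)) * measure M (cell l y)"
      using measure_cell_pos by (rule mult_strict_right_mono)
    then have "ennreal lam * emeasure M (cell l y) < (\<integral>\<^sup>+z\<in>cell l y. g z \<partial>M)"
      unfolding gI emeasure_cell using lam measure_cell_pos[of l y]
      by (subst ennreal_mult[symmetric]) (auto simp: ennreal_less_iff)
    moreover have "l \<in> {k..m}" using l \<open>k < l\<close> by simp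
    ultimately show "\<exists>l\<in>{k..m}. ennreal lam * emeasure M (cell l y) < (\<integral>\<^sup>+z\<in>cell l y. g z \<partial>M)" by blast
  qed
  have [measurable]: "Measurable.pred M (\<lambda>y. ennreal lam * emeasure M (cell l y) < (\<integral>\<^sup>+z\<in>cell l y. g z \<partial>M))" for l
    by (rule cell_fun_measurable[of l]) (auto simp: cell_def)
  have "{y \<in> space M. y \<in> cell k x \<and> (\<exists>l\<in>{k..m}. ennreal lam * emeasure M (cell l y) < (\<integral>\<^sup>+z\<in>cell l y. g z \<partial>M))} \<in> sets M"
    by measurable
  then have "ennreal lam * emeasure M {y \<in> cell k x. n k x < n m y}
    \<le> ennreal lam * emeasure M {y \<in> cell k x. \<exists>l\<in>{k..m}. ennreal lam * emeasure M (cell l y) < (\<integral>\<^sup>+z\<in>cell l y. g z \<partial>M)}"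
    by (intro mult_left_mono emeasure_mono sub) auto
  also have "\<dots> \<le> (\<integral>\<^sup>+z\<in>cell k x. g z \<partial>M)"
    by (rule weak_type) (use assms in auto)
  also have "\<dots> \<le> ennreal (real CARD('d) * measure M (cell k x))"
    unfolding gI using ew(1) measure_cell_pos[of k x]
    by (intro ennreal_leI mult_right_mono) (auto intro: order.trans[OF sum_mono[where g = "\<lambda>_. 1"]])
  also have "\<dots> = ennreal (real CARD('d)) * emeasure M (cell k x)"
    by (simp add: emeasure_cell ennreal_mult'')
  finally have "ennreal (real CARD('d)) * (2 * emeasure M {y \<in> cell k x. n k x < n m y})
      \<le> ennreal (real CARD('d)) * emeasure M (cell k x)"
    by (simp add: lam_def ennreal_mult'' mult_ac)
  then show ?thesis
    by (subst (asm) ennreal_mult_le_mult_iff) auto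
qed


text \<open>If \<open>a\<close> is the mass of the later generations in a stopping cell and
  \<open>b\<close> the remaining mass, then \<open>c * (a + b) \<le> b\<close>. The value of
  \<open>t\<close> is such that this gives
  \<open>2 * t * a + b = 2 * a + c * a + b \<le> 2 * (a + b)\<close>.\<close>

definition t :: real where "t = 1 + c / 2"

lemma t: "1 < t" using c by (simp add: t_def)

text \<open>The exponent counts the stops between the levels \<open>k\<close> and \<open>m\<close>
  on the branch of \<open>y\<close>. The horizon \<open>m\<close> is finite so that downward
  induction has a start.\<close>

definition W :: "nat \<Rightarrow> nat \<Rightarrow> 'x \<Rightarrow> ennreal" where
  "W m k y = ennreal (t ^ (n m y - n k y))"

lemma W_meas [measurable]: "W m k \<in> borel_measurable M"
  unfolding W_def by measurable

lemma cell_nn_integral_cong: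
  assumes "\<And>y. y \<in> cell k x \<Longrightarrow> f y = g y"
  shows "(\<integral>\<^sup>+y\<in>cell k x. f y \<partial>M) = (\<integral>\<^sup>+y\<in>cell k x. g y \<partial>M)"
  using assms by (intro nn_integral_cong) (auto split: split_indicator)

text \<open>Separated from \<open>decay\<close> because the induction there applies it at each
  stopping cell it meets. The bound with the factors \<open>2 * t\<close> and 1 becomes twice the
  total mass, since at least half of the measure, hence the proportion \<open>c\<close> of the mass,
  is never stopped again.\<close>

lemma stop_decay_aux:
  assumes decay: "(\<integral>\<^sup>+y\<in>cell k x. W m k y * ennreal (D y v powr q) \<partial>M)
    \<le> (\<integral>\<^sup>+y\<in>cell k x. (if n k y < n m y then ennreal (2 * t) else 1) * ennreal (D y v powr q) \<partial>M)"
    and stop: "s k x = k" and km: "k \<le> m"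
  shows "(\<integral>\<^sup>+y\<in>cell k x. W m k y * ennreal (D y v powr q) \<partial>M)
    \<le> 2 * (\<sigma> (cell k x) v)"
proof -
  define S where "S = {y \<in> cell k x. n k x < n m y}"
  define E where "E = cell k x - S"
  have "{y \<in> space M. y \<in> cell k x \<and> n k x < n m y} \<in> sets M" by measurable
  then have S [measurable]: "S \<in> sets M" by (simp add: S_def)
  have E [measurable]: "E \<in> sets M" unfolding E_def by measurable
  have un: "cell k x = S \<union> E" "S \<inter> E = {}" by (auto simp: E_def S_def)
  have em: "emeasure M (cell k x) = emeasure M S + emeasure M E"
    unfolding un(1) by (rule plus_emeasure[symmetric]) (auto simp: un(2))
  have fin: "emeasure M S < top" "emeasure M E < top"
    using cell_fin[of k x] em by (auto simp: less_top)
  have "2 * emeasure M S \<le> emeasure M S + emeasure M E"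
    using stopped_measure[OF stop km] em by (simp add: S_def)
  then have "emeasure M S \<le> emeasure M E"
    using fin by (auto simp: mult_2)
  then have half: "emeasure M (cell k x) \<le> 2 * emeasure M E" 
    by (simp add: em mult_2 add_right_mono)
  define a b where "a = \<sigma> S v" and "b = \<sigma> E v"
  have ab: "(\<sigma> (cell k x) v) = a + b"
    unfolding a_def b_def un(1) by (rule nn_integral_disjoint_pair) (auto simp: un(2))
  have "ennreal c * (a + b) \<le> b"
    using Ainf[OF E _ half, of v] by (simp add: ab b_def E_def)
  moreover have "a + b < top" using D_int[of v k x] by (simp add: ab)
  then obtain a' b' where ab': "a = ennreal a'" "b = ennreal b'" "0 \<le> a'" "0 \<le> b'"
    by (metis ennreal_add_eq_top ennreal_cases less_top)
  ultimately have cab: "c * (a' + b') \<le> b'"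
    using c by (simp flip: ennreal_plus ennreal_mult add: ennreal_le_iff)
  have "(\<integral>\<^sup>+y\<in>cell k x. (if n k y < n m y then ennreal (2 * t) else 1) * ennreal (D y v powr q) \<partial>M)
      = ennreal (2 * t) * a + b"
  proof -
    have "(\<integral>\<^sup>+y\<in>cell k x. (if n k y < n m y then ennreal (2 * t) else 1) * ennreal (D y v powr q) \<partial>M)
      = (\<integral>\<^sup>+y. ennreal (2 * t) * (ennreal (D y v powr q) * indicator S y) + ennreal (D y v powr q) * indicator E y \<partial>M)"
    proof (rule nn_integral_cong)
      fix y
      show "(if n k y < n m y then ennreal (2 * t) else 1) * ennreal (D y v powr q) * indicator (cell k x) y
        = ennreal (2 * t) * (ennreal (D y v powr q) * indicator S y) + ennreal (D y v powr q) * indicator E y"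
        using n_cong[of y k x] by (cases "y \<in> cell k x"; cases "n k y < n m y") (auto simp: S_def E_def)
    qed
    also have "\<dots> = ennreal (2 * t) * a + b"
      by (subst nn_integral_add) (auto simp: nn_integral_cmult a_def b_def)
    finally show ?thesis .
  qed
  also have "\<dots> = ennreal (2 * t * a' + b')"
  proof -
    have "ennreal (2 * t) * a = ennreal (2 * t * a')"
      unfolding ab' by (rule ennreal_mult[symmetric]) (use t ab' in auto)
    then show ?thesis using ab' t by (simp add: ennreal_plus)
  qed
  also have "\<dots> \<le> ennreal (2 * (a' + b'))"
  proof (rule ennreal_leI)
    have "0 \<le> c * b'" using c ab' by simp
    then have "b' + c * a' \<le> 2 * b'" if "c * (a' + b') \<le> b'"
      using that by (simp add: distrib_left)
    moreover have "2 * t * a' + b' = 2 * a' + c * a' + b'" by (simp add: t_def algebra_simps)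
    ultimately show "2 * t * a' + b' \<le> 2 * (a' + b')" using cab by simp
  qed
  also have "\<dots> = 2 * (a + b)"
    using ab' by (subst ennreal_mult) (auto simp: ennreal_plus)
  finally show ?thesis using decay by (simp add: ab)
qed

text \<open>The integral of the geometric weight over a cell is controlled by downward induction on the level;
  the gain comes from the fact that a stopping cell keeps a fixed proportion of its mass
  outside of the next generation.\<close>

lemma decay:
  assumes "k \<le> m"
  shows "(\<integral>\<^sup>+y\<in>cell k x. W m k y * ennreal (D y v powr q) \<partial>M)
    \<le> (\<integral>\<^sup>+y\<in>cell k x. (if n k y < n m y then ennreal (2 * t) else 1) * ennreal (D y v powr q) \<partial>M)"
  using assms
proof (induction k arbitrary: x rule: inc_induct)
  case base
  show ?case by (simp add: W_def)
next
  case (step k)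
  show ?case
  proof (rule cell_integral_le_subcells)
    fix y assume y: "y \<in> cell k x"
    show "(\<integral>\<^sup>+z\<in>cell (Suc k) y. W m k z * ennreal (D z v powr q) \<partial>M)
      \<le> (\<integral>\<^sup>+z\<in>cell (Suc k) y. (if n k z < n m z then ennreal (2 * t) else 1) * ennreal (D z v powr q) \<partial>M)"
    proof (cases "\<exists>v. lam * N (s k y) y v < N (Suc k) y v")
      case False
      have nz: "n (Suc k) z = n k z" if "z \<in> cell (Suc k) y" for z
        using False n_cong[OF that] n_cong[of z k y] that cell_mono[of k "Suc k" y] by auto
      have "(\<integral>\<^sup>+z\<in>cell (Suc k) y. W m k z * ennreal (D z v powr q) \<partial>M)
        = (\<integral>\<^sup>+z\<in>cell (Suc k) y. W m (Suc k) z * ennreal (D z v powr q) \<partial>M)"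
        by (rule cell_nn_integral_cong) (simp add: W_def nz del: n.simps)
      also have "\<dots> \<le> (\<integral>\<^sup>+z\<in>cell (Suc k) y. (if n (Suc k) z < n m z then ennreal (2 * t) else 1) * ennreal (D z v powr q) \<partial>M)"
        by (rule step.IH)
      also have "\<dots> = (\<integral>\<^sup>+z\<in>cell (Suc k) y. (if n k z < n m z then ennreal (2 * t) else 1) * ennreal (D z v powr q) \<partial>M)"
        by (rule cell_nn_integral_cong) (simp add: nz del: n.simps)
      finally show ?thesis .
    next
      case True
      \<comment> \<open>The stop contributes one factor \<open>t\<close>, and the induction
        hypothesis at the stopping cell contributes 2. Every point of the subcell has now met a stop
        after level \<open>k\<close>, so the right-hand weight is \<open>2 * t\<close>
        throughout.\<close>
      then have stop: "s (Suc k) y = Suc k" by simp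
      have nz: "n (Suc k) z = Suc (n k z)" if "z \<in> cell (Suc k) y" for z
        using True n_cong[OF that] n_cong[of z k y] that cell_mono[of k "Suc k" y] by auto
      have lt: "n k z < n m z" if "z \<in> cell (Suc k) y" for z
        using n_mono[of "Suc k" m z] step.hyps nz[OF that] by (simp del: n.simps)
      have "(\<integral>\<^sup>+z\<in>cell (Suc k) y. W m k z * ennreal (D z v powr q) \<partial>M)
        = (\<integral>\<^sup>+z\<in>cell (Suc k) y. ennreal t * (W m (Suc k) z * ennreal (D z v powr q)) \<partial>M)"
      proof (rule cell_nn_integral_cong)
        fix z assume z: "z \<in> cell (Suc k) y"
        have "n m z - n k z = Suc (n m z - n (Suc k) z)" using lt[OF z] nz[OF z] by (simp del: n.simps)
        then show "W m k z * ennreal (D z v powr q) = ennreal t * (W m (Suc k) z * ennreal (D z v powr q))"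
          using t by (simp add: W_def ennreal_mult mult.assoc del: n.simps)
      qed
      also have "\<dots> = ennreal t * (\<integral>\<^sup>+z\<in>cell (Suc k) y. W m (Suc k) z * ennreal (D z v powr q) \<partial>M)"
        by (simp add: mult.assoc nn_integral_cmult)
      also have "\<dots> \<le> ennreal t * (2 * (\<sigma> (cell (Suc k) y) v))"
        by (intro mult_left_mono stop_decay_aux step.IH stop) (use step.hyps in auto)
      also have "\<dots> = (\<integral>\<^sup>+z\<in>cell (Suc k) y. ennreal (2 * t) * ennreal (D z v powr q) \<partial>M)"
        using t by (simp add: mult.assoc nn_integral_cmult ennreal_mult mult_ac)
      also have "\<dots> = (\<integral>\<^sup>+z\<in>cell (Suc k) y. (if n k z < n m z then ennreal (2 * t) else 1) * ennreal (D z v powr q) \<partial>M)"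
        by (rule cell_nn_integral_cong) (simp add: lt)
      finally show ?thesis .
    qed
  next
    show "(\<lambda>y. (if n k y < n m y then ennreal (2 * t) else 1) * ennreal (D y v powr q)) \<in> borel_measurable M"
      by measurable
  qed auto
qed

lemma stop_decay:
  assumes "s k x = k" "k \<le> m"
  shows "(\<integral>\<^sup>+y\<in>cell k x. W m k y * ennreal (D y v powr q) \<partial>M)
    \<le> 2 * (\<sigma> (cell k x) v)"
  by (rule stop_decay_aux[OF decay[OF assms(2)] assms])


section \<open>A majorant summed over the stopping cells\<close>

definition good_basis :: "'x set \<Rightarrow> ('d \<Rightarrow> real^'d) \<times> ('d \<Rightarrow> real^'d) \<Rightarrow> bool" where
  "good_basis Q = (\<lambda>(e, w). (\<forall>u. u = (\<Sum>i\<in>UNIV. (u \<bullet> w i) *\<^sub>R e i)) \<and>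
       (\<forall>i. (\<integral>\<^sup>+y\<in>Q. ennreal (rho y (e i) powr p) \<partial>M) \<le> emeasure M Q) \<and>
       (\<forall>i. (\<sigma> Q (w i)) \<le> ennreal C * emeasure M Q))"

text \<open>Chosen as a function of the cell as a set, so that all points of a cell share one
  basis.\<close>

definition ebase :: "'x set \<Rightarrow> 'd \<Rightarrow> real^'d" where "ebase Q = fst (SOME b. good_basis Q b)"
definition wbase :: "'x set \<Rightarrow> 'd \<Rightarrow> real^'d" where "wbase Q = snd (SOME b. good_basis Q b)"

lemma good_basis: "good_basis (cell k x) (ebase (cell k x), wbase (cell k x))"
proof -
  have "\<exists>b. good_basis (cell k x) b"
    using basis[of k x] unfolding good_basis_def by fast
  from someI_ex[OF this] show ?thesis by (simp add: ebase_def wbase_def)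
qed

lemma base_expansion: "u = (\<Sum>i\<in>UNIV. (u \<bullet> wbase (cell k x) i) *\<^sub>R ebase (cell k x) i)"
  and rho_ebase: "(\<integral>\<^sup>+y\<in>cell k x. ennreal (rho y (ebase (cell k x) i) powr p) \<partial>M) \<le> emeasure M (cell k x)"
  and D_wbase: "(\<sigma> (cell k x) (wbase (cell k x) i)) \<le> ennreal C * emeasure M (cell k x)"
  using good_basis[of k x] unfolding good_basis_def by auto

text \<open>An upper bound for \<open>rho y\<close> on the polar body of \<open>N k y\<close>, read
  off from the basis expansion. The sums are multiplied so that the first factor is constant on a
  cell and only the second has to be integrated.\<close>

definition b :: "nat \<Rightarrow> 'x \<Rightarrow> real" where
  "b k y = (\<Sum>i\<in>UNIV. N k y (wbase (cell k y) i)) * (\<Sum>j\<in>UNIV. rho y (ebase (cell k y) j))"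

lemma rho_le_b:
  assumes "\<And>w. \<bar>u \<bullet> w\<bar> \<le> N k y w" shows "rho y u \<le> b k y"
proof -
  let ?e = "ebase (cell k y)" and ?w = "wbase (cell k y)"
  have "rho y u = rho y (\<Sum>i\<in>UNIV. (u \<bullet> ?w i) *\<^sub>R ?e i)" using base_expansion[of u k y] by simp
  also have "\<dots> \<le> (\<Sum>i\<in>UNIV. rho y ((u \<bullet> ?w i) *\<^sub>R ?e i))" by (rule is_norm_sum_le[OF rho_norm]) simp
  also have "\<dots> = (\<Sum>i\<in>UNIV. \<bar>u \<bullet> ?w i\<bar> * rho y (?e i))" by (simp add: is_normD(3)[OF rho_norm])
  also have "\<dots> \<le> (\<Sum>i\<in>UNIV. N k y (?w i) * (\<Sum>j\<in>UNIV. rho y (?e j)))"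
    by (intro sum_mono mult_mono assms member_le_sum) (auto simp: sum_nonneg)
  finally show ?thesis by (simp add: b_def sum_distrib_right)
qed

text \<open>A sum replaces the supremum over the stopping levels: it dominates each single term, and
  its integral can be computed term by term.\<close>

definition B :: "'x \<Rightarrow> ennreal" where
  "B y = (\<Sum>k. if s k y = k then ennreal (b k y powr p) else 0)"

lemma rho_le_B:
  assumes "\<And>w. \<bar>u \<bullet> w\<bar> \<le> N k y w"
  shows "ennreal (rho y u powr p) \<le> ennreal (lam powr p) * B y"
proof -
  \<comment> \<open>Shrinking by \<open>lam\<close> moves the vector into the polar body of the last
    stopping cell, at the cost of the constant \<open>lam powr p\<close>.\<close>
  have "rho y ((1 / lam) *\<^sub>R u) \<le> b (s k y) y"
  proof (rule rho_le_b)
    fix w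
    show "\<bar>((1 / lam) *\<^sub>R u) \<bullet> w\<bar> \<le> N (s k y) y w"
      using order.trans[OF assms[of w] N_le_stop[of k y w]] lam(2) by (simp add: abs_mult field_simps)
  qed
  then have "rho y u \<le> lam * b (s k y) y" using lam(2) by (simp add: is_normD(3)[OF rho_norm] field_simps)
  then have "rho y u powr p \<le> (lam * b (s k y) y) powr p" using pq by (intro powr_mono2) auto
  also have "\<dots> = lam powr p * b (s k y) y powr p" using lam by (simp add: powr_mult)
  finally have "ennreal (rho y u powr p) \<le> ennreal (lam powr p) * ennreal (b (s k y) y powr p)"
    by (simp add: ennreal_leI flip: ennreal_mult)
  also have "ennreal (b (s k y) y powr p) \<le> B y"
    using sum_le_suminf[of "\<lambda>k. if s k y = k then ennreal (b k y powr p) else 0" "{s k y}"]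
    by (simp add: B_def s_s)
  finally show ?thesis by (simp add: mult_left_mono)
qed

text \<open>There are countably many cells of level \<open>k\<close>; on each of them the
  coefficients and the basis are those of a chosen representative point, and only
  \<open>rho x\<close> varies.\<close>

lemma b_meas [measurable]: "b k \<in> borel_measurable M"
proof -
  have "b k \<in> measurable M borel"
  proof (rule measurable_compose_countable'[where f = "\<lambda>i x. if \<exists>z. ix k z = i then
      (\<Sum>j\<in>UNIV. N k (SOME z. ix k z = i) (wbase (cell k (SOME z. ix k z = i)) j))
       * (\<Sum>j\<in>UNIV. rho x (ebase (cell k (SOME z. ix k z = i)) j)) else 0" and g = "ix k" and I = UNIV,
        THEN measurable_cong[THEN iffD1, rotated]])
    fix x
    define z where "z = (SOME z. ix k z = ix k x)"
    have z: "ix k z = ix k x" unfolding z_def by (rule someI) simp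
    then have "N k z = N k x" "cell k z = cell k x" by (auto intro: N_cong simp: cell_def)
    then show "(if \<exists>z. ix k z = ix k x then
      (\<Sum>j\<in>UNIV. N k (SOME z. ix k z = ix k x) (wbase (cell k (SOME z. ix k z = ix k x)) j))
       * (\<Sum>j\<in>UNIV. rho x (ebase (cell k (SOME z. ix k z = ix k x)) j)) else 0) = b k x"
      unfolding z_def[symmetric] b_def by auto
  qed auto
  then show ?thesis .
qed

text \<open>The geometric ratio left over for \<open>h powr p\<close> when Hoelder's inequality puts
  the weight \<open>t\<close> on the factor with \<open>D\<close>.\<close>

definition u :: real where "u = t powr (- (p / q))"

lemma u: "0 < u" "u < 1"
  using t pq by (auto simp: u_def powr_less_one)

text \<open>Write \<open>h * D = F * H\<close>, where \<open>H\<close> carries \<open>t\<close> to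
  the power \<open>r / q\<close> and \<open>F\<close> its inverse, \<open>r\<close> being the number
  of later stops. The \<open>q\<close>-integral of \<open>H\<close> is bounded by
  \<open>stop_decay\<close> and the normalisation of the dual vectors. The \<open>p\<close>-integral
  of \<open>F\<close> retains the factor \<open>u ^ r\<close>, which makes the sum over the stopping
  ancestors of a point converge.\<close>

lemma Hoelder_stop:
  assumes stop: "s k x = k" "k \<le> m"
  shows "ennreal (measure M (cell k x) * N k x (wbase (cell k x) i) powr p)
    \<le> ennreal ((2 * C) powr (p / q)) * (\<integral>\<^sup>+y\<in>cell k x. ennreal (h y powr p * u ^ (n m y - n k y)) \<partial>M)"
proof -
  define w where "w = wbase (cell k x) i"
  define \<mu> where "\<mu> = measure M (cell k x)"
  define r where "r y = n m y - n k y" for y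
  have r [measurable]: "r \<in> measurable M (count_space UNIV)" unfolding r_def by measurable
  have mu: "0 < \<mu>" by (simp add: \<mu>_def measure_cell_pos)
  define F where "F y = ennreal (h y * t powr (- real (r y) / q)) * indicator (cell k x) y" for y
  define H where "H y = ennreal (D y w * t powr (real (r y) / q)) * indicator (cell k x) y" for y
  have [measurable]: "F \<in> borel_measurable M" "H \<in> borel_measurable M"
    unfolding F_def H_def by measurable
  define X where "X = (\<integral>\<^sup>+y\<in>cell k x. ennreal (h y powr p * u ^ r y) \<partial>M)"
  have F: "(\<integral>\<^sup>+y. ennreal_powr (F y) p \<partial>M) = X"
  proof -
    have "(t powr (- real (r y) / q)) powr p = u ^ r y" for y
      using t by (simp add: u_def powr_powr powr_realpow[symmetric] mult.commute)
    then show ?thesis unfolding X_def F_def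
      by (intro nn_integral_cong) (auto simp: ennreal_powr_ennreal powr_mult split: split_indicator)
  qed
  have H: "(\<integral>\<^sup>+y. ennreal_powr (H y) q \<partial>M) \<le> ennreal (2 * C * \<mu>)"
  proof -
    have "(t powr (real (r y) / q)) powr q = t ^ r y" for y
      using t pq by (simp add: powr_powr powr_realpow)
    then have "(\<integral>\<^sup>+y. ennreal_powr (H y) q \<partial>M) = (\<integral>\<^sup>+y\<in>cell k x. W m k y * ennreal (D y w powr q) \<partial>M)"
      unfolding H_def W_def r_def[symmetric] using t
      by (intro nn_integral_cong)
         (auto simp: ennreal_powr_ennreal powr_mult mult.commute split: split_indicator simp flip: ennreal_mult)
    also have "\<dots> \<le> 2 * (\<sigma> (cell k x) w)"
      by (rule stop_decay[OF stop])
    also have "\<dots> \<le> 2 * (ennreal C * emeasure M (cell k x))"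
      unfolding w_def by (intro mult_left_mono D_wbase) auto
    finally show ?thesis using C mu by (simp add: emeasure_cell ennreal_mult \<mu>_def mult.assoc)
  qed
  have "ennreal (N k x w * \<mu>) = (\<integral>\<^sup>+y. F y * H y \<partial>M)"
  proof -
    have "t powr (- real (r y) / q) * t powr (real (r y) / q) = 1" for y
      using t by (simp flip: powr_add)
    moreover have "h y * t powr (- real (r y) / q) * (D y w * t powr (real (r y) / q))
        = h y * D y w * (t powr (- real (r y) / q) * t powr (real (r y) / q))" for y
      by (simp only: mult_ac)
    ultimately have "h y * t powr (- real (r y) / q) * (D y w * t powr (real (r y) / q)) = h y * D y w" for y
      by (simp only: mult_1_right)
    then show ?thesis unfolding I_eq[symmetric, of k x w, folded \<mu>_def] I_def F_def H_def
      by (intro nn_integral_cong) (auto simp flip: ennreal_mult split: split_indicator)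
  qed
  also have "\<dots> \<le> ennreal_powr (\<integral>\<^sup>+y. ennreal_powr (F y) p \<partial>M) (1 / p) * ennreal_powr (\<integral>\<^sup>+y. ennreal_powr (H y) q \<partial>M) (1 / q)"
    by (intro nn_integral_Hoelder pq) auto
  also have "\<dots> \<le> ennreal_powr X (1 / p) * ennreal_powr (ennreal (2 * C * \<mu>)) (1 / q)"
    unfolding F using H pq by (intro mult_left_mono ennreal_powr_mono) auto
  finally have "ennreal_powr (ennreal (N k x w * \<mu>)) p \<le> ennreal_powr (ennreal_powr X (1 / p) * ennreal_powr (ennreal (2 * C * \<mu>)) (1 / q)) p"
    using pq by (intro ennreal_powr_mono) auto
  also have "\<dots> = X * ennreal ((2 * C * \<mu>) powr (p / q))"
    using pq C mu by (simp add: ennreal_powr_mult ennreal_powr_powr ennreal_powr_ennreal powr_powr)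
  finally have main: "ennreal ((N k x w * \<mu>) powr p) \<le> X * ennreal ((2 * C * \<mu>) powr (p / q))"
    using mu by (simp add: ennreal_powr_ennreal)
  \<comment> \<open>By this identity dividing \<open>(N * \<mu>) powr p\<close> by
    \<open>\<mu> powr (p / q)\<close> leaves exactly one power of the measure, and the right-hand
    side loses its dependence on it.\<close>
  have pq1: "p / q = p - 1"
    using pq by (simp add: field_simps)
  have "ennreal (\<mu> * N k x w powr p) = ennreal (\<mu> powr (- (p / q))) * ennreal ((N k x w * \<mu>) powr p)"
    using mu by (simp add: powr_mult pq1 powr_diff powr_minus field_simps flip: ennreal_mult)
  also have "\<dots> \<le> ennreal (\<mu> powr (- (p / q))) * (X * ennreal ((2 * C * \<mu>) powr (p / q)))"
    by (intro mult_left_mono main) auto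
  also have "\<dots> = X * ennreal (\<mu> powr (- (p / q)) * (2 * C * \<mu>) powr (p / q))"
    by (simp add: ennreal_mult mult_ac)
  also have "\<mu> powr (- (p / q)) * (2 * C * \<mu>) powr (p / q) = (2 * C) powr (p / q)"
    using mu C by (simp add: powr_mult powr_minus)
  finally show ?thesis by (simp add: X_def \<mu>_def w_def r_def mult.commute)
qed

text \<open>Here \<open>lam / 2\<close> is the dimension d: the factor with exponent
  \<open>2 * p\<close> comes from taking two sums to the power \<open>p\<close>, the square from
  summing d terms twice, the last factor from \<open>Hoelder_stop\<close>. It depends neither on
  \<open>h\<close> nor on the filtration.\<close>

definition K :: real where "K = (lam / 2) powr (2 * p) * (lam / 2)\<^sup>2 * (2 * C) powr (p / q)"

lemma stop_b:
  assumes stop: "s k x = k" "k \<le> m"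
  shows "(\<integral>\<^sup>+y\<in>cell k x. ennreal (b k y powr p) \<partial>M)
    \<le> (\<integral>\<^sup>+y\<in>cell k x. ennreal K * ennreal (h y powr p * u ^ (n m y - n k y)) \<partial>M)"
proof -
  define d where "d = real CARD('d)"
  let ?e = "ebase (cell k x)" and ?w = "wbase (cell k x)"
  define X where "X = (\<integral>\<^sup>+y\<in>cell k x. ennreal (h y powr p * u ^ (n m y - n k y)) \<partial>M)"
  define a where "a = (\<Sum>i\<in>UNIV. N k x (?w i) powr p)"
  have le: "b k y powr p \<le> d powr (2 * p) * a * (\<Sum>j\<in>UNIV. rho y (?e j) powr p)" if "y \<in> cell k x" for y
  proof -
    have N: "N k y = N k x" using that by (intro N_cong) (simp add: cell_def)
    have "b k y powr p = (\<Sum>i\<in>UNIV. N k x (?w i)) powr p * (\<Sum>j\<in>UNIV. rho y (?e j)) powr p"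
      unfolding b_def cell_eq[OF that] N by (simp add: powr_mult sum_nonneg)
    also have "\<dots> \<le> (d powr p * a) * (d powr p * (\<Sum>j\<in>UNIV. rho y (?e j) powr p))"
    proof (rule mult_mono)
      show "(\<Sum>i\<in>UNIV. N k x (?w i)) powr p \<le> d powr p * a"
        unfolding a_def d_def using pq by (intro sum_powr_le) auto
      show "(\<Sum>j\<in>UNIV. rho y (?e j)) powr p \<le> d powr p * (\<Sum>j\<in>UNIV. rho y (?e j) powr p)"
        unfolding d_def using pq by (intro sum_powr_le) auto
    qed (simp_all add: a_def sum_nonneg)
    also have "\<dots> = d powr (2 * p) * a * (\<Sum>j\<in>UNIV. rho y (?e j) powr p)"
      by (subst mult_2) (simp only: powr_add mult_ac)
    finally show ?thesis .
  qed
  have a: "0 \<le> a" by (simp add: a_def sum_nonneg)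
  have "(\<integral>\<^sup>+y\<in>cell k x. ennreal (b k y powr p) \<partial>M)
    \<le> (\<integral>\<^sup>+y\<in>cell k x. ennreal (d powr (2 * p) * a) * (\<Sum>j\<in>UNIV. ennreal (rho y (?e j) powr p)) \<partial>M)"
    using a le by (intro nn_integral_mono)
      (auto simp: sum_nonneg ennreal_leI simp flip: ennreal_mult split: split_indicator)
  also have "\<dots> = ennreal (d powr (2 * p) * a) * (\<Sum>j\<in>UNIV. \<integral>\<^sup>+y\<in>cell k x. ennreal (rho y (?e j) powr p) \<partial>M)"
  proof -
    have "(\<integral>\<^sup>+y\<in>cell k x. (\<Sum>j\<in>UNIV. ennreal (rho y (?e j) powr p)) \<partial>M)
        = (\<Sum>j\<in>UNIV. \<integral>\<^sup>+y\<in>cell k x. ennreal (rho y (?e j) powr p) \<partial>M)"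
      unfolding sum_distrib_right by (rule nn_integral_sum) measurable
    moreover have "(\<lambda>y. (\<Sum>j\<in>UNIV. ennreal (rho y (?e j) powr p)) * indicator (cell k x) y) \<in> borel_measurable M"
      by measurable
    ultimately show ?thesis
      unfolding mult.assoc by (simp only: nn_integral_cmult)
  qed
  also have "\<dots> \<le> ennreal (d powr (2 * p) * a) * (\<Sum>j\<in>(UNIV::'d set). emeasure M (cell k x))"
    by (intro mult_left_mono sum_mono rho_ebase) auto
  also have "\<dots> = ennreal (d powr (2 * p) * d) * (\<Sum>i\<in>UNIV. ennreal (measure M (cell k x) * N k x (?w i) powr p))"
    using a by (simp add: emeasure_cell a_def sum_distrib_left[symmetric] d_def ennreal_of_nat_eq_real_of_nat mult_ac sum_nonneg flip: ennreal_mult)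
  also have "\<dots> \<le> ennreal (d powr (2 * p) * d) * (\<Sum>i\<in>(UNIV::'d set). ennreal ((2 * C) powr (p / q)) * X)"
    unfolding X_def by (intro mult_left_mono sum_mono Hoelder_stop stop) auto
  also have "\<dots> = ennreal (d powr (2 * p) * d) * (ennreal d * (ennreal ((2 * C) powr (p / q)) * X))"
    by (simp add: d_def ennreal_of_nat_eq_real_of_nat)
  also have "\<dots> = ennreal (d powr (2 * p) * d * d * (2 * C) powr (p / q)) * X"
    by (simp add: d_def ennreal_mult mult.assoc)
  also have "\<dots> = ennreal K * X"
  proof -
    have "lam / 2 = d" by (simp add: d_def lam_def)
    then show ?thesis unfolding K_def by (simp add: power2_eq_square mult.assoc)
  qed
  also have "\<dots> = (\<integral>\<^sup>+y\<in>cell k x. ennreal K * ennreal (h y powr p * u ^ (n m y - n k y)) \<partial>M)"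
    unfolding X_def mult.assoc by (subst nn_integral_cmult) auto
  finally show ?thesis .
qed

text \<open>The exponents are the numbers of later stops, which are distinct for distinct stopping
  levels: a partial sum of the geometric series. In the induction a new stop multiplies the old sum
  by \<open>u\<close> and adds 1, and \<open>1 / (1 - u)\<close> is the fixed point of that
  map.\<close>

lemma stop_sum: "(\<Sum>k\<le>m. if s k y = k then u ^ (n m y - n k y) else 0) \<le> 1 / (1 - u)"
proof (induction m)
  case 0
  then show ?case using u by simp
next
  case (Suc m)
  define A where "A = (\<Sum>k\<le>m. if s k y = k then u ^ (n m y - n k y) else 0)"
  show ?case
  proof (cases "\<exists>v. lam * N (s m y) y v < N (Suc m) y v")
    case False
    then have "s (Suc m) y \<noteq> Suc m" "n (Suc m) y = n m y" using s_le[of m y] by auto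
    then show ?thesis using Suc by (simp del: n.simps s.simps cong: if_cong)
  next
    case True
    then have S: "s (Suc m) y = Suc m" "n (Suc m) y = Suc (n m y)" by auto
    have "(\<Sum>k\<le>m. if s k y = k then u ^ (n (Suc m) y - n k y) else 0) = u * A"
      unfolding A_def sum_distrib_left
      by (intro sum.cong) (auto simp: S Suc_diff_le n_mono simp del: n.simps s.simps)
    then have "(\<Sum>k\<le>Suc m. if s k y = k then u ^ (n (Suc m) y - n k y) else 0) = u * A + 1"
      using S by (simp del: n.simps s.simps)
    also have "\<dots> \<le> u * (1 / (1 - u)) + 1" using Suc u by (intro add_right_mono mult_left_mono) (auto simp: A_def)
    also have "\<dots> = 1 / (1 - u)" using u by (simp add: field_simps)
    finally show ?thesis .
  qed
qed

lemma B_meas [measurable]: "B \<in> borel_measurable M"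
  unfolding B_def by measurable

theorem B_integral: "(\<integral>\<^sup>+y. B y \<partial>M) \<le> ennreal (K / (1 - u)) * (\<integral>\<^sup>+y. ennreal (h y powr p) \<partial>M)"
proof -
  have K: "0 \<le> K" by (simp add: K_def)
  define f where "f k y = (if s k y = k then ennreal (b k y powr p) else 0)" for k y
  have f [measurable]: "f k \<in> borel_measurable M" for k unfolding f_def by measurable
  have fk: "(\<integral>\<^sup>+y. f k y \<partial>M) \<le> (\<integral>\<^sup>+y. ennreal K * ennreal (h y powr p) * ennreal (if s k y = k then u ^ (n m y - n k y) else 0) \<partial>M)"
    if "k \<le> m" for k m
  proof -
    have "(\<integral>\<^sup>+y. f k y \<partial>M) = (\<integral>\<^sup>+y\<in>{y. s k y = k}. ennreal (b k y powr p) \<partial>M)"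
      by (intro nn_integral_cong) (auto simp: f_def split: split_indicator)
    also have "\<dots> \<le> (\<integral>\<^sup>+y\<in>{y. s k y = k}. ennreal K * ennreal (h y powr p * u ^ (n m y - n k y)) \<partial>M)"
    proof (rule cells_integral_le[where l = k])
      have "{y \<in> space M. s k y = k} \<in> sets M" by measurable
      then show "{y. s k y = k} \<in> sets M" by simp
      show "cell k y \<subseteq> {y. s k y = k}" if "y \<in> {y. s k y = k}" for y
        using that s_cong by auto
    qed (use that stop_b in auto)
    also have "\<dots> = (\<integral>\<^sup>+y. ennreal K * ennreal (h y powr p) * ennreal (if s k y = k then u ^ (n m y - n k y) else 0) \<partial>M)"
      using u by (intro nn_integral_cong) (auto simp: ennreal_mult' mult.assoc split: split_indicator)
    finally show ?thesis .
  qed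
  \<comment> \<open>For a fixed horizon \<open>m\<close> the sum over the levels is moved inside the
    integral, where \<open>stop_sum\<close> bounds it pointwise. The bound is free of
    \<open>m\<close>, so the full series follows.\<close>
  have part: "(\<integral>\<^sup>+y. (\<Sum>k<m. f k y) \<partial>M) \<le> ennreal (K / (1 - u)) * (\<integral>\<^sup>+y. ennreal (h y powr p) \<partial>M)" for m
  proof -
    have "(\<integral>\<^sup>+y. (\<Sum>k<m. f k y) \<partial>M) \<le> (\<Sum>k\<le>m. \<integral>\<^sup>+y. f k y \<partial>M)"
      by (subst nn_integral_sum) (auto intro!: sum_mono2)
    also have "\<dots> \<le> (\<Sum>k\<le>m. \<integral>\<^sup>+y. ennreal K * ennreal (h y powr p) * ennreal (if s k y = k then u ^ (n m y - n k y) else 0) \<partial>M)"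
      by (intro sum_mono fk) auto
    also have "\<dots> = (\<integral>\<^sup>+y. ennreal K * ennreal (h y powr p) * (\<Sum>k\<le>m. ennreal (if s k y = k then u ^ (n m y - n k y) else 0)) \<partial>M)"
      unfolding sum_distrib_left by (subst nn_integral_sum) auto
    also have "\<dots> \<le> (\<integral>\<^sup>+y. ennreal K * ennreal (h y powr p) * ennreal (1 / (1 - u)) \<partial>M)"
    proof (intro nn_integral_mono mult_left_mono)
      fix y
      have "(\<Sum>k\<le>m. ennreal (if s k y = k then u ^ (n m y - n k y) else 0)) = ennreal (\<Sum>k\<le>m. if s k y = k then u ^ (n m y - n k y) else 0)"
        using u by (intro sum_ennreal) auto
      also have "\<dots> \<le> ennreal (1 / (1 - u))" by (intro ennreal_leI stop_sum)
      finally show "(\<Sum>k\<le>m. ennreal (if s k y = k then u ^ (n m y - n k y) else 0)) \<le> ennreal (1 / (1 - u))" .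
    qed auto
    also have "\<dots> = (\<integral>\<^sup>+y. ennreal (K / (1 - u)) * ennreal (h y powr p) \<partial>M)"
      using K u by (intro nn_integral_cong) (simp add: mult_ac flip: ennreal_mult)
    finally show ?thesis by (simp add: nn_integral_cmult)
  qed
  have "(\<integral>\<^sup>+y. B y \<partial>M) = (\<Sum>k. \<integral>\<^sup>+y. f k y \<partial>M)"
    unfolding B_def f_def[symmetric] by (rule nn_integral_suminf) auto
  also have "\<dots> = (SUP m. \<Sum>k<m. \<integral>\<^sup>+y. f k y \<partial>M)" by (rule suminf_eq_SUP)
  also have "\<dots> \<le> ennreal (K / (1 - u)) * (\<integral>\<^sup>+y. ennreal (h y powr p) \<partial>M)"
    using part by (intro SUP_least) (simp add: nn_integral_sum)
  finally show ?thesis .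
qed

end

section \<open>Dual norms\<close>

definition dual :: "(real^'d \<Rightarrow> real) \<Rightarrow> real^'d \<Rightarrow> real" where
  "dual q w = enn2real (dual_norm (\<lambda>v. ennreal (q v)) w)"

lemma dual_norm_le:
  fixes q :: "real^'d \<Rightarrow> real"
  assumes q: "is_norm q" and a: "0 \<le> a" and le: "\<And>v. \<bar>v \<bullet> w\<bar> \<le> a * q v"
  shows "dual_norm (\<lambda>v. ennreal (q v)) w \<le> ennreal a"
  unfolding dual_norm_def
proof (rule SUP_least)
  fix v :: "real^'d" assume "v \<in> - {0}"
  then have "0 < q v" using is_normD(8)[OF q] by simp
  then show "ennreal \<bar>w \<bullet> v\<bar> / ennreal (q v) \<le> ennreal a"
    using le[of v] by (simp add: divide_ennreal inner_commute[of w] ennreal_leI field_simps)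
qed

lemma dual_norm_eq:
  fixes q :: "real^'d \<Rightarrow> real"
  assumes q: "is_norm q" shows "dual_norm (\<lambda>v. ennreal (q v)) w = ennreal (dual q w)"
proof -
  obtain c where c: "0 < c" "\<And>v. c * norm v \<le> q v" by (rule is_norm_ge[OF q]) blast
  have "dual_norm (\<lambda>v. ennreal (q v)) w \<le> ennreal (norm w / c)"
  proof (rule dual_norm_le[OF q])
    fix v
    have "\<bar>v \<bullet> w\<bar> \<le> norm v * norm w" by (rule Cauchy_Schwarz_ineq2)
    also have "\<dots> = norm w / c * (c * norm v)" using c by simp
    also have "\<dots> \<le> norm w / c * q v" using c by (intro mult_left_mono) auto
    finally show "\<bar>v \<bullet> w\<bar> \<le> norm w / c * q v" .
  qed (use c in simp)
  then have "dual_norm (\<lambda>v. ennreal (q v)) w < top" by (rule order.strict_trans1) simp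
  then show ?thesis by (simp add: dual_def)
qed

lemma dual_nonneg [simp]: "0 \<le> dual q w" by (simp add: dual_def)

lemma dual_bound:
  fixes q :: "real^'d \<Rightarrow> real"
  assumes q: "is_norm q" shows "\<bar>v \<bullet> w\<bar> \<le> q v * dual q w"
proof (cases "v = 0")
  case False
  then have pos: "0 < q v" using is_normD(8)[OF q] by simp
  have "ennreal \<bar>w \<bullet> v\<bar> / ennreal (q v) \<le> dual_norm (\<lambda>v. ennreal (q v)) w"
    unfolding dual_norm_def using False by (intro SUP_upper) simp
  then show ?thesis
    using pos by (simp add: dual_norm_eq[OF q] divide_ennreal inner_commute[of w] field_simps)
qed (simp add: is_normD(5)[OF q])

lemma dual_le:
  fixes q :: "real^'d \<Rightarrow> real"
  assumes q: "is_norm q" and "0 \<le> a" "\<And>v. \<bar>v \<bullet> w\<bar> \<le> a * q v" shows "dual q w \<le> a"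
  using dual_norm_le[OF assms] assms(2) by (simp add: dual_norm_eq[OF q])

lemma dual_le_iff:
  fixes q :: "real^'d \<Rightarrow> real"
  assumes q: "is_norm q" and "0 \<le> a" shows "dual q w \<le> a \<longleftrightarrow> (\<forall>v. \<bar>v \<bullet> w\<bar> \<le> a * q v)"
proof (intro iffI allI)
  fix v assume "dual q w \<le> a"
  then have "q v * dual q w \<le> q v * a" by (intro mult_left_mono is_normD(1)[OF q])
  then show "\<bar>v \<bullet> w\<bar> \<le> a * q v" using dual_bound[OF q, of v w] by (simp add: mult.commute)
qed (use assms dual_le in blast)

lemma is_norm_dual:
  fixes q :: "real^'d \<Rightarrow> real"
  assumes q: "is_norm q" shows "is_norm (dual q)"
  unfolding is_norm_def
proof (intro conjI allI)
  fix v w :: "real^'d" and a :: real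
  show "0 \<le> dual q v" by simp
  have z: "dual q 0 = 0" using dual_le[OF q, of 0 0] dual_nonneg[of q 0] by simp
  show "dual q v = 0 \<longleftrightarrow> v = 0"
  proof
    assume "dual q v = 0"
    then have "v \<bullet> v = 0" using dual_bound[OF q, of v v] inner_ge_zero[of v] by simp
    then show "v = 0" by simp
  qed (simp add: z)
  have le: "dual q (a *\<^sub>R v) \<le> \<bar>a\<bar> * dual q v" for a v
    using dual_bound[OF q, of _ v]
    by (intro dual_le[OF q]) (auto simp: abs_mult mult.assoc mult.commute[of "dual q v"] intro!: mult_left_mono)
  show "dual q (a *\<^sub>R v) = \<bar>a\<bar> * dual q v"
  proof (cases "a = 0")
    case False
    have "dual q v = dual q ((1 / a) *\<^sub>R (a *\<^sub>R v))" using False by simp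
    also have "\<dots> \<le> \<bar>1 / a\<bar> * dual q (a *\<^sub>R v)" by (rule le)
    finally have "\<bar>a\<bar> * dual q v \<le> dual q (a *\<^sub>R v)" using False by (simp add: field_simps)
    then show ?thesis using le[of a v] by simp
  qed (simp add: z)
  show "dual q (v + w) \<le> dual q v + dual q w"
  proof (rule dual_le[OF q])
    fix u
    have "\<bar>u \<bullet> (v + w)\<bar> \<le> \<bar>u \<bullet> v\<bar> + \<bar>u \<bullet> w\<bar>" by (simp add: inner_add_right)
    also have "\<dots> \<le> (dual q v + dual q w) * q u"
      using dual_bound[OF q, of u v] dual_bound[OF q, of u w] by (simp add: algebra_simps)
    finally show "\<bar>u \<bullet> (v + w)\<bar> \<le> (dual q v + dual q w) * q u" .
  qed simp
qed

text \<open>By continuity of the norm, the inequality that describes a sublevel set need only be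
  tested on a countable dense set of vectors.\<close>

lemma measurable_dual:
  fixes \<rho> :: "'x \<Rightarrow> real^'d \<Rightarrow> real"
  assumes norm: "\<And>x. is_norm (\<rho> x)" and [measurable]: "\<And>v. (\<lambda>x. \<rho> x v) \<in> borel_measurable M"
  shows "(\<lambda>x. dual (\<rho> x) w) \<in> borel_measurable M"
proof (rule borel_measurableI_le)
  fix a :: real
  obtain A :: "(real^'d) set" where A: "countable A" "closure A = UNIV"
    using separable[of UNIV] by (metis equalityI subset_UNIV)
  show "{x \<in> space M. dual (\<rho> x) w \<le> a} \<in> sets M"
  proof (cases "0 \<le> a")
    case False
    then have "\<not> dual (\<rho> x) w \<le> a" for x using order.trans[OF dual_nonneg] by blast
    then have "{x \<in> space M. dual (\<rho> x) w \<le> a} = {}" by auto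
    then show ?thesis by (simp only: sets.empty_sets)
  next
    case True
    have "(\<forall>v. \<bar>v \<bullet> w\<bar> \<le> a * \<rho> x v) \<longleftrightarrow> (\<forall>v\<in>A. \<bar>v \<bullet> w\<bar> \<le> a * \<rho> x v)" for x
    proof
      assume "\<forall>v\<in>A. \<bar>v \<bullet> w\<bar> \<le> a * \<rho> x v"
      then have "A \<subseteq> {v. \<bar>v \<bullet> w\<bar> \<le> a * \<rho> x v}" by auto
      moreover have "closed {v. \<bar>v \<bullet> w\<bar> \<le> a * \<rho> x v}"
        by (intro closed_Collect_le continuous_intros is_norm_continuous_on[OF norm])
      ultimately show "\<forall>v. \<bar>v \<bullet> w\<bar> \<le> a * \<rho> x v"
        using closure_minimal[of A] A(2) by auto
    qed auto
    then have "{x \<in> space M. dual (\<rho> x) w \<le> a} = {x \<in> space M. \<forall>v\<in>A. \<bar>v \<bullet> w\<bar> \<le> a * \<rho> x v}"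
      using dual_le_iff[OF norm True] by auto
    also have "\<dots> \<in> sets M" using A(1) by measurable
    finally show ?thesis .
  qed
qed

text \<open>One inequality for scaling suffices: applied to the inverse factor it gives the
  other.\<close>

lemma is_norm_enn2real:
  assumes sc: "\<And>a v. A (a *\<^sub>R v) \<le> ennreal \<bar>a\<bar> * A v" and tri: "\<And>v w. A (v + w) \<le> A v + A w"
    and fin: "\<And>v. A v < \<infinity>" and pos: "\<And>v. A v = 0 \<Longrightarrow> v = 0"
  shows "is_norm (\<lambda>v. enn2real (A v))"
proof -
  have e: "A v = ennreal (enn2real (A v))" for v using fin[of v] by simp
  have A0: "A 0 = 0" using sc[of 0 0] by simp
  have sc': "A (a *\<^sub>R v) = ennreal \<bar>a\<bar> * A v" for a v
  proof (cases "a = 0")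
    case False
    have "ennreal \<bar>a\<bar> * A v = ennreal \<bar>a\<bar> * A ((1 / a) *\<^sub>R (a *\<^sub>R v))" using False by simp
    also have "\<dots> \<le> ennreal \<bar>a\<bar> * (ennreal \<bar>1 / a\<bar> * A (a *\<^sub>R v))" by (intro mult_left_mono sc) simp
    also have "\<dots> = A (a *\<^sub>R v)" using False by (simp flip: mult.assoc ennreal_mult)
    finally show ?thesis using sc[of a v] by (intro antisym)
  qed (simp add: A0)
  have "enn2real (A (v + w)) \<le> enn2real (A v) + enn2real (A w)" for v w
    using tri[of v w] e[of v] e[of w] e[of "v + w"]
    by (metis enn2real_nonneg ennreal_le_iff ennreal_plus add_nonneg_nonneg)
  moreover have "enn2real (A v) = 0 \<longleftrightarrow> v = 0" for v
    using pos[of v] e[of v] A0 by (metis ennreal_0 enn2real_0)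
  ultimately show ?thesis unfolding is_norm_def by (auto simp: sc' enn2real_mult)
qed

section \<open>Consequences of the Muckenhoupt condition\<close>

lemma emeasure_cube:
  assumes "0 \<le> l" shows "emeasure lebesgue (box a (\<chi> i. a $ i + l) :: (real^'n) set) = ennreal (l ^ CARD('n))"
proof -
  have b: "a \<bullet> b \<le> (\<chi> i. a $ i + l) \<bullet> b \<and> ((\<chi> i. a $ i + l) - a) \<bullet> b = l" if "b \<in> Basis" for b
    using that assms by (auto simp: Basis_vec_def inner_axis)
  have "emeasure lebesgue (box a (\<chi> i. a $ i + l)) = emeasure lborel (box a (\<chi> i. a $ i + l))"
    by simp
  also have "\<dots> = (\<Prod>b\<in>Basis. ((\<chi> i. a $ i + l) - a) \<bullet> b)"
    by (rule emeasure_lborel_box) (use b in auto)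
  also have "(\<Prod>b\<in>Basis. ((\<chi> i. a $ i + l) - a) \<bullet> b) = (\<Prod>b\<in>(Basis :: (real^'n) set). l)"
    by (rule prod.cong) (use b in auto)
  finally show ?thesis by simp
qed

lemma cubes_measurable [measurable, simp]: "Q \<in> cubes \<Longrightarrow> Q \<in> sets lebesgue"
  by (auto simp: cubes_def)

lemma open_cubes: "Q \<in> cubes \<Longrightarrow> open Q"
  by (auto simp: cubes_def open_box)

lemma cubes_emeasure:
  assumes "Q \<in> cubes"
  shows "emeasure lebesgue Q = ennreal (measure lebesgue Q)" "0 < measure lebesgue Q"
proof -
  from assms obtain a l where Q: "Q = box a (\<chi> i. a $ i + l)" and l: "0 < l"
    by (auto simp: cubes_def)
  have e: "emeasure lebesgue Q = ennreal (l ^ CARD('a))" unfolding Q by (rule emeasure_cube) (use l in simp)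
  then have "measure lebesgue Q = l ^ CARD('a)" using l by (simp add: measure_def)
  then show "emeasure lebesgue Q = ennreal (measure lebesgue Q)" "0 < measure lebesgue Q"
    using e l by simp_all
qed

lemma conj_exponent_ennreal:
  assumes "1 < r" shows "conj_exponent (ennreal r) = ennreal (r / (r - 1))"
proof -
  have "1 - inverse (ennreal r) = ennreal (1 - 1 / r)"
    using assms by (simp add: inverse_ennreal inverse_eq_divide ennreal_minus flip: ennreal_1)
  then have "conj_exponent (ennreal r) = ennreal (1 / (1 - 1 / r))"
    using assms by (simp add: conj_exponent_def inverse_ennreal inverse_eq_divide)
  also have "1 / (1 - 1 / r) = r / (r - 1)" using assms by (simp add: field_simps)
  finally show ?thesis .
qed

locale Ap_setting =
  fixes \<rho> :: "real^'n \<Rightarrow> real^'d \<Rightarrow> real" and p :: ennreal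
  assumes p: "1 < p" and Ap: "Ap_norm p \<rho>"
begin

definition D :: "real^'n \<Rightarrow> real^'d \<Rightarrow> real" where "D x = dual (\<rho> x)"

lemma \<rho>_norm: "is_norm (\<rho> x)"
  using Ap by (simp add: Ap_norm_def norm_function_def)

lemma \<rho>_meas [measurable]: "(\<lambda>x. \<rho> x v) \<in> borel_measurable lebesgue"
  using Ap by (simp add: Ap_norm_def norm_function_def)

lemma \<rho>_nn [simp]: "0 \<le> \<rho> x v" by (rule is_normD(1)[OF \<rho>_norm])

lemma D_norm: "is_norm (D x)" unfolding D_def by (intro is_norm_dual \<rho>_norm)

lemma D_meas [measurable]: "(\<lambda>x. D x v) \<in> borel_measurable lebesgue"
  unfolding D_def by (intro measurable_dual \<rho>_norm) auto

lemma D_nn [simp]: "0 \<le> D x v" by (rule is_normD(1)[OF D_norm])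

lemma inner_le: "\<bar>v \<bullet> w\<bar> \<le> \<rho> x v * D x w" unfolding D_def by (rule dual_bound[OF \<rho>_norm])

definition AQ :: "(real^'n) set \<Rightarrow> real^'d \<Rightarrow> ennreal" where
  "AQ Q v = avg_norm p Q (\<lambda>x w. ennreal (\<rho> x w)) v"

definition R :: "(real^'n) set \<Rightarrow> real^'d \<Rightarrow> real" where
  "R Q v = enn2real (AQ Q v)"

lemma AQ_fin: "Q \<in> cubes \<Longrightarrow> AQ Q v < \<infinity>"
  using Ap by (auto simp: Ap_norm_def AQ_def)

lemma AQ_R: "Q \<in> cubes \<Longrightarrow> AQ Q v = ennreal (R Q v)"
  using AQ_fin[of Q v] by (simp add: R_def)

text \<open>The triangle inequality comes from Minkowski's inequality or from essential suprema,
  definiteness from the positive measure of a cube.\<close>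

lemma R_norm: 
  assumes Q: "Q \<in> cubes" shows "is_norm (R Q)"
proof -
  have contra: False if "AE x in lebesgue. x \<notin> Q"
  proof -
    have "emeasure lebesgue Q = 0" using that Q by (subst (asm) AE_iff_measurable[of Q]) auto
    then show False using cubes_emeasure[OF Q] by simp
  qed
  have "is_norm (\<lambda>v. enn2real (AQ Q v))"
  proof (cases "p = top")
    case True
    let ?M = "restrict_space lebesgue Q"
    have A: "AQ Q v = esssup ?M (\<lambda>x. ennreal (\<rho> x v))" for v
      using True unfolding AQ_def avg_norm_def Lp_avg_def by simp
    have meas [measurable]: "(\<lambda>x. ennreal (\<rho> x v)) \<in> borel_measurable ?M" for v
      by (intro measurable_restrict_space1) auto
    show ?thesis
    proof (rule is_norm_enn2real)
      show "AQ Q v < \<infinity>" for v using AQ_fin[OF Q] .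
      have "AE x in ?M. ennreal (\<rho> x (a *\<^sub>R v)) \<le> ennreal \<bar>a\<bar> * AQ Q v" for a v
        using esssup_AE[of "\<lambda>x. ennreal (\<rho> x v)" ?M]
        by eventually_elim (simp add: is_normD(3)[OF \<rho>_norm] ennreal_mult A mult_left_mono)
      then show "AQ Q (a *\<^sub>R v) \<le> ennreal \<bar>a\<bar> * AQ Q v" for a v
        unfolding A[of "a *\<^sub>R v"] by (intro esssup_I meas)
      have "AE x in ?M. ennreal (\<rho> x (v + w)) \<le> AQ Q v + AQ Q w" for v w
        using esssup_AE[of "\<lambda>x. ennreal (\<rho> x v)" ?M] esssup_AE[of "\<lambda>x. ennreal (\<rho> x w)" ?M]
      proof eventually_elim
        case (elim x)
        have "ennreal (\<rho> x (v + w)) \<le> ennreal (\<rho> x v) + ennreal (\<rho> x w)"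
          by (simp add: is_normD(4)[OF \<rho>_norm] flip: ennreal_plus)
        also have "\<dots> \<le> AQ Q v + AQ Q w" unfolding A by (intro add_mono elim)
        finally show ?case .
      qed
      then show "AQ Q (v + w) \<le> AQ Q v + AQ Q w" for v w
        unfolding A[of "v + w"] by (intro esssup_I meas)
      show "v = 0" if "AQ Q v = 0" for v
      proof (rule ccontr)
        assume "v \<noteq> 0"
        then have pos: "0 < \<rho> x v" for x by (rule is_normD(8)[OF \<rho>_norm])
        have "AE x in ?M. ennreal (\<rho> x v) \<le> 0"
          using esssup_AE[of "\<lambda>x. ennreal (\<rho> x v)" ?M] that by (simp only: A)
        then have "AE x in ?M. False"
          by eventually_elim (use pos in \<open>simp add: ennreal_eq_0_iff not_le[symmetric]\<close>)
        then show False
          using contra by (subst (asm) AE_restrict_space_iff) (use Q in auto)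
      qed
    qed
  next
    case False
    define P where "P = enn2real p"
    have P: "1 < P" unfolding P_def using p False by (rule exponent_real)
    define \<kappa> where "\<kappa> = ennreal_powr (ennreal (1 / measure lebesgue Q)) (1 / P)"
    have \<kappa>: "\<kappa> \<noteq> 0" using cubes_emeasure[OF Q] by (simp add: \<kappa>_def)
    define f where "f v x = ennreal (\<rho> x v) * indicator Q x" for v x
    have [measurable]: "f v \<in> borel_measurable lebesgue" for v unfolding f_def using Q by measurable
    have A: "AQ Q v = \<kappa> * ennreal_powr (\<integral>\<^sup>+x. ennreal_powr (f v x) P \<partial>lebesgue) (1 / P)" for v
    proof -
      have "(\<integral>\<^sup>+x\<in>Q. ennreal_powr (ennreal (\<rho> x v)) P \<partial>lebesgue) = (\<integral>\<^sup>+x. ennreal_powr (f v x) P \<partial>lebesgue)"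
        by (intro nn_integral_cong) (auto simp: f_def split: split_indicator)
      moreover have "y / emeasure lebesgue Q = ennreal (1 / measure lebesgue Q) * y" for y
        using cubes_emeasure[OF Q] by (simp add: divide_ennreal_def inverse_ennreal inverse_eq_divide mult.commute)
      ultimately show ?thesis
        using False by (simp add: AQ_def avg_norm_def Lp_avg_def P_def \<kappa>_def ennreal_powr_mult)
    qed
    show ?thesis
    proof (rule is_norm_enn2real)
      show "AQ Q v < \<infinity>" for v using AQ_fin[OF Q] .
      show "AQ Q (a *\<^sub>R v) \<le> ennreal \<bar>a\<bar> * AQ Q v" for a v
      proof -
        have "f (a *\<^sub>R v) x = ennreal \<bar>a\<bar> * f v x" for x
          by (simp add: f_def is_normD(3)[OF \<rho>_norm] ennreal_mult mult.assoc)
        then show ?thesis using P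
          by (simp add: A ennreal_powr_mult nn_integral_cmult ennreal_powr_powr mult_ac)
      qed
      show "AQ Q (v + w) \<le> AQ Q v + AQ Q w" for v w
      proof -
        have "f (v + w) x \<le> f v x + f w x" for x
          by (auto simp: f_def is_normD(4)[OF \<rho>_norm] split: split_indicator simp flip: ennreal_plus)
        then have "ennreal_powr (\<integral>\<^sup>+x. ennreal_powr (f (v + w) x) P \<partial>lebesgue) (1 / P)
          \<le> ennreal_powr (\<integral>\<^sup>+x. ennreal_powr (f v x + f w x) P \<partial>lebesgue) (1 / P)"
          using P by (intro ennreal_powr_mono nn_integral_mono) auto
        also have "\<dots> \<le> ennreal_powr (\<integral>\<^sup>+x. ennreal_powr (f v x) P \<partial>lebesgue) (1 / P)
           + ennreal_powr (\<integral>\<^sup>+x. ennreal_powr (f w x) P \<partial>lebesgue) (1 / P)"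
          using P by (intro nn_integral_Minkowski) auto
        finally show ?thesis unfolding A distrib_left[symmetric] by (rule mult_left_mono) simp
      qed
      show "v = 0" if "AQ Q v = 0" for v
      proof (rule ccontr)
        assume "v \<noteq> 0"
        then have pos: "0 < \<rho> x v" for x by (rule is_normD(8)[OF \<rho>_norm])
        have "(\<integral>\<^sup>+x. ennreal_powr (f v x) P \<partial>lebesgue) = 0" using that \<kappa> by (simp add: A)
        then have "AE x in lebesgue. f v x = 0"
          by (subst (asm) nn_integral_0_iff_AE) auto
        then have "AE x in lebesgue. x \<notin> Q"
        proof eventually_elim
          case (elim x)
          then show ?case using pos[of x] by (auto simp: f_def split: split_indicator_asm)
        qed
        then show False by (rule contra)
      qed
    qed
  qed
  then show ?thesis by (simp add: R_def[abs_def])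
qed

lemma dual_AQ: "Q \<in> cubes \<Longrightarrow> dual_norm (avg_norm p Q (\<lambda>x w. ennreal (\<rho> x w))) v = ennreal (dual (R Q) v)"
  using dual_norm_eq[OF R_norm, of Q v] AQ_R[of Q] unfolding AQ_def by presburger

lemma Ap_const:
  obtains C where "0 \<le> C" "\<And>Q v. Q \<in> cubes \<Longrightarrow>
    avg_norm (conj_exponent p) Q (\<lambda>x w. ennreal (D x w)) v \<le> ennreal (C * dual (R Q) v)"
proof -
  obtain C0 where C0: "\<And>Q v. Q \<in> cubes \<Longrightarrow>
      avg_norm (conj_exponent p) Q (\<lambda>x. dual_norm (\<lambda>w. ennreal (\<rho> x w))) v
          \<le> ennreal C0 * dual_norm (avg_norm p Q (\<lambda>x w. ennreal (\<rho> x w))) v"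
    using Ap unfolding Ap_norm_def by blast
  have "(\<lambda>x. dual_norm (\<lambda>w. ennreal (\<rho> x w))) = (\<lambda>x w. ennreal (D x w))"
    by (simp add: dual_norm_eq[OF \<rho>_norm] D_def fun_eq_iff)
  \<comment> \<open>The constant in the definition may be negative; \<open>ennreal\<close> sends
    such a constant to 0, hence \<open>max 0 C0\<close>.\<close>
  then have "avg_norm (conj_exponent p) Q (\<lambda>x w. ennreal (D x w)) v \<le> ennreal (max 0 C0 * dual (R Q) v)"
    if "Q \<in> cubes" for Q v
    using C0[OF that, of v] \<open>_ = (\<lambda>x w. ennreal (D x w))\<close>
    by (cases "0 \<le> C0") (simp_all add: dual_AQ[OF that] ennreal_mult ennreal_neg)
  then show ?thesis using that[of "max 0 C0"] by simp
qed

text \<open>For \<open>p = top\<close> this is the default value 0, so statements about it are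
  guarded by \<open>p \<noteq> top\<close>; the real conjugate exponent \<open>q\<close> is 1 in
  that case.\<close>

definition P :: real where "P = enn2real p"
definition q :: real where "q = enn2real (conj_exponent p)"

lemma conj_top: "conj_exponent top = 1"
  by (simp add: conj_exponent_def)

lemma q_top: "p = top \<Longrightarrow> q = 1"
  unfolding q_def by (simp add: conj_top)

lemma P_gt: "p \<noteq> top \<Longrightarrow> 1 < P"
  unfolding P_def using p by (rule exponent_real)

lemma conj_finite:
  assumes "p \<noteq> top"
  shows "conj_exponent p = ennreal (P / (P - 1))" "q = P / (P - 1)" "1 < q" "1 / P + 1 / q = 1"
proof -
  note P = P_gt[OF assms]
  have "p = ennreal P" using assms by (simp add: P_def less_top)
  then show c: "conj_exponent p = ennreal (P / (P - 1))"
    using conj_exponent_ennreal[OF P] by metis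
  show q: "q = P / (P - 1)" unfolding q_def c using P by simp
  show "1 < q" "1 / P + 1 / q = 1" unfolding q using P by (auto simp: field_simps)
qed

abbreviation \<sigma> :: "(real^'n) set \<Rightarrow> real^'d \<Rightarrow> ennreal" where
  "\<sigma> A v \<equiv> \<integral>\<^sup>+y\<in>A. ennreal (D y v powr q) \<partial>lebesgue"

lemma q_ge: "1 \<le> q" "0 < q"
  using q_top conj_finite(3) by (cases "p = top"; simp)+

lemma conj_q: "conj_exponent p = ennreal q" "conj_exponent p \<noteq> top"
proof -
  show *: "conj_exponent p = ennreal q"
  proof (cases "p = top")
    case True
    then show ?thesis using conj_top q_top by (metis ennreal_1)
  qed (simp add: conj_finite)
  show "conj_exponent p \<noteq> top" by (simp add: *)
qed

lemma set_avg_le_iff: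
  assumes Q: "Q \<in> cubes" and r: "0 < r" and a: "0 \<le> a"
  shows "ennreal_powr (X / emeasure lebesgue Q) (1 / r) \<le> ennreal a \<longleftrightarrow> X \<le> ennreal (a powr r * measure lebesgue Q)"
proof -
  have m: "emeasure lebesgue Q \<noteq> 0" "emeasure lebesgue Q \<noteq> top" using cubes_emeasure[OF Q] by auto
  have "ennreal_powr (X / emeasure lebesgue Q) (1 / r) \<le> ennreal a
    \<longleftrightarrow> X / emeasure lebesgue Q \<le> ennreal (a powr r)"
    using r a by (simp add: ennreal_powr_le_iff ennreal_powr_ennreal)
  also have "\<dots> \<longleftrightarrow> X \<le> ennreal (a powr r) * emeasure lebesgue Q"
  proof
    assume "X / emeasure lebesgue Q \<le> ennreal (a powr r)"
    then have "X / emeasure lebesgue Q * emeasure lebesgue Q \<le> ennreal (a powr r) * emeasure lebesgue Q"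
      by (rule mult_right_mono) simp
    then show "X \<le> ennreal (a powr r) * emeasure lebesgue Q"
      using m by (simp add: ennreal_divide_times ennreal_divide_self less_top)
  next
    assume "X \<le> ennreal (a powr r) * emeasure lebesgue Q"
    then have "X / emeasure lebesgue Q \<le> ennreal (a powr r) * emeasure lebesgue Q / emeasure lebesgue Q"
      by (rule divide_right_mono_ennreal)
    then show "X / emeasure lebesgue Q \<le> ennreal (a powr r)"
      using m by (simp add: ennreal_mult_divide_eq)
  qed
  also have "ennreal (a powr r) * emeasure lebesgue Q = ennreal (a powr r * measure lebesgue Q)"
    using cubes_emeasure[OF Q] by (simp add: ennreal_mult)
  finally show ?thesis .
qed

lemma D_int_le:
  obtains C where "0 \<le> C" "\<And>Q v. Q \<in> cubes \<Longrightarrow>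
    (\<sigma> Q v) \<le> ennreal ((C * dual (R Q) v) powr q * measure lebesgue Q)"
proof -
  obtain C where C: "0 \<le> C" "\<And>Q v. Q \<in> cubes \<Longrightarrow>
    avg_norm (conj_exponent p) Q (\<lambda>x w. ennreal (D x w)) v \<le> ennreal (C * dual (R Q) v)"
    by (rule Ap_const) blast
  have "\<sigma> Q v \<le> ennreal ((C * dual (R Q) v) powr q * measure lebesgue Q)"
    if Q: "Q \<in> cubes" for Q v
  proof -
    have "avg_norm (conj_exponent p) Q (\<lambda>x w. ennreal (D x w)) v
      = ennreal_powr ((\<sigma> Q v) / emeasure lebesgue Q) (1 / q)"
      using conj_q(2) q_ge by (simp add: avg_norm_def Lp_avg_def q_def[symmetric] ennreal_powr_ennreal)
    then show ?thesis
      using C(2)[OF Q, of v] set_avg_le_iff[OF Q q_ge(2)] C(1) by simp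
  qed
  then show ?thesis using that C(1) by blast
qed

lemma rho_int:
  assumes Q: "Q \<in> cubes" and fin: "p \<noteq> top"
  shows "(\<integral>\<^sup>+x\<in>Q. ennreal (\<rho> x v powr P) \<partial>lebesgue) \<le> ennreal (R Q v powr P * measure lebesgue Q)"
proof -
  have "ennreal_powr ((\<integral>\<^sup>+x\<in>Q. ennreal (\<rho> x v powr P) \<partial>lebesgue) / emeasure lebesgue Q) (1 / P) = AQ Q v"
    using fin unfolding AQ_def avg_norm_def Lp_avg_def by (simp add: P_def[symmetric] ennreal_powr_ennreal)
  then show ?thesis
    using AQ_R[OF Q, of v] P_gt[OF fin] is_normD(1)[OF R_norm[OF Q], of v]
    by (subst set_avg_le_iff[OF Q, symmetric]) auto
qed

lemma rho_AE:
  assumes Q: "Q \<in> cubes" and top: "p = top"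
  shows "AE x in lebesgue. x \<in> Q \<longrightarrow> \<rho> x v \<le> R Q v"
proof -
  let ?M = "restrict_space lebesgue Q"
  have "AE x in ?M. ennreal (\<rho> x v) \<le> AQ Q v"
    using top esssup_AE[of "\<lambda>x. ennreal (\<rho> x v)" ?M] unfolding AQ_def avg_norm_def Lp_avg_def by simp
  then have "AE x in ?M. \<rho> x v \<le> R Q v"
    using is_normD(1)[OF R_norm[OF Q], of v] by (simp add: AQ_R[OF Q])
  then show ?thesis
    by (subst (asm) AE_restrict_space_iff) (use Q in auto)
qed

lemma dual_base_le:
  assumes "is_norm N" "\<And>v. \<bar>v \<bullet> w\<bar> \<le> N v" shows "dual N w \<le> 1"
  using assms by (intro dual_le) auto

text \<open>The cubes are open and the dyadic cells half-open, hence the null set.\<close>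

definition cube_ae :: "(real^'n) set \<Rightarrow> bool" where
  "cube_ae Q \<longleftrightarrow> Q \<in> sets lebesgue \<and> (\<exists>Q0\<in>cubes. AE x in lebesgue. x \<in> Q \<longleftrightarrow> x \<in> Q0)"

lemma cube_ae_cong:
  assumes "AE x in lebesgue. x \<in> Q \<longleftrightarrow> x \<in> Q0" "Q \<in> sets lebesgue" "Q0 \<in> sets lebesgue"
  shows "(\<integral>\<^sup>+x\<in>Q. f x \<partial>lebesgue) = (\<integral>\<^sup>+x\<in>Q0. f x \<partial>lebesgue)" "emeasure lebesgue Q = emeasure lebesgue Q0"
proof -
  show "(\<integral>\<^sup>+x\<in>Q. f x \<partial>lebesgue) = (\<integral>\<^sup>+x\<in>Q0. f x \<partial>lebesgue)"
    using assms(1) by (intro nn_integral_cong_AE) (auto split: split_indicator)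
  show "emeasure lebesgue Q = emeasure lebesgue Q0"
    by (rule emeasure_eq_AE) (use assms in auto)
qed

text \<open>An Auerbach basis of \<open>R Q\<close> is normalised for the average of
  \<open>\<rho>\<close>, and its coordinate vectors have dual norm at most 1. The
  \<open>A\<^sub>p\<close> condition turns the latter into a bound for the averages of the pointwise
  dual norms.\<close>

lemma basis_exists:
  obtains C where "0 \<le> C" "\<And>Q. cube_ae Q \<Longrightarrow> \<exists>e w :: 'd \<Rightarrow> real^'d. (\<forall>u. u = (\<Sum>i\<in>UNIV. (u \<bullet> w i) *\<^sub>R e i)) \<and>
       (\<forall>i. if p = top then (AE x in lebesgue. x \<in> Q \<longrightarrow> \<rho> x (e i) \<le> 1)
          else (\<integral>\<^sup>+y\<in>Q. ennreal (\<rho> y (e i) powr P) \<partial>lebesgue) \<le> emeasure lebesgue Q) \<and>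
       (\<forall>i. (\<sigma> Q (w i)) \<le> ennreal C * emeasure lebesgue Q)"
proof -
  obtain C where C: "0 \<le> C" "\<And>Q v. Q \<in> cubes \<Longrightarrow>
    (\<sigma> Q v) \<le> ennreal ((C * dual (R Q) v) powr q * measure lebesgue Q)"
    by (rule D_int_le) blast
  show ?thesis
  proof
    show "0 \<le> C powr q" by simp
    fix Q assume "cube_ae Q"
    then obtain Q0 where Q0: "Q0 \<in> cubes" "AE x in lebesgue. x \<in> Q \<longleftrightarrow> x \<in> Q0" and Q: "Q \<in> sets lebesgue"
      by (auto simp: cube_ae_def)
    note cong = cube_ae_cong[OF Q0(2) Q cubes_measurable[OF Q0(1)]]
    obtain e w :: "'d \<Rightarrow> real^'d" where ew: "\<And>i. R Q0 (e i) \<le> 1" "\<And>i v. \<bar>v \<bullet> w i\<bar> \<le> R Q0 v"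
        "\<And>v. v = (\<Sum>i\<in>UNIV. (v \<bullet> w i) *\<^sub>R e i)"
      by (rule Auerbach[OF R_norm[OF Q0(1)]]) blast
    have m: "emeasure lebesgue Q0 = ennreal (measure lebesgue Q0)" "0 < measure lebesgue Q0"
      using cubes_emeasure[OF Q0(1)] .
    have 1: "AE x in lebesgue. x \<in> Q \<longrightarrow> \<rho> x (e i) \<le> 1" if "p = top" for i
      using rho_AE[OF Q0(1) that, of "e i"] Q0(2) by eventually_elim (use ew(1)[of i] in auto)
    have 2: "(\<integral>\<^sup>+y\<in>Q. ennreal (\<rho> y (e i) powr P) \<partial>lebesgue) \<le> emeasure lebesgue Q" if "p \<noteq> top" for i
    proof -
      have "R Q0 (e i) powr P \<le> 1 powr P"
        using ew(1)[of i] P_gt[OF that] is_normD(1)[OF R_norm[OF Q0(1)], of "e i"] by (intro powr_mono2) auto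
      then have "R Q0 (e i) powr P * measure lebesgue Q0 \<le> 1 * measure lebesgue Q0"
        using m by (intro mult_right_mono) auto
      then show ?thesis unfolding cong m(1)
        by (intro order.trans[OF rho_int[OF Q0(1) that]] ennreal_leI) simp
    qed
    have 3: "(\<sigma> Q (w i)) \<le> ennreal (C powr q) * emeasure lebesgue Q" for i
    proof -
      have "dual (R Q0) (w i) \<le> 1" using ew(2) by (intro dual_base_le R_norm Q0)
      then have "(C * dual (R Q0) (w i)) powr q \<le> (C * 1) powr q"
        using C(1) q_ge by (intro powr_mono2 mult_left_mono) auto
      then have "(C * dual (R Q0) (w i)) powr q * measure lebesgue Q0 \<le> C powr q * measure lebesgue Q0"
        using m by (intro mult_right_mono) auto
      then show ?thesis unfolding cong m(1)
        by (intro order.trans[OF C(2)[OF Q0(1)]]) (simp add: ennreal_leI flip: ennreal_mult)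
    qed
    show "\<exists>e w :: 'd \<Rightarrow> real^'d. (\<forall>u. u = (\<Sum>i\<in>UNIV. (u \<bullet> w i) *\<^sub>R e i)) \<and>
       (\<forall>i. if p = top then (AE x in lebesgue. x \<in> Q \<longrightarrow> \<rho> x (e i) \<le> 1)
          else (\<integral>\<^sup>+y\<in>Q. ennreal (\<rho> y (e i) powr P) \<partial>lebesgue) \<le> emeasure lebesgue Q) \<and>
       (\<forall>i. (\<sigma> Q (w i)) \<le> ennreal (C powr q) * emeasure lebesgue Q)"
      using ew(3) 1 2 3 by (intro exI[of _ e] exI[of _ w]) auto
  qed
qed

lemma D_int_fin:
  assumes "cube_ae Q" shows "\<sigma> Q v < \<infinity>"
proof -
  obtain C where C: "\<And>Q v. Q \<in> cubes \<Longrightarrow>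
    (\<sigma> Q v) \<le> ennreal ((C * dual (R Q) v) powr q * measure lebesgue Q)"
    by (rule D_int_le) blast
  obtain Q0 where Q0: "Q0 \<in> cubes" "AE x in lebesgue. x \<in> Q \<longleftrightarrow> x \<in> Q0" and Q: "Q \<in> sets lebesgue"
    using assms by (auto simp: cube_ae_def)
  show ?thesis unfolding cube_ae_cong[OF Q0(2) Q cubes_measurable[OF Q0(1)]]
    by (rule order.strict_trans1[OF C[OF Q0(1)]]) simp
qed

text \<open>Hoelder's inequality on \<open>E\<close> bounds the dual of \<open>R Q\<close> by the mass of \<open>E\<close>, and the
  \<open>A\<^sub>p\<close> condition bounds the mass of \<open>Q\<close> by the dual of \<open>R Q\<close>.\<close>

lemma Ainf_exists:
  assumes fin: "p \<noteq> top"
  obtains c where "0 < c" "c \<le> 1" "\<And>Q E v. cube_ae Q \<Longrightarrow> E \<in> sets lebesgue \<Longrightarrow> E \<subseteq> Q \<Longrightarrow>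
     emeasure lebesgue Q \<le> 2 * emeasure lebesgue E \<Longrightarrow>
     ennreal c * (\<sigma> Q v) \<le> (\<sigma> E v)"
proof -
  note P = P_gt[OF fin] and q = conj_finite[OF fin]
  obtain C where C: "0 \<le> C" "\<And>Q v. Q \<in> cubes \<Longrightarrow>
    (\<sigma> Q v) \<le> ennreal ((C * dual (R Q) v) powr q * measure lebesgue Q)"
    by (rule D_int_le) blast
  \<comment> \<open>The estimate below asks for \<open>c * (2 * C) powr q \<le> 1\<close>; the
    summand 1 keeps \<open>c\<close> in the required range even for \<open>C = 0\<close>.\<close>
  define c where "c = 1 / (1 + (2 * C) powr q)"
  have c: "0 < c" "c \<le> 1" "c * (2 * C) powr q \<le> 1"
    by (simp_all add: c_def divide_simps add_pos_nonneg)
  show ?thesis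
  proof
    show "0 < c" "c \<le> 1" by (fact c)+
    fix Q E :: "(real^'n) set" and v
    assume "cube_ae Q" and E [measurable]: "E \<in> sets lebesgue" and sub: "E \<subseteq> Q"
      and half: "emeasure lebesgue Q \<le> 2 * emeasure lebesgue E"
    then obtain Q0 where Q0: "Q0 \<in> cubes" "AE x in lebesgue. x \<in> Q \<longleftrightarrow> x \<in> Q0" and Q: "Q \<in> sets lebesgue"
      by (auto simp: cube_ae_def)
    note cong = cube_ae_cong[OF Q0(2) Q cubes_measurable[OF Q0(1)]]
    note RQ = R_norm[OF Q0(1)]
    define m where "m = measure lebesgue Q0"
    have m: "emeasure lebesgue Q0 = ennreal m" "0 < m"
      using cubes_emeasure[OF Q0(1)] by (simp_all add: m_def)
    have EQ: "emeasure lebesgue E \<le> ennreal m"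
      unfolding m(1)[symmetric] cong(2)[symmetric] by (rule emeasure_mono[OF sub Q])
    define mE where "mE = measure lebesgue E"
    have mE: "emeasure lebesgue E = ennreal mE"
      unfolding mE_def using EQ by (intro emeasure_eq_ennreal_measure) (auto simp: top_unique)
    have mE2: "m \<le> 2 * mE"
    proof -
      have "ennreal m \<le> ennreal (2 * mE)"
        using half by (simp add: cong m mE ennreal_mult' mE_def)
      then show ?thesis by (subst (asm) ennreal_le_iff) (simp_all add: mE_def)
    qed
    define s\<^sub>E where "s\<^sub>E = (\<sigma> E v)"
    have "s\<^sub>E \<le> (\<sigma> Q v)"
      unfolding s\<^sub>E_def using sub by (intro nn_integral_mono) (auto split: split_indicator)
    also have "\<dots> < \<infinity>" by (rule D_int_fin) fact
    finally obtain s where s: "s\<^sub>E = ennreal s" "0 \<le> s" by (cases s\<^sub>E) auto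
    have "\<bar>u \<bullet> v\<bar> \<le> 2 * m powr (- 1 / q) * s powr (1 / q) * R Q0 u" for u
    proof -
      have "ennreal (\<bar>u \<bullet> v\<bar> * mE) = (\<integral>\<^sup>+y. ennreal \<bar>u \<bullet> v\<bar> * indicator E y \<partial>lebesgue)"
        by (simp add: nn_integral_cmult_indicator mE ennreal_mult mE_def)
      also have "\<dots> \<le> (\<integral>\<^sup>+y. (ennreal (\<rho> y u) * indicator Q y) * (ennreal (D y v) * indicator E y) \<partial>lebesgue)"
        using sub by (intro nn_integral_mono)
          (auto simp: ennreal_leI inner_le split: split_indicator simp flip: ennreal_mult)
      also have "\<dots> \<le> ennreal_powr (\<integral>\<^sup>+y. ennreal_powr (ennreal (\<rho> y u) * indicator Q y) P \<partial>lebesgue) (1 / P)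
          * ennreal_powr (\<integral>\<^sup>+y. ennreal_powr (ennreal (D y v) * indicator E y) q \<partial>lebesgue) (1 / q)"
        using Q by (intro nn_integral_Hoelder P q) auto
      also have "(\<integral>\<^sup>+y. ennreal_powr (ennreal (\<rho> y u) * indicator Q y) P \<partial>lebesgue)
          = (\<integral>\<^sup>+y\<in>Q. ennreal (\<rho> y u powr P) \<partial>lebesgue)"
        by (intro nn_integral_cong) (auto simp: ennreal_powr_ennreal split: split_indicator)
      also have "(\<integral>\<^sup>+y. ennreal_powr (ennreal (D y v) * indicator E y) q \<partial>lebesgue) = s\<^sub>E"
        unfolding s\<^sub>E_def by (intro nn_integral_cong) (auto simp: ennreal_powr_ennreal split: split_indicator)
      also have "ennreal_powr (\<integral>\<^sup>+y\<in>Q. ennreal (\<rho> y u powr P) \<partial>lebesgue) (1 / P) * ennreal_powr s\<^sub>E (1 / q)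
        \<le> ennreal_powr (ennreal (R Q0 u powr P * m)) (1 / P) * ennreal_powr s\<^sub>E (1 / q)"
        unfolding cong m_def using P by (intro mult_right_mono ennreal_powr_mono rho_int[OF Q0(1) fin]) auto
      also have "\<dots> = ennreal (R Q0 u * m powr (1 / P) * s powr (1 / q))"
        using s m P is_normD(1)[OF RQ, of u]
        by (simp add: ennreal_powr_ennreal powr_mult powr_powr flip: ennreal_mult)
      finally have le: "\<bar>u \<bullet> v\<bar> * mE \<le> R Q0 u * m powr (1 / P) * s powr (1 / q)"
        by (subst (asm) ennreal_le_iff) (auto simp: is_normD(1)[OF RQ])
      have "\<bar>u \<bullet> v\<bar> * m \<le> \<bar>u \<bullet> v\<bar> * (2 * mE)"
        using mE2 by (intro mult_left_mono) auto
      also have "\<dots> \<le> 2 * (R Q0 u * m powr (1 / P) * s powr (1 / q))" using le by simp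
      also have "m powr (1 / P) = m * m powr (- 1 / q)"
      proof -
        have "1 / P = 1 + (- 1 / q)" using q(4) by simp
        then show ?thesis using m(2) by (simp only: powr_add powr_one)
      qed
      finally show ?thesis using m(2) by (simp add: mult_ac)
    qed
    then have "dual (R Q0) v \<le> 2 * m powr (- 1 / q) * s powr (1 / q)"
      by (intro dual_le[OF RQ]) auto
    then have "(C * dual (R Q0) v) powr q \<le> (C * (2 * m powr (- 1 / q) * s powr (1 / q))) powr q"
      using C(1) q by (intro powr_mono2 mult_left_mono) auto
    also have "\<dots> = (2 * C) powr q * (s / m)"
    proof -
      have "(m powr (- 1 / q)) powr q = 1 / m" "(s powr (1 / q)) powr q = s"
      proof -
        have "- 1 / q * q = - 1" "1 / q * q = 1" using q(3) by simp_all
        then show "(m powr (- 1 / q)) powr q = 1 / m" "(s powr (1 / q)) powr q = s"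
          using m(2) s(2) by (simp_all only: powr_powr) (simp_all add: powr_minus_divide)
      qed
      moreover have "C * (2 * m powr (- 1 / q) * s powr (1 / q)) = (2 * C) * m powr (- 1 / q) * s powr (1 / q)"
        by simp
      ultimately show ?thesis using C(1) by (simp only: powr_mult mult_nonneg_nonneg powr_ge_zero zero_le_numeral) simp
    qed
    finally have "(C * dual (R Q0) v) powr q * m \<le> (2 * C) powr q * s"
      using m(2) by (simp add: field_simps)
    then have "c * ((C * dual (R Q0) v) powr q * m) \<le> c * ((2 * C) powr q * s)"
      using c by (intro mult_left_mono) auto
    also have "\<dots> \<le> s" using mult_right_mono[OF c(3) s(2)] by (simp add: mult.assoc)
    finally have fin: "c * ((C * dual (R Q0) v) powr q * m) \<le> s" .
    have "ennreal c * (\<sigma> Q v) \<le> ennreal c * ennreal ((C * dual (R Q0) v) powr q * m)"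
      unfolding cong m_def by (intro mult_left_mono C(2) Q0) auto
    also have "\<dots> \<le> s\<^sub>E" using fin c(1) m(2) by (simp add: s ennreal_leI flip: ennreal_mult)
    finally show "ennreal c * (\<sigma> Q v) \<le> (\<sigma> E v)"
      by (simp add: s\<^sub>E_def)
  qed
qed

end

section \<open>Shifted dyadic grids\<close>

text \<open>The mesh at level \<open>k\<close> is \<open>L / 2 ^ k\<close>. The shift
  \<open>L / 3\<close> is the same at all levels, so each grid is nested; \<open>\<tau>\<close>
  decides for each coordinate separately whether to shift, which gives finitely many grids.\<close>

definition gcoord :: "real \<Rightarrow> ('n \<Rightarrow> bool) \<Rightarrow> nat \<Rightarrow> real^'n \<Rightarrow> 'n \<Rightarrow> int" where
  "gcoord L \<tau> k x i = \<lfloor>(x $ i - (if \<tau> i then L / 3 else 0)) * 2 ^ k / L\<rfloor>"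

definition gix :: "real \<Rightarrow> ('n::finite \<Rightarrow> bool) \<Rightarrow> nat \<Rightarrow> real^'n \<Rightarrow> nat" where
  "gix L \<tau> k x = to_nat (gcoord L \<tau> k x)"

lemma gix_eq_iff: "gix L \<tau> k x = gix L \<tau> k y \<longleftrightarrow> (\<forall>i. gcoord L \<tau> k x i = gcoord L \<tau> k y i)"
  by (auto simp: gix_def fun_eq_iff)

lemma gix_nested:
  assumes "gix L \<tau> (Suc k) x = gix L \<tau> (Suc k) y" shows "gix L \<tau> k x = gix L \<tau> k y"
proof -
  have "gcoord L \<tau> k x i = gcoord L \<tau> (Suc k) x i div 2" for x :: "real^'a" and i
    using floor_divide_real_eq_div[of 2 "(x $ i - (if \<tau> i then L / 3 else 0)) * 2 ^ Suc k / L"]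
    unfolding gcoord_def by simp
  then show ?thesis using assms by (simp add: gix_eq_iff)
qed

lemma gix_measurable: "gix L \<tau> k \<in> measurable lebesgue (count_space UNIV)"
proof (subst measurable_count_space_eq2_countable, safe)
  have [measurable]: "(\<lambda>x::real^'a. x $ i) \<in> borel_measurable lebesgue" for i
    by (intro measurable_completion) (auto intro!: borel_measurable_continuous_onI continuous_intros)
  have gc: "(\<lambda>x. gcoord L \<tau> k x i) \<in> measurable lebesgue (count_space UNIV)" for i
    unfolding gcoord_def by measurable
  fix n
  show "gix L \<tau> k -` {n} \<inter> space lebesgue \<in> sets lebesgue"
  proof (cases "\<exists>y. gix L \<tau> k y = n")
    case True
    then obtain y where "gix L \<tau> k y = n" by blast
    then have "gix L \<tau> k -` {n} \<inter> space lebesgue = {x \<in> space lebesgue. \<forall>i. gcoord L \<tau> k x i = gcoord L \<tau> k y i}"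
      by (auto simp: gix_eq_iff)
    also have "\<dots> \<in> sets lebesgue" using gc by measurable
    finally show ?thesis .
  next
    case False
    then have "gix L \<tau> k -` {n} \<inter> space lebesgue = {}" by auto
    then show ?thesis by (simp only: sets.empty_sets)
  qed
qed auto

lemma gix_cell:
  fixes x :: "real^'n"
  assumes L: "0 < L"
  obtains a where "AE y in lebesgue. gix L \<tau> k y = gix L \<tau> k x \<longleftrightarrow> y \<in> box a (\<chi> i. a $ i + L / 2 ^ k)"
proof -
  define d where "d = L / 2 ^ k"
  have d: "0 < d" using L by (simp add: d_def)
  define a :: "real^'n" where "a = (\<chi> i. (if \<tau> i then L / 3 else 0) + real_of_int (gcoord L \<tau> k x i) * d)"
  define b :: "real^'n" where "b = (\<chi> i. a $ i + d)"
  have coord: "gcoord L \<tau> k y i = gcoord L \<tau> k x i \<longleftrightarrow> a $ i \<le> y $ i \<and> y $ i < b $ i" for y i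
  proof -
    have g: "gcoord L \<tau> k y i = \<lfloor>(y $ i - (if \<tau> i then L / 3 else 0)) / d\<rfloor>"
      by (simp add: gcoord_def d_def)
    have ab: "a $ i = (if \<tau> i then L / 3 else 0) + real_of_int (gcoord L \<tau> k x i) * d"
      "b $ i = (if \<tau> i then L / 3 else 0) + real_of_int (gcoord L \<tau> k x i) * d + d"
      by (simp_all add: a_def b_def)
    show ?thesis unfolding g floor_eq_iff ab using d by (auto simp: field_simps)
  qed
  have "negligible (cbox a b - box a b)" by (rule negligible_frontier_interval)
  then have "AE y in lebesgue. y \<notin> cbox a b - box a b"
    by (intro AE_not_in) (simp add: negligible_iff_null_sets)
  then have "AE y in lebesgue. gix L \<tau> k y = gix L \<tau> k x \<longleftrightarrow> y \<in> box a b"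
  proof eventually_elim
    case (elim y)
    then show ?case unfolding gix_eq_iff coord by (auto simp: mem_box_cart less_imp_le)
  qed
  then show ?thesis using that[of a] by (simp add: b_def d_def)
qed

lemma (in Ap_setting) gix_cube_ae: 
  assumes "0 < L" shows "cube_ae {y. gix L \<tau> k y = gix L \<tau> k x}"
proof -
  obtain a where a: "AE y in lebesgue. gix L \<tau> k y = gix L \<tau> k x \<longleftrightarrow> y \<in> box a (\<chi> i. a $ i + L / 2 ^ k)"
    by (rule gix_cell[OF assms])
  have "{y \<in> space lebesgue. gix L \<tau> k y = gix L \<tau> k x} \<in> sets lebesgue"
    using gix_measurable[of L \<tau> k] by measurable
  moreover have "box a (\<chi> i. a $ i + L / 2 ^ k) \<in> cubes"
    unfolding cubes_def using assms by (intro CollectI exI[of _ a] exI[of _ "L / 2 ^ k"]) simp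
  ultimately show ?thesis using a by (auto simp: cube_ae_def)
qed

lemma gix_emeasure:
  fixes x :: "real^'n"
  assumes "0 < L" shows "emeasure lebesgue {y. gix L \<tau> k y = gix L \<tau> k x} = ennreal ((L / 2 ^ k) ^ CARD('n))"
proof -
  obtain a where a: "AE y in lebesgue. gix L \<tau> k y = gix L \<tau> k x \<longleftrightarrow> y \<in> box a (\<chi> i. a $ i + L / 2 ^ k)"
    by (rule gix_cell[OF assms])
  have "{y \<in> space lebesgue. gix L \<tau> k y = gix L \<tau> k x} \<in> sets lebesgue"
    using gix_measurable[of L \<tau> k] by measurable
  then have "emeasure lebesgue {y. gix L \<tau> k y = gix L \<tau> k x} = emeasure lebesgue (box a (\<chi> i. a $ i + L / 2 ^ k))"
    using a by (intro emeasure_eq_AE) auto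
  also have "\<dots> = ennreal ((L / 2 ^ k) ^ CARD('n))"
    by (rule emeasure_cube) (use assms in simp)
  finally show ?thesis .
qed

lemma filtration_gix:
  fixes \<tau> :: "'n::finite \<Rightarrow> bool"
  assumes "0 < L" shows "filtration lebesgue (gix L \<tau>)"
proof
  show "gix L \<tau> k \<in> measurable lebesgue (count_space UNIV)" for k by (rule gix_measurable)
  show "gix L \<tau> (Suc k) x = gix L \<tau> (Suc k) y \<Longrightarrow> gix L \<tau> k x = gix L \<tau> k y" for k x y
    by (rule gix_nested)
  show "0 < emeasure lebesgue {y. gix L \<tau> k y = gix L \<tau> k x}"
    "emeasure lebesgue {y. gix L \<tau> k y = gix L \<tau> k x} < \<infinity>" for k x
    unfolding gix_emeasure[OF assms] using assms by auto
qed simp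

text \<open>Since \<open>2 ^ k / 3\<close> has distance at least \<open>1 / 3\<close> from the integers, an interval of length less than
  a third of the mesh cannot contain points of both grids.\<close>

lemma third_trick:
  fixes b l L :: real
  assumes l: "3 * l < L / 2 ^ k" and L: "0 < L"
  obtains t where "\<And>y z. b < y \<Longrightarrow> y < b + l \<Longrightarrow> b < z \<Longrightarrow> z < b + l \<Longrightarrow>
    \<lfloor>(y - (if t then L / 3 else 0)) * 2 ^ k / L\<rfloor> = \<lfloor>(z - (if t then L / 3 else 0)) * 2 ^ k / L\<rfloor>"
proof -
  define d where "d = L / 2 ^ k"
  have d: "0 < d" "L = 2 ^ k * d" using L by (auto simp: d_def)
  have split: "\<exists>j::int. b < j * d + s \<and> j * d + s < b + l"
    if yz: "b < y" "y < b + l" "b < z" "z < b + l" "\<lfloor>(y - s) * 2 ^ k / L\<rfloor> < \<lfloor>(z - s) * 2 ^ k / L\<rfloor>" for y z s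
  proof -
    have e: "(v - s) * 2 ^ k / L = (v - s) / d" for v by (simp add: d_def)
    define j where "j = \<lfloor>(z - s) / d\<rfloor>"
    have "j \<le> (z - s) / d" by (simp add: j_def)
    moreover have "(y - s) / d < j" using yz(5) by (simp add: e j_def floor_less_iff)
    ultimately have "j * d + s \<le> z" "y < j * d + s" using d(1) by (simp_all add: field_simps)
    then show ?thesis using yz by (intro exI[of _ j]) auto
  qed
  have split': "\<exists>j::int. b < j * d + s \<and> j * d + s < b + l"
    if yz: "b < y" "y < b + l" "b < z" "z < b + l" "\<lfloor>(y - s) * 2 ^ k / L\<rfloor> \<noteq> \<lfloor>(z - s) * 2 ^ k / L\<rfloor>" for y z s
    using split[of y z s] split[of z y s] yz(1-4) yz(5)[unfolded neq_iff] by blast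
  show ?thesis
  proof (rule ccontr)
    assume "\<not> thesis"
    then have "\<exists>y z. b < y \<and> y < b + l \<and> b < z \<and> z < b + l \<and>
      \<lfloor>(y - (if t then L / 3 else 0)) * 2 ^ k / L\<rfloor> \<noteq> \<lfloor>(z - (if t then L / 3 else 0)) * 2 ^ k / L\<rfloor>" for t
      using that[of t] by blast
    then have "\<exists>j::int. b < j * d + (if t then L / 3 else 0) \<and> j * d + (if t then L / 3 else 0) < b + l" for t
      using split' by meson
    from this[of True] this[of False] obtain i j :: int
      where ij: "b < i * d + L / 3" "i * d + L / 3 < b + l" "b < j * d" "j * d < b + l" by auto
    have "\<bar>(i - j) * d + 2 ^ k * d / 3\<bar> < d / 3"
    proof -
      have "real_of_int (i - j) * d + 2 ^ k * d / 3 = i * d + L / 3 - j * d"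
        by (simp add: d(2) algebra_simps)
      moreover have "l < d / 3" using l by (simp add: d_def)
      moreover have "\<bar>i * d + L / 3 - j * d\<bar> < l" using ij by linarith
      ultimately show ?thesis by simp
    qed
    \<comment> \<open>The distance between points of the two grids is an integer multiple of
      \<open>d / 3\<close>. Being smaller than \<open>d / 3\<close>, it is 0, and then 3 would
      divide a power of 2.\<close>
    moreover have "real_of_int (i - j) * d + 2 ^ k * d / 3 = real_of_int (3 * (i - j) + 2 ^ k) * (d / 3)"
      by (simp add: algebra_simps)
    ultimately have "\<bar>real_of_int (3 * (i - j) + 2 ^ k)\<bar> * (d / 3) < 1 * (d / 3)"
      using d(1) by (simp only: abs_mult)
    then have "\<bar>real_of_int (3 * (i - j) + 2 ^ k)\<bar> < 1"
      using d(1) by (subst (asm) mult_less_cancel_right_pos) auto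
    then have "3 * (i - j) + 2 ^ k = 0" by linarith
    then have "(3::int) dvd 2 ^ k" by presburger
    moreover have "\<not> (3::int) dvd 2 ^ m" for m
    proof (induction m)
      case (Suc m)
      then show ?case by (simp only: power_Suc) presburger
    qed simp
    ultimately show False by blast
  qed
qed

text \<open>The first level with mesh at most \<open>6 * l\<close> has mesh greater than
  \<open>3 * l\<close>: at level 0 by hypothesis, later because the preceding mesh is twice as
  large. So \<open>third_trick\<close> applies, and the shift is chosen in each coordinate
  separately.\<close>

lemma cube_in_cell:
  fixes b :: "real^'n"
  assumes l: "0 < l" "3 * l < L"
  obtains \<tau> k where "\<And>x. x \<in> box b (\<chi> i. b $ i + l) \<Longrightarrow> box b (\<chi> i. b $ i + l) \<subseteq> {y. gix L \<tau> k y = gix L \<tau> k x}"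
    "L / 2 ^ k \<le> 6 * l"
proof -
  have L: "0 < L" using l by simp
  have "\<exists>k. L / 2 ^ k \<le> 6 * l"
  proof -
    obtain k where "L / (6 * l) < 2 ^ k" using real_arch_pow[of 2 "L / (6 * l)"] by auto
    then have "L / 2 ^ k \<le> 6 * l" using l by (simp add: field_simps)
    then show ?thesis by blast
  qed
  define k where "k = (LEAST k. L / 2 ^ k \<le> 6 * l)"
  have k: "L / 2 ^ k \<le> 6 * l" unfolding k_def by (rule LeastI_ex) fact
  have k3: "3 * l < L / 2 ^ k"
  proof (cases k)
    case (Suc j)
    then have "\<not> L / 2 ^ j \<le> 6 * l" unfolding k_def using not_less_Least by (metis lessI)
    then show ?thesis by (simp add: Suc)
  qed (use l in simp)
  have "\<forall>i. \<exists>t. \<forall>y z. b $ i < y \<longrightarrow> y < b $ i + l \<longrightarrow> b $ i < z \<longrightarrow> z < b $ i + l \<longrightarrow>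
    \<lfloor>(y - (if t then L / 3 else 0)) * 2 ^ k / L\<rfloor> = \<lfloor>(z - (if t then L / 3 else 0)) * 2 ^ k / L\<rfloor>"
    using third_trick[OF k3 L] by metis
  then obtain \<tau> where \<tau>: "\<And>i y z. b $ i < y \<Longrightarrow> y < b $ i + l \<Longrightarrow> b $ i < z \<Longrightarrow> z < b $ i + l \<Longrightarrow>
    \<lfloor>(y - (if \<tau> i then L / 3 else 0)) * 2 ^ k / L\<rfloor> = \<lfloor>(z - (if \<tau> i then L / 3 else 0)) * 2 ^ k / L\<rfloor>"
    by metis
  show ?thesis
  proof
    show "box b (\<chi> i. b $ i + l) \<subseteq> {y. gix L \<tau> k y = gix L \<tau> k x}" if "x \<in> box b (\<chi> i. b $ i + l)" for x
    proof
      fix y assume y: "y \<in> box b (\<chi> i. b $ i + l)"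
      have "gcoord L \<tau> k y i = gcoord L \<tau> k x i" for i
        unfolding gcoord_def using that y by (intro \<tau>) (auto simp: mem_box_cart)
      then show "y \<in> {y. gix L \<tau> k y = gix L \<tau> k x}" by (simp add: gix_eq_iff)
    qed
  qed (rule k)
qed

section \<open>Estimates on a single dyadic grid\<close>

context Ap_setting
begin

abbreviation gcell :: "real \<Rightarrow> ('n \<Rightarrow> bool) \<Rightarrow> nat \<Rightarrow> real^'n \<Rightarrow> (real^'n) set" where
  "gcell L \<tau> k x \<equiv> {y. gix L \<tau> k y = gix L \<tau> k x}"

text \<open>Membership of \<open>u\<close> in the polar body of the averaged norm over
  \<open>Q\<close>, multiplied by the measure so that no finiteness or division is involved.\<close>

abbreviation polar :: "(real^'n) set \<Rightarrow> (real^'n \<Rightarrow> real) \<Rightarrow> real^'d \<Rightarrow> bool" where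
  "polar Q h u \<equiv> \<forall>w. ennreal \<bar>u \<bullet> w\<bar> * emeasure lebesgue Q \<le> (\<integral>\<^sup>+y\<in>Q. ennreal (h y * D y w) \<partial>lebesgue)"

lemma gcell_sets [measurable, simp]: "gcell L \<tau> k x \<in> sets lebesgue"
proof -
  have "{y \<in> space lebesgue. gix L \<tau> k y = gix L \<tau> k x} \<in> sets lebesgue"
    using gix_measurable[of L \<tau> k] by measurable
  then show ?thesis by simp
qed

text \<open>The constant is fixed before \<open>h\<close>, \<open>L\<close> and
  \<open>\<tau>\<close>. This uniformity later allows \<open>L\<close> to tend to infinity.\<close>

lemma grid_maximal:
  assumes fin: "p \<noteq> top"
  obtains K where "\<And>h L \<tau>. h \<in> borel_measurable lebesgue \<Longrightarrow> (\<And>x. 0 < h x) \<Longrightarrow>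
    (\<integral>\<^sup>+x. ennreal (h x powr P) \<partial>lebesgue) < \<infinity> \<Longrightarrow> 0 < L \<Longrightarrow>
    \<exists>B\<in>borel_measurable lebesgue.
      (\<forall>x k u. polar (gcell L \<tau> k x) h u \<longrightarrow> ennreal (\<rho> x u powr P) \<le> B x) \<and>
      (\<integral>\<^sup>+x. B x \<partial>lebesgue) \<le> ennreal K * (\<integral>\<^sup>+x. ennreal (h x powr P) \<partial>lebesgue)"
proof -
  obtain C where C: "0 \<le> C" "\<And>Q. cube_ae Q \<Longrightarrow> \<exists>e w :: 'd \<Rightarrow> real^'d. (\<forall>u. u = (\<Sum>i\<in>UNIV. (u \<bullet> w i) *\<^sub>R e i)) \<and>
       (\<forall>i. if p = top then (AE x in lebesgue. x \<in> Q \<longrightarrow> \<rho> x (e i) \<le> 1)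
          else (\<integral>\<^sup>+y\<in>Q. ennreal (\<rho> y (e i) powr P) \<partial>lebesgue) \<le> emeasure lebesgue Q) \<and>
       (\<forall>i. (\<sigma> Q (w i)) \<le> ennreal C * emeasure lebesgue Q)"
    by (rule basis_exists) blast
  obtain c where c: "0 < c" "c \<le> 1" "\<And>Q E v. cube_ae Q \<Longrightarrow> E \<in> sets lebesgue \<Longrightarrow> E \<subseteq> Q \<Longrightarrow>
     emeasure lebesgue Q \<le> 2 * emeasure lebesgue E \<Longrightarrow>
     ennreal c * (\<sigma> Q v) \<le> (\<sigma> E v)"
    by (rule Ainf_exists[OF fin]) blast
  define lam where "lam = 2 * real CARD('d)"
  define K where "K = lam powr P * (weighted_filtration.K P q C lam / (1 - weighted_filtration.u P q c))"
  show ?thesis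
  proof
    fix h :: "real^'n \<Rightarrow> real" and L :: real and \<tau> :: "'n \<Rightarrow> bool"
    assume h: "h \<in> borel_measurable lebesgue" "\<And>x. 0 < h x" "(\<integral>\<^sup>+x. ennreal (h x powr P) \<partial>lebesgue) < \<infinity>" and L: "0 < L"
    interpret F: filtration lebesgue "gix L \<tau>" by (rule filtration_gix[OF L])
    have cell: "F.cell k x = gcell L \<tau> k x" for k x by (auto simp: F.cell_def)
    have cae: "cube_ae (F.cell k x)" for k x unfolding cell by (rule gix_cube_ae[OF L])
    interpret W: weighted_filtration lebesgue "gix L \<tau>" \<rho> D h P q C c lam
    \<comment> \<open>The three numbered goals are the locale assumptions \<open>D_int\<close>,
      \<open>basis\<close> and \<open>Ainf\<close>.\<close>
    proof (unfold_locales, goal_cases)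
      case (12 k x v) then show ?case by (rule D_int_fin[OF cae])
    next
      case (13 k x) then show ?case using C(2)[OF cae[of k x]] fin by simp
    next
      case (17 E k x v) then show ?case by (intro c(3)[OF cae])
    qed (use P_gt[OF fin] conj_finite[OF fin] \<rho>_norm D_norm h C(1) c lam_def in auto)
    show "\<exists>B\<in>borel_measurable lebesgue.
      (\<forall>x k u. polar (gcell L \<tau> k x) h u \<longrightarrow> ennreal (\<rho> x u powr P) \<le> B x) \<and>
      (\<integral>\<^sup>+x. B x \<partial>lebesgue) \<le> ennreal K * (\<integral>\<^sup>+x. ennreal (h x powr P) \<partial>lebesgue)"
    proof (intro bexI[of _ "\<lambda>x. ennreal (lam powr P) * W.B x"] conjI allI impI)
      fix x k u
      assume "polar (gcell L \<tau> k x) h u"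
      then have "ennreal \<bar>u \<bullet> w\<bar> * emeasure lebesgue (F.cell k x) \<le> W.I k x w" for w
        by (simp add: W.I_def cell)
      then have "ennreal (\<bar>u \<bullet> w\<bar> * measure lebesgue (F.cell k x)) \<le> ennreal (W.N k x w * measure lebesgue (F.cell k x))" for w
        by (simp add: W.I_eq W.emeasure_cell ennreal_mult)
      then have "\<bar>u \<bullet> w\<bar> \<le> W.N k x w" for w
        using W.measure_cell_pos[of k x] by (simp add: ennreal_le_iff)
      then show "ennreal (\<rho> x u powr P) \<le> ennreal (lam powr P) * W.B x" by (rule W.rho_le_B)
    next
      have "0 \<le> W.K / (1 - W.u)" using W.u by (simp add: W.K_def)
      then have "ennreal K = ennreal (lam powr P) * ennreal (W.K / (1 - W.u))"
        unfolding K_def by (intro ennreal_mult) auto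
      then show "(\<integral>\<^sup>+x. ennreal (lam powr P) * W.B x \<partial>lebesgue) \<le> ennreal K * (\<integral>\<^sup>+x. ennreal (h x powr P) \<partial>lebesgue)"
        using W.B_integral by (simp add: nn_integral_cmult mult.assoc mult_left_mono)
    qed measurable
  qed
qed

text \<open>Here \<open>q = 1\<close>, so the basis bounds the plain averages of the dual norms: a
  vector of the polar body has coordinates at most \<open>C * H\<close>, while each basis vector
  satisfies \<open>\<rho> x (e i) \<le> 1\<close> almost everywhere on the cell. Summing gives the
  dimension as a factor.\<close>

lemma grid_maximal_top:
  assumes top: "p = top"
  obtains K where "0 \<le> K" "\<And>H L \<tau>. 0 \<le> H \<Longrightarrow> 0 < L \<Longrightarrow>
    AE x in lebesgue. \<forall>k u. polar (gcell L \<tau> k x) (\<lambda>_. H) u \<longrightarrow> \<rho> x u \<le> K * H"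
proof -
  obtain C where C: "0 \<le> C" "\<And>Q. cube_ae Q \<Longrightarrow> \<exists>e w :: 'd \<Rightarrow> real^'d. (\<forall>u. u = (\<Sum>i\<in>UNIV. (u \<bullet> w i) *\<^sub>R e i)) \<and>
       (\<forall>i. if p = top then (AE x in lebesgue. x \<in> Q \<longrightarrow> \<rho> x (e i) \<le> 1)
          else (\<integral>\<^sup>+y\<in>Q. ennreal (\<rho> y (e i) powr P) \<partial>lebesgue) \<le> emeasure lebesgue Q) \<and>
       (\<forall>i. (\<sigma> Q (w i)) \<le> ennreal C * emeasure lebesgue Q)"
    by (rule basis_exists) blast
  show ?thesis
  proof
    show "0 \<le> real CARD('d) * C" using C(1) by simp
    fix H L :: real and \<tau> :: "'n \<Rightarrow> bool"
    assume H: "0 \<le> H" and L: "0 < L"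
    interpret F: filtration lebesgue "gix L \<tau>" by (rule filtration_gix[OF L])
    have cell: "F.cell k x = gcell L \<tau> k x" for k x by (auto simp: F.cell_def)
    \<comment> \<open>The exceptional points are grouped by cell number, so that a countable union
      of null sets suffices although \<open>u\<close> runs over all vectors.\<close>
    define Bad where "Bad k i = (if \<exists>x. gix L \<tau> k x = i then
      {y. gix L \<tau> k y = i \<and> (\<exists>u. (\<forall>w. ennreal \<bar>u \<bullet> w\<bar> * emeasure lebesgue {y. gix L \<tau> k y = i}
           \<le> (\<integral>\<^sup>+y\<in>{y. gix L \<tau> k y = i}. ennreal (H * D y w) \<partial>lebesgue)) \<and> \<not> \<rho> y u \<le> real CARD('d) * C * H)} else {})" for k i
    have "AE y in lebesgue. y \<notin> Bad k i" for k i
    proof (cases "\<exists>x. gix L \<tau> k x = i")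
      case True
      then obtain x where x: "gix L \<tau> k x = i" by blast
      define Q where "Q = F.cell k x"
      have Q: "cube_ae Q" unfolding Q_def cell by (rule gix_cube_ae[OF L])
      have Qi: "{y. gix L \<tau> k y = i} = Q" by (auto simp: Q_def cell x)
      obtain e w :: "'d \<Rightarrow> real^'d" where ew: "\<And>u. u = (\<Sum>i\<in>UNIV. (u \<bullet> w i) *\<^sub>R e i)"
          "\<And>i. AE x in lebesgue. x \<in> Q \<longrightarrow> \<rho> x (e i) \<le> 1"
          "\<And>i. (\<sigma> Q (w i)) \<le> ennreal C * emeasure lebesgue Q"
        using C(2)[OF Q] top by auto
      have "AE x in lebesgue. \<forall>i\<in>UNIV. x \<in> Q \<longrightarrow> \<rho> x (e i) \<le> 1"
        using ew(2) by (subst AE_finite_all) auto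
      then show ?thesis
      proof eventually_elim
        case (elim y)
        show ?case
        proof
          assume "y \<in> Bad k i"
          then obtain u where u: "y \<in> Q" "\<And>w. ennreal \<bar>u \<bullet> w\<bar> * emeasure lebesgue Q
           \<le> (\<integral>\<^sup>+y\<in>Q. ennreal (H * D y w) \<partial>lebesgue)" and big: "\<not> \<rho> y u \<le> real CARD('d) * C * H"
            using True Qi by (auto simp: Bad_def)
          have ui: "\<bar>u \<bullet> w i\<bar> \<le> C * H" for i
          proof -
            have "ennreal \<bar>u \<bullet> w i\<bar> * emeasure lebesgue Q \<le> (\<integral>\<^sup>+y\<in>Q. ennreal (H * D y (w i)) \<partial>lebesgue)"
              by (rule u)
            also have "\<dots> = ennreal H * (\<integral>\<^sup>+y\<in>Q. ennreal (D y (w i)) \<partial>lebesgue)"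
            proof -
              have [measurable]: "Q \<in> sets lebesgue" using Q by (simp add: cube_ae_def)
              show ?thesis using H
                by (subst nn_integral_cmult[symmetric]) (auto simp: ennreal_mult mult.assoc)
            qed
            also have "\<dots> \<le> ennreal H * (ennreal C * emeasure lebesgue Q)"
              using ew(3)[of i] by (intro mult_left_mono) (simp_all add: q_top[OF top])
            finally have le: "ennreal \<bar>u \<bullet> w i\<bar> * emeasure lebesgue Q \<le> ennreal H * (ennreal C * emeasure lebesgue Q)" .
            define m where "m = (L / 2 ^ k) ^ CARD('n)"
            have m: "0 < m" "emeasure lebesgue Q = ennreal m"
              unfolding m_def Q_def cell gix_emeasure[OF L] using L by simp_all
            have "ennreal (\<bar>u \<bullet> w i\<bar> * m) \<le> ennreal (C * H * m)"
              using le H C(1) m(1) unfolding m(2) by (simp add: ennreal_mult mult_ac)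
            then show ?thesis using H C(1) m(1) by (simp add: ennreal_le_iff)
          qed
          have "\<rho> y u = \<rho> y (\<Sum>i\<in>UNIV. (u \<bullet> w i) *\<^sub>R e i)" using ew(1)[of u] by simp
          also have "\<dots> \<le> (\<Sum>i\<in>UNIV. \<rho> y ((u \<bullet> w i) *\<^sub>R e i))" by (rule is_norm_sum_le[OF \<rho>_norm]) simp
          also have "\<dots> = (\<Sum>i\<in>UNIV. \<bar>u \<bullet> w i\<bar> * \<rho> y (e i))" by (simp add: is_normD(3)[OF \<rho>_norm])
          also have "\<dots> \<le> (\<Sum>i\<in>(UNIV::'d set). (C * H) * 1)"
            using u(1) elim H C(1) by (intro sum_mono mult_mono ui) auto
          finally show False using big by (simp add: mult.assoc)
        qed
      qed
    qed (auto simp: Bad_def)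
    then have "AE y in lebesgue. \<forall>k i. y \<notin> Bad k i" by (simp add: AE_all_countable)
    then show "AE x in lebesgue. \<forall>k u. polar (gcell L \<tau> k x) (\<lambda>_. H) u \<longrightarrow> \<rho> x u \<le> (real CARD('d) * C) * H"
    proof eventually_elim
      case (elim x)
      then show ?case unfolding Bad_def
        by (auto split: if_splits)
    qed
  qed
qed

end

section \<open>Measurable set-valued maps\<close>

text \<open>No condition on the values is imposed, because the maximal function is handled before it
  is known to be bounded almost everywhere.\<close>

definition set_measurable :: "('x::euclidean_space \<Rightarrow> ('a::euclidean_space) set) \<Rightarrow> bool" where
  "set_measurable F \<longleftrightarrow> (\<forall>U. open U \<longrightarrow> {x. F x \<inter> U \<noteq> {}} \<in> sets lebesgue)"

lemma Kbcs_measurable_iff: "Kbcs_measurable F \<longleftrightarrow> (\<forall>x. F x \<in> Kbcs) \<and> set_measurable F"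
  by (simp add: Kbcs_measurable_def set_measurable_def)

lemma set_measurableD: "set_measurable F \<Longrightarrow> open U \<Longrightarrow> {x. F x \<inter> U \<noteq> {}} \<in> sets lebesgue"
  by (simp add: set_measurable_def)

lemma dense_set_exists:
  obtains A :: "('a::euclidean_space) set" where "countable A" "\<And>U. open U \<Longrightarrow> U \<noteq> {} \<Longrightarrow> \<exists>a\<in>A. a \<in> U"
  using countable_dense_exists by metis

text \<open>The set to be met by \<open>F x\<close> depends on \<open>x\<close>, so it is exhausted
  by balls from a countable family: some ball meets \<open>F x\<close>, and on its points from a
  dense set \<open>\<phi> x\<close> exceeds \<open>a\<close> by a fixed margin. Each of these
  conditions is measurable in \<open>x\<close>.\<close>

lemma measurable_Caratheodory_greater:
  fixes F :: "'x::euclidean_space \<Rightarrow> ('a::euclidean_space) set" and \<phi> :: "'x \<Rightarrow> 'a \<Rightarrow> real"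
  assumes F: "set_measurable F" and \<phi>: "\<And>v. (\<lambda>x. \<phi> x v) \<in> borel_measurable lebesgue"
    and cont: "\<And>x. continuous_on UNIV (\<phi> x)"
  shows "{x. \<exists>v\<in>F x. a < \<phi> x v} \<in> sets lebesgue"
proof -
  obtain A :: "'a set" where A: "countable A" "\<And>U. open U \<Longrightarrow> U \<noteq> {} \<Longrightarrow> \<exists>a\<in>A. a \<in> U"
    by (rule dense_set_exists) blast
  have op: "open {v. c < \<phi> x v}" "open {v. \<phi> x v < c}" for x c
    using cont by (auto intro!: open_Collect_less continuous_intros)
  define r where "r n = 1 / real (Suc n)" for n
  have r: "0 < r n" for n by (simp add: r_def)
  have "{x. \<exists>v\<in>F x. a < \<phi> x v} = (\<Union>b\<in>A. \<Union>n. \<Union>j. {x. F x \<inter> ball b (r n) \<noteq> {}} \<inter>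
      (\<Inter>v\<in>A \<inter> ball b (r n). {x. a + r j \<le> \<phi> x v}))" (is "?L = ?R")
  proof (intro set_eqI iffI)
    fix x assume "x \<in> ?L"
    then obtain v where v: "v \<in> F x" "a < \<phi> x v" by blast
    obtain j where j: "r j < \<phi> x v - a"
      using v(2) unfolding r_def by (metis diff_gt_0_iff_gt reals_Archimedean inverse_eq_divide)
    then have "v \<in> {w. a + r j < \<phi> x w}" by simp
    then obtain e where e: "0 < e" "ball v e \<subseteq> {w. a + r j < \<phi> x w}"
      using op(1)[of "a + r j" x] unfolding open_contains_ball by blast
    obtain n where n: "r n < e / 2"
      using reals_Archimedean[of "e / 2"] e(1) by (auto simp: r_def inverse_eq_divide)
    obtain b where b: "b \<in> A" "b \<in> ball v (r n)"
      using A(2)[of "ball v (r n)"] r[of n] by auto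
    have "ball b (r n) \<subseteq> ball v e"
    proof
      fix w assume "w \<in> ball b (r n)"
      then show "w \<in> ball v e"
        using b(2) n dist_triangle[of v w b] by auto
    qed
    then have "x \<in> {x. F x \<inter> ball b (r n) \<noteq> {}} \<inter> (\<Inter>v\<in>A \<inter> ball b (r n). {x. a + r j \<le> \<phi> x v})"
      using e(2) v(1) b(2) by (auto simp: dist_commute less_imp_le subset_iff)
    then show "x \<in> ?R" using b(1) by blast
  next
    fix x assume "x \<in> ?R"
    then obtain b n j v where v: "v \<in> F x" "v \<in> ball b (r n)"
      and le: "\<And>v. v \<in> A \<Longrightarrow> v \<in> ball b (r n) \<Longrightarrow> a + r j \<le> \<phi> x v" by blast
    \<comment> \<open>Otherwise this strict inequality would hold on an open part of the ball, hence
      at a point of the dense set.\<close>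
    have "\<not> \<phi> x v < a + r j"
    proof
      assume "\<phi> x v < a + r j"
      then obtain w where "w \<in> A" "w \<in> ball b (r n) \<inter> {v. \<phi> x v < a + r j}"
        using A(2)[of "ball b (r n) \<inter> {v. \<phi> x v < a + r j}"] v(2) op(2) by blast
      then show False using le[of w] by auto
    qed
    then show "x \<in> ?L" using v(1) r[of j] by (auto intro!: bexI[of _ v])
  qed
  also have "\<dots> \<in> sets lebesgue"
  proof (intro sets.countable_UN' A(1) sets.countable_UN image_subsetI sets.Int)
    fix b n j
    show "{x. F x \<inter> ball b (r n) \<noteq> {}} \<in> sets lebesgue" by (rule set_measurableD[OF F]) simp
    have "{x \<in> space lebesgue. \<forall>v\<in>A \<inter> ball b (r n). a + r j \<le> \<phi> x v} \<in> sets lebesgue"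
    proof -
      have "countable (A \<inter> ball b (r n))" using A(1) by (rule countable_subset[rotated]) auto
      then show ?thesis using \<phi> by measurable
    qed
    moreover have "(\<Inter>v\<in>A \<inter> ball b (r n). {x. a + r j \<le> \<phi> x v}) = {x \<in> space lebesgue. \<forall>v\<in>A \<inter> ball b (r n). a + r j \<le> \<phi> x v}"
      by auto
    ultimately show "(\<Inter>v\<in>A \<inter> ball b (r n). {x. a + r j \<le> \<phi> x v}) \<in> sets lebesgue" by simp
  qed auto
  finally show ?thesis .
qed

lemma measurable_SUP_Caratheodory:
  fixes F :: "'x::euclidean_space \<Rightarrow> ('a::euclidean_space) set" and \<phi> :: "'x \<Rightarrow> 'a \<Rightarrow> real"
  assumes F: "set_measurable F" and \<phi>: "\<And>v. (\<lambda>x. \<phi> x v) \<in> borel_measurable lebesgue"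
    and cont: "\<And>x. continuous_on UNIV (\<phi> x)"
  shows "(\<lambda>x. SUP v\<in>F x. ennreal (\<phi> x v)) \<in> borel_measurable lebesgue"
proof (rule borel_measurableI_greater)
  fix a :: ennreal
  show "{x \<in> space lebesgue. a < (SUP v\<in>F x. ennreal (\<phi> x v))} \<in> sets lebesgue"
  proof (cases a)
    case (real r)
    then have "{x \<in> space lebesgue. a < (SUP v\<in>F x. ennreal (\<phi> x v))} = {x. \<exists>v\<in>F x. r < \<phi> x v}"
      by (auto simp: less_SUP_iff ennreal_less_iff)
    then show ?thesis using measurable_Caratheodory_greater[OF assms] by simp
  qed simp
qed

lemma measurable_INF_Caratheodory:
  fixes F :: "'x::euclidean_space \<Rightarrow> ('a::euclidean_space) set" and \<phi> :: "'x \<Rightarrow> 'a \<Rightarrow> real"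
  assumes F: "set_measurable F" and \<phi>: "\<And>v. (\<lambda>x. \<phi> x v) \<in> borel_measurable lebesgue"
    and cont: "\<And>x. continuous_on UNIV (\<phi> x)" and nn: "\<And>x v. 0 \<le> \<phi> x v"
  shows "(\<lambda>x. INF v\<in>F x. ennreal (\<phi> x v)) \<in> borel_measurable lebesgue"
proof (rule borel_measurableI_less)
  fix a :: ennreal
  show "{x \<in> space lebesgue. (INF v\<in>F x. ennreal (\<phi> x v)) < a} \<in> sets lebesgue"
  proof (cases a)
    case (real r)
    then have "{x \<in> space lebesgue. (INF v\<in>F x. ennreal (\<phi> x v)) < a} = {x. \<exists>v\<in>F x. - r < - \<phi> x v}"
      using nn by (auto simp: INF_less_iff ennreal_less_iff)
    then show ?thesis
      using measurable_Caratheodory_greater[OF F, of "\<lambda>x v. - \<phi> x v" "- r"] \<phi> cont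
      by (simp add: continuous_on_minus)
  next
    case top
    then have "{x \<in> space lebesgue. (INF v\<in>F x. ennreal (\<phi> x v)) < a} = {x. F x \<inter> UNIV \<noteq> {}}"
      by (auto simp: INF_less_iff)
    then show ?thesis using set_measurableD[OF F open_UNIV] by simp
  qed
qed

lemma measurable_norm_of_set:
  fixes \<rho> :: "real^'n \<Rightarrow> real^'d \<Rightarrow> real"
  assumes "\<And>x. is_norm (\<rho> x)" "\<And>v. (\<lambda>x. \<rho> x v) \<in> borel_measurable lebesgue" "set_measurable F"
  shows "(\<lambda>x. norm_of_set (\<rho> x) (F x)) \<in> borel_measurable lebesgue"
  unfolding norm_of_set_def
  by (rule measurable_SUP_Caratheodory) (use assms is_norm_continuous_on in auto)

text \<open>The distance from \<open>v\<close> to \<open>L x\<close> is measurable in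
  \<open>x\<close> and Lipschitz in \<open>v\<close>; hence the supremum over \<open>K x\<close> is
  again covered by the criterion for functions continuous in \<open>v\<close>.\<close>

lemma measurable_set_dist:
  fixes \<rho> :: "real^'n \<Rightarrow> real^'d \<Rightarrow> real"
  assumes norm: "\<And>x. is_norm (\<rho> x)" and meas: "\<And>v. (\<lambda>x. \<rho> x v) \<in> borel_measurable lebesgue"
    and K: "set_measurable K" and L: "set_measurable L" and ne: "\<And>x. L x \<noteq> {}"
  shows "(\<lambda>x. SUP v\<in>K x. INF w\<in>L x. ennreal (\<rho> x (v - w))) \<in> borel_measurable lebesgue"
proof -
  define I where "I x v = (INF w\<in>L x. ennreal (\<rho> x (v - w)))" for x v
  have fin: "I x v < top" for x v
  proof -
    obtain w where "w \<in> L x" using ne[of x] by blast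
    then have "I x v \<le> ennreal (\<rho> x (v - w))" unfolding I_def by (rule INF_lower)
    then show ?thesis by (rule order.strict_trans1) simp
  qed
  have I: "I x v = ennreal (enn2real (I x v))" for x v using fin[of x v] by simp
  have tri: "enn2real (I x v) \<le> \<rho> x (v - v') + enn2real (I x v')" for x v v'
  proof -
    define a where "a = enn2real (I x v) - \<rho> x (v - v')"
    have "ennreal a \<le> I x v'"
      unfolding I_def[of x v']
    proof (rule INF_greatest)
      fix w assume "w \<in> L x"
      then have "I x v \<le> ennreal (\<rho> x (v - w))" unfolding I_def by (rule INF_lower)
      then have "enn2real (I x v) \<le> \<rho> x (v - w)"
        by (subst (asm) I) (simp add: ennreal_le_iff is_normD(1)[OF norm])
      then show "ennreal a \<le> ennreal (\<rho> x (v' - w))"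
        using is_normD(4)[OF norm, of x "v - v'" "v' - w"] by (intro ennreal_leI) (simp add: a_def)
    qed
    then have "a \<le> enn2real (I x v')"
      by (cases "0 \<le> a") (subst (asm) I, auto intro: order.trans[of a 0])
    then show ?thesis by (simp add: a_def)
  qed
  have "(\<lambda>x. SUP v\<in>K x. ennreal (enn2real (I x v))) \<in> borel_measurable lebesgue"
  proof (rule measurable_SUP_Caratheodory[OF K])
    fix v
    have "(\<lambda>x. I x v) \<in> borel_measurable lebesgue"
      unfolding I_def
    proof (rule measurable_INF_Caratheodory[OF L])
      show "continuous_on UNIV (\<lambda>w. \<rho> x (v - w))" for x
        by (rule continuous_on_compose2[OF is_norm_continuous_on[OF norm, of UNIV]]) (auto intro!: continuous_intros)
    qed (use meas is_normD(1)[OF norm] in auto)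
    then show "(\<lambda>x. enn2real (I x v)) \<in> borel_measurable lebesgue" by simp
  next
    fix x
    define C where "C = (\<Sum>i\<in>UNIV. \<rho> x (axis i (1::real)))"
    have "\<bar>enn2real (I x v) - enn2real (I x w)\<bar> \<le> C * dist v w" for v w
      using tri[of x v w] tri[of x w v] is_norm_le_axis[OF norm, of x "v - w"] is_norm_le_axis[OF norm, of x "w - v"]
      by (simp add: C_def dist_norm norm_minus_commute)
    then have "C-lipschitz_on UNIV (\<lambda>v. enn2real (I x v))"
      by (intro lipschitz_onI) (auto simp: dist_real_def C_def sum_nonneg is_normD(1)[OF norm])
    then show "continuous_on UNIV (\<lambda>v. enn2real (I x v))" by (rule lipschitz_on_continuous_on)
  qed
  then show ?thesis using I by (simp add: I_def)
qed

lemma measurable_hausdorff_dist: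
  fixes \<rho> :: "real^'n \<Rightarrow> real^'d \<Rightarrow> real"
  assumes norm: "\<And>x. is_norm (\<rho> x)" and meas: "\<And>v. (\<lambda>x. \<rho> x v) \<in> borel_measurable lebesgue"
    and K: "set_measurable K" "\<And>x. K x \<noteq> {}" and L: "set_measurable L" "\<And>x. L x \<noteq> {}"
  shows "(\<lambda>x. hausdorff_dist (\<rho> x) (K x) (L x)) \<in> borel_measurable lebesgue"
  unfolding hausdorff_dist_def
  using measurable_set_dist[OF norm meas K(1) L(1) L(2)] measurable_set_dist[OF norm meas L(1) K(1) K(2)]
  by (intro borel_measurable_max)

section \<open>Compact symmetric convex sets\<close>

lemma KbcsD:
  assumes "K \<in> Kbcs"
  shows "K \<noteq> {}" "closed K" "bounded K" "convex K" "uminus ` K = K" "compact K" "0 \<in> K"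
    "v \<in> K \<Longrightarrow> - v \<in> K" "v \<in> K \<Longrightarrow> 0 \<le> t \<Longrightarrow> t \<le> 1 \<Longrightarrow> t *\<^sub>R v \<in> K"
proof -
  show *: "K \<noteq> {}" "closed K" "bounded K" "convex K" "uminus ` K = K"
    using assms by (auto simp: Kbcs_def)
  then show "compact K" by (simp add: compact_eq_bounded_closed)
  have m: "- v \<in> K" if "v \<in> K" for v using *(5) that by blast
  then show "v \<in> K \<Longrightarrow> - v \<in> K" .
  obtain u where "u \<in> K" using *(1) by blast
  then have "(1 / 2) *\<^sub>R u + (1 / 2) *\<^sub>R (- u) \<in> K"
    using *(4) m by (intro convexD) auto
  then show z: "0 \<in> K" by simp
  show "t *\<^sub>R v \<in> K" if "v \<in> K" "0 \<le> t" "t \<le> 1"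
    using convexD[OF *(4) that(1) z, of t "1 - t"] that by simp
qed

lemma Kbcs_zero: "{0} \<in> Kbcs"
  by (simp add: Kbcs_def)

lemma Kbcs_plus: "K \<in> Kbcs \<Longrightarrow> L \<in> Kbcs \<Longrightarrow> K + L \<in> Kbcs"
proof -
  assume K: "K \<in> Kbcs" and L: "L \<in> Kbcs"
  have eq: "K + L = {x + y | x y. x \<in> K \<and> y \<in> L}" by (auto simp: set_plus_def)
  have "compact (K + L)" unfolding eq by (intro compact_sums KbcsD(6) K L)
  moreover have "convex (K + L)"
    using KbcsD(4)[OF K] KbcsD(4)[OF L] by (rule convex_set_plus)
  moreover have "uminus ` (K + L) = K + L"
  proof -
    have "- v \<in> K + L" if v: "v \<in> K + L" for v
    proof -
      obtain a b where ab: "v = a + b" "a \<in> K" "b \<in> L" using v by (auto simp: set_plus_def)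
      have "(- a) + (- b) \<in> K + L" by (intro set_plus_intro KbcsD(8)[OF K] KbcsD(8)[OF L] ab)
      then show ?thesis by (simp add: ab)
    qed
    then show ?thesis by (auto simp: image_iff) (metis minus_minus)
  qed
  moreover have "K + L \<noteq> {}" using set_plus_intro[OF KbcsD(7)[OF K] KbcsD(7)[OF L]] by blast
  ultimately show ?thesis by (simp add: Kbcs_def compact_eq_bounded_closed)
qed

lemma Kbcs_scale:
  assumes K: "K \<in> Kbcs" shows "set_scale c K \<in> Kbcs"
proof -
  have "compact (set_scale c K)" unfolding set_scale_def by (intro compact_scaling KbcsD(6) K)
  moreover have "convex (set_scale c K)" unfolding set_scale_def by (intro convex_scaling KbcsD(4) K)
  moreover have "uminus ` set_scale c K = set_scale c (uminus ` K)" by (auto simp: set_scale_def image_image)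
  ultimately show ?thesis using KbcsD(1,5)[OF K] by (auto simp: Kbcs_def compact_eq_bounded_closed set_scale_def)
qed

text \<open>A sum of two points lies in \<open>U\<close> iff the points lie in small balls with
  centres in a countable dense set whose Minkowski sum is contained in \<open>U\<close>.\<close>

lemma set_measurable_plus:
  fixes F G :: "'x::euclidean_space \<Rightarrow> ('a::euclidean_space) set"
  assumes F: "set_measurable F" and G: "set_measurable G"
  shows "set_measurable (\<lambda>x. F x + G x)"
  unfolding set_measurable_def
proof (intro allI impI)
  fix U :: "'a set" assume U: "open U"
  obtain A :: "'a set" where A: "countable A" "\<And>U. open U \<Longrightarrow> U \<noteq> {} \<Longrightarrow> \<exists>a\<in>A. a \<in> U"
    by (rule dense_set_exists) blast
  define r where "r n = 1 / real (Suc n)" for n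
  have r: "0 < r n" for n by (simp add: r_def)
  define T where "T = {(a, b, n). a \<in> A \<and> b \<in> A \<and> ball a (r n) + ball b (r n) \<subseteq> U}"
  have "T \<subseteq> A \<times> A \<times> UNIV" by (auto simp: T_def)
  then have T: "countable T" by (rule countable_subset) (use A(1) in auto)
  have "{x. (F x + G x) \<inter> U \<noteq> {}} = (\<Union>(a, b, n)\<in>T. {x. F x \<inter> ball a (r n) \<noteq> {}} \<inter> {x. G x \<inter> ball b (r n) \<noteq> {}})" (is "?L = ?R")
  proof (intro set_eqI iffI)
    fix x assume "x \<in> ?L"
    then obtain v w where vw: "v \<in> F x" "w \<in> G x" "v + w \<in> U" by (auto elim!: set_plus_elim)
    obtain e where e: "0 < e" "ball (v + w) e \<subseteq> U" using U vw(3) by (auto simp: open_contains_ball)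
    obtain n where n: "r n < e / 4"
      using reals_Archimedean[of "e / 4"] e(1) by (auto simp: r_def inverse_eq_divide)
    obtain a b where ab: "a \<in> A" "a \<in> ball v (r n)" "b \<in> A" "b \<in> ball w (r n)"
      using A(2)[of "ball v (r n)"] A(2)[of "ball w (r n)"] r by (metis ball_eq_empty not_le open_ball)
    have "ball a (r n) + ball b (r n) \<subseteq> ball (v + w) e"
    proof
      fix z assume "z \<in> ball a (r n) + ball b (r n)"
      then obtain y y' where y: "z = y + y'" "dist a y < r n" "dist b y' < r n"
        by (auto elim!: set_plus_elim)
      have "dist (v + w) z \<le> dist v y + dist w y'" unfolding y(1) by (rule dist_triangle_add)
      also have "\<dots> \<le> (dist v a + dist a y) + (dist w b + dist b y')" by (intro add_mono dist_triangle)
      also have "\<dots> < e" using y ab n by auto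
      finally show "z \<in> ball (v + w) e" by simp
    qed
    then have "(a, b, n) \<in> T" using ab e(2) by (auto simp: T_def)
    then show "x \<in> ?R" using vw ab by (auto simp: dist_commute intro!: bexI[of _ "(a, b, n)"])
  next
    fix x assume "x \<in> ?R"
    then obtain a b n v w where "(a, b, n) \<in> T" "v \<in> F x" "v \<in> ball a (r n)" "w \<in> G x" "w \<in> ball b (r n)"
      by auto
    then show "x \<in> ?L" using set_plus_intro[of v "ball a (r n)" w "ball b (r n)"] set_plus_intro[of v "F x" w "G x"]
      by (auto simp: T_def)
  qed
  also have "\<dots> \<in> sets lebesgue"
    using set_measurableD[OF F] set_measurableD[OF G] by (intro sets.countable_UN'[OF T]) auto
  finally show "{x. (F x + G x) \<inter> U \<noteq> {}} \<in> sets lebesgue" .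
qed

lemma set_measurable_scale:
  assumes F: "set_measurable F" shows "set_measurable (\<lambda>x. set_scale c (F x))"
  unfolding set_measurable_def
proof (intro allI impI)
  fix U :: "'b set" assume U: "open U"
  have "{x. set_scale c (F x) \<inter> U \<noteq> {}} = {x. F x \<inter> ((\<lambda>v. c *\<^sub>R v) -` U) \<noteq> {}}"
    by (auto simp: set_scale_def)
  also have "\<dots> \<in> sets lebesgue"
    by (intro set_measurableD[OF F] open_vimage U continuous_intros)
  finally show "{x. set_scale c (F x) \<inter> U \<noteq> {}} \<in> sets lebesgue" .
qed

lemma set_measurable_const: "set_measurable (\<lambda>x. K)"
  by (simp add: set_measurable_def)

lemma set_measurable_If:
  assumes "set_measurable F" "set_measurable G" "A \<in> sets lebesgue"
  shows "set_measurable (\<lambda>x. if x \<in> A then F x else G x)"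
  unfolding set_measurable_def
proof (intro allI impI)
  fix U :: "'b set" assume U: "open U"
  have "{x. (if x \<in> A then F x else G x) \<inter> U \<noteq> {}}
      = ({x. F x \<inter> U \<noteq> {}} \<inter> A) \<union> ({x. G x \<inter> U \<noteq> {}} - A)"
    by auto
  also have "\<dots> \<in> sets lebesgue"
    using assms(3) set_measurableD[OF assms(1) U] set_measurableD[OF assms(2) U] by blast
  finally show "{x. (if x \<in> A then F x else G x) \<inter> U \<noteq> {}} \<in> sets lebesgue" .
qed

lemma set_measurable_closure_UN:
  fixes F :: "nat \<Rightarrow> 'x::euclidean_space \<Rightarrow> ('a::euclidean_space) set"
  assumes "\<And>n. set_measurable (F n)" shows "set_measurable (\<lambda>x. closure (\<Union>n. F n x))"
  unfolding set_measurable_def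
proof (intro allI impI)
  fix U :: "'a set" assume U: "open U"
  have "{x. closure (\<Union>n. F n x) \<inter> U \<noteq> {}} = (\<Union>n. {x. F n x \<inter> U \<noteq> {}})"
    using open_Int_closure_eq_empty[OF U] by (auto simp: Int_commute)
  also have "\<dots> \<in> sets lebesgue" using set_measurableD[OF assms U] by (intro sets.countable_UN) auto
  finally show "{x. closure (\<Union>n. F n x) \<inter> U \<noteq> {}} \<in> sets lebesgue" .
qed

lemma bounded_set_measurable:
  assumes F: "set_measurable F" shows "{x. bounded (F x)} \<in> sets lebesgue"
proof -
  have "{x. bounded (F x)} = (\<Union>n::nat. - {x. F x \<inter> {v. real n < norm v} \<noteq> {}})"
  proof (intro set_eqI iffI)
    fix x assume "x \<in> {x. bounded (F x)}"
    then obtain a where a: "\<And>v. v \<in> F x \<Longrightarrow> norm v \<le> a" by (auto simp: bounded_iff)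
    obtain n where "a \<le> real n" using real_arch_simple by blast
    then have "F x \<inter> {v. real n < norm v} = {}" using a by fastforce
    then show "x \<in> (\<Union>n::nat. - {x. F x \<inter> {v. real n < norm v} \<noteq> {}})" by blast
  next
    fix x assume "x \<in> (\<Union>n::nat. - {x. F x \<inter> {v. real n < norm v} \<noteq> {}})"
    then obtain n where "F x \<inter> {v. real n < norm v} = {}" by blast
    then have "norm v \<le> real n" if "v \<in> F x" for v using that by (auto simp: not_less[symmetric])
    then show "x \<in> {x. bounded (F x)}" by (auto simp: bounded_iff)
  qed
  also have "\<dots> \<in> sets lebesgue"
  proof (intro sets.countable_UN image_subsetI)
    fix n :: nat
    have "{x. F x \<inter> {v. real n < norm v} \<noteq> {}} \<in> sets lebesgue"
      by (intro set_measurableD[OF F] open_Collect_less continuous_intros)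
    then show "- {x. F x \<inter> {v. real n < norm v} \<noteq> {}} \<in> sets lebesgue"
      by (simp add: sets.compl_sets Compl_in_sets_lebesgue)
  qed
  finally show ?thesis .
qed

section \<open>The maximal operator\<close>

text \<open>Completeness of Lebesgue measure; it is needed because elements of \<open>LpK\<close>
  only agree almost everywhere with measurable maps.\<close>

lemma measurable_lebesgue_AE:
  fixes f :: "'x::euclidean_space \<Rightarrow> 'b::topological_space"
  assumes f: "f \<in> borel_measurable lebesgue" and ae: "AE x in lebesgue. f x = g x"
  shows "g \<in> borel_measurable lebesgue"
proof (rule measurableI)
  fix A :: "'b set" assume A: "A \<in> sets borel"
  have "AE x in lebesgue. x \<in> f -` A \<inter> space lebesgue \<longleftrightarrow> x \<in> g -` A \<inter> space lebesgue"
    using ae by eventually_elim simp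
  then show "g -` A \<inter> space lebesgue \<in> sets lebesgue"
    by (rule completion.in_sets_AE) (use measurable_sets[OF f A] in auto)
qed simp

lemma aumann_integral_cong:
  assumes "AE x in lebesgue. F x = G x" shows "aumann_integral Q F = aumann_integral Q G"
proof -
  have "(AE y in lebesgue. y \<in> Q \<longrightarrow> f y \<in> F y) \<longleftrightarrow> (AE y in lebesgue. y \<in> Q \<longrightarrow> f y \<in> G y)" for f
    using assms by (intro eventually_subst) (auto elim: eventually_mono)
  then show ?thesis by (simp add: aumann_integral_def)
qed

lemma maximal_op_cong:
  assumes "AE x in lebesgue. F x = G x" shows "maximal_op F = maximal_op G"
  using aumann_integral_cong[OF assms] by (simp add: maximal_op_def avg_op_def fun_eq_iff)

lemma zero_in_avg_op:
  assumes "AE y in lebesgue. 0 \<in> F y" shows "0 \<in> avg_op Q F x"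
proof -
  have "0 \<in> aumann_integral Q F"
    unfolding aumann_integral_def
    by (rule CollectI, rule exI[of _ "\<lambda>_. 0"]) (use assms in \<open>auto simp: set_integrable_def set_lebesgue_integral_def\<close>)
  then show ?thesis by (auto simp: avg_op_def set_scale_def intro: rev_image_eqI)
qed

lemma cubes_nonempty: "cubes \<noteq> {}"
  unfolding cubes_def by (auto intro: exI[of _ 1])

text \<open>Since the cubes are open, the maximal function is lower semicontinuous.\<close>

lemma maximal_op_set_measurable:
  assumes z: "AE y in lebesgue. 0 \<in> F y" shows "set_measurable (maximal_op F)"
  unfolding set_measurable_def
proof (intro allI impI)
  fix U :: "(real^'b) set" assume U: "open U"
  let ?S = "\<lambda>x. \<Union>Q\<in>cubes. avg_op Q F x"
  have eq: "{x. maximal_op F x \<inter> U \<noteq> {}} = {x. convex hull (?S x) \<inter> U \<noteq> {}}"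
    using open_Int_closure_eq_empty[OF U] by (auto simp: maximal_op_def Int_commute)
  have "open {x. convex hull (?S x) \<inter> U \<noteq> {}}"
    unfolding open_subopen[of "{x. convex hull (?S x) \<inter> U \<noteq> {}}"]
  proof
    fix x assume "x \<in> {x. convex hull (?S x) \<inter> U \<noteq> {}}"
    then obtain v where v: "v \<in> convex hull (?S x)" "v \<in> U" by blast
    then obtain T u where T: "finite T" "T \<subseteq> ?S x" and u: "\<forall>s\<in>T. 0 \<le> u s" "sum u T = 1" "(\<Sum>s\<in>T. u s *\<^sub>R s) = v"
      unfolding convex_hull_explicit by blast
    have "\<forall>s\<in>T. \<exists>Q\<in>cubes. s \<in> avg_op Q F x" using T(2) by blast
    then obtain Q where Q: "\<And>s. s \<in> T \<Longrightarrow> Q s \<in> cubes" "\<And>s. s \<in> T \<Longrightarrow> s \<in> avg_op (Q s) F x" by metis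
    \<comment> \<open>Only finitely many cubes enter a convex combination. Those containing
      \<open>x\<close> contain a common neighbourhood; the others contribute the vector 0, which
      belongs to every average.\<close>
    define V where "V = (\<Inter>s\<in>{s\<in>T. x \<in> Q s}. Q s)"
    have "open V" unfolding V_def using T(1) Q(1) open_cubes by (intro open_INT) auto
    moreover have "x \<in> V" by (simp add: V_def)
    moreover have "V \<subseteq> {x. convex hull (?S x) \<inter> U \<noteq> {}}"
    proof
      fix y assume y: "y \<in> V"
      have "s \<in> avg_op (Q s) F y" if s: "s \<in> T" for s
      proof (cases "x \<in> Q s")
        case True
        then have "y \<in> Q s" using y s by (auto simp: V_def)
        then show ?thesis using Q(2)[OF s] True by (simp add: avg_op_def)
      next
        case False
        then have "s = 0" using Q(2)[OF s] by (simp add: avg_op_def)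
        then show ?thesis using zero_in_avg_op[OF z] by simp
      qed
      then have "T \<subseteq> ?S y" using Q(1) by blast
      then have "v \<in> convex hull (?S y)" unfolding convex_hull_explicit using T(1) u by blast
      then show "y \<in> {x. convex hull (?S x) \<inter> U \<noteq> {}}" using v(2) by blast
    qed
    ultimately show "\<exists>V. open V \<and> x \<in> V \<and> V \<subseteq> {x. convex hull (?S x) \<inter> U \<noteq> {}}" by blast
  qed
  then show "{x. maximal_op F x \<inter> U \<noteq> {}} \<in> sets lebesgue" unfolding eq by simp
qed

lemma zero_in_maximal_op:
  assumes "AE y in lebesgue. 0 \<in> F y" shows "0 \<in> maximal_op F x"
proof -
  obtain Q where "Q \<in> (cubes :: (real^'a) set set)" using cubes_nonempty by blast
  then have "0 \<in> (\<Union>Q\<in>cubes. avg_op Q F x)" using zero_in_avg_op[OF assms] by blast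
  then show ?thesis unfolding maximal_op_def by (intro closure_subset[THEN subsetD] hull_inc)
qed

lemma avg_op_uminus:
  assumes sym: "AE y in lebesgue. uminus ` F y = F y" and v: "v \<in> avg_op Q F x" shows "- v \<in> avg_op Q F x"
proof (cases "x \<in> Q")
  case True
  then obtain f where f: "set_integrable lebesgue Q f" "AE y in lebesgue. y \<in> Q \<longrightarrow> f y \<in> F y"
    "v = (1 / measure lebesgue Q) *\<^sub>R (LINT y:Q|lebesgue. f y)"
    using v by (auto simp: avg_op_def set_scale_def aumann_integral_def)
  have "AE y in lebesgue. y \<in> Q \<longrightarrow> - f y \<in> F y"
    using f(2) sym by eventually_elim auto
  moreover have "set_integrable lebesgue Q (\<lambda>y. - f y)"
    using integrable_minus[OF f(1)[unfolded set_integrable_def]]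
    unfolding set_integrable_def by (simp only: scaleR_minus_right)
  moreover have "- (LINT y:Q|lebesgue. f y) = (LINT y:Q|lebesgue. - f y)"
    by (simp add: set_lebesgue_integral_def)
  ultimately have "- (LINT y:Q|lebesgue. f y) \<in> aumann_integral Q F"
    unfolding aumann_integral_def by blast
  then have "(1 / measure lebesgue Q) *\<^sub>R (- (LINT y:Q|lebesgue. f y)) \<in> avg_op Q F x"
    unfolding avg_op_def set_scale_def if_P[OF True] by (rule imageI)
  then show ?thesis by (simp add: f(3))
qed (use v in \<open>simp add: avg_op_def\<close>)

text \<open>All properties except boundedness pass from the averages to the closed convex hull;
  symmetry comes from negating selections.\<close>

lemma maximal_op_Kbcs:
  assumes K: "AE y in lebesgue. F y \<in> Kbcs" and b: "bounded (maximal_op F x)"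
  shows "maximal_op F x \<in> Kbcs"
proof -
  let ?S = "\<Union>Q\<in>cubes. avg_op Q F x"
  have z: "AE y in lebesgue. 0 \<in> F y" using K by eventually_elim (rule KbcsD)
  have "AE y in lebesgue. uminus ` F y = F y" using K by eventually_elim (rule KbcsD)
  note neg = avg_op_uminus[OF this]
  have S: "(\<lambda>v. (- 1) *\<^sub>R v) ` ?S = ?S"
  proof -
    have "- v \<in> ?S" if "v \<in> ?S" for v using that neg by blast
    then show ?thesis by (auto simp: image_iff) (metis minus_minus)
  qed
  have "(\<lambda>v. (- 1) *\<^sub>R v) ` maximal_op F x = closure ((\<lambda>v. (- 1) *\<^sub>R v) ` (convex hull ?S))"
    unfolding maximal_op_def by (rule closure_scaleR)
  also have "(\<lambda>v. (- 1) *\<^sub>R v) ` (convex hull ?S) = convex hull ?S"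
    using convex_hull_linear_image[OF linear_scaleR, of "- 1" ?S] unfolding S .
  finally have "uminus ` maximal_op F x = maximal_op F x" by (simp add: maximal_op_def)
  moreover have "maximal_op F x \<noteq> {}" using zero_in_maximal_op[OF z, of x] by blast
  moreover have "convex (maximal_op F x)" unfolding maximal_op_def by (intro convex_closure convex_convex_hull)
  ultimately show ?thesis using b by (auto simp: Kbcs_def maximal_op_def)
qed

text \<open>Sublevel sets of a norm are closed and convex, so bounds for the maximal function need
  only be checked on single averages.\<close>

lemma norm_of_set_closure_hull:
  fixes q :: "real^'d \<Rightarrow> real"
  assumes q: "is_norm q" and le: "\<And>v. v \<in> S \<Longrightarrow> ennreal (q v) \<le> a"
  shows "norm_of_set q (closure (convex hull S)) \<le> a"
proof (cases a)
  case (real r)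
  have S: "S \<subseteq> {v. q v \<le> r}" using le real by auto
  have "convex {v. q v \<le> r}"
  proof (rule convexI)
    fix v w :: "real^'d" and s t :: real
    assume "v \<in> {v. q v \<le> r}" "w \<in> {v. q v \<le> r}" and st: "0 \<le> s" "0 \<le> t" "s + t = 1"
    then have "s * q v + t * q w \<le> s * r + t * r" by (intro add_mono mult_left_mono) auto
    also have "\<dots> = r" using st by (simp flip: distrib_right)
    finally have "s * q v + t * q w \<le> r" .
    then show "s *\<^sub>R v + t *\<^sub>R w \<in> {v. q v \<le> r}"
      using is_normD(4)[OF q, of "s *\<^sub>R v" "t *\<^sub>R w"] st by (simp add: is_normD(3)[OF q])
  qed
  moreover have "closed {v. q v \<le> r}" by (intro closed_Collect_le is_norm_continuous_on[OF q] continuous_intros)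
  ultimately have "closure (convex hull S) \<subseteq> {v. q v \<le> r}"
    using S by (intro closure_minimal hull_minimal)
  then show ?thesis using real by (auto simp: norm_of_set_def intro!: SUP_least ennreal_leI)
qed simp

lemma norm_of_set_mono: "K \<subseteq> L \<Longrightarrow> norm_of_set q K \<le> norm_of_set q L"
  unfolding norm_of_set_def by (rule SUP_subset_mono) auto

lemma norm_of_set_upper: "v \<in> K \<Longrightarrow> ennreal (q v) \<le> norm_of_set q K"
  unfolding norm_of_set_def by (rule SUP_upper)

lemma norm_of_set_finite_iff:
  fixes q :: "real^'d \<Rightarrow> real"
  assumes q: "is_norm q" shows "norm_of_set q K < \<infinity> \<longleftrightarrow> bounded K"
proof
  assume fin: "norm_of_set q K < \<infinity>"
  obtain c where c: "0 < c" "\<And>v. c * norm v \<le> q v" by (rule is_norm_ge[OF q]) blast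
  have "norm v \<le> enn2real (norm_of_set q K) / c" if "v \<in> K" for v
  proof -
    have "ennreal (q v) \<le> ennreal (enn2real (norm_of_set q K))"
      using norm_of_set_upper[OF that, of q] fin by simp
    then have "c * norm v \<le> enn2real (norm_of_set q K)"
      using c(2)[of v] by (subst (asm) ennreal_le_iff) auto
    then show ?thesis using c(1) by (simp add: field_simps)
  qed
  then show "bounded K" by (auto simp: bounded_iff)
next
  assume "bounded K"
  then obtain a where a: "\<And>v. v \<in> K \<Longrightarrow> norm v \<le> a" by (auto simp: bounded_iff)
  define C where "C = (\<Sum>i\<in>UNIV. q (axis i (1::real)))"
  have "norm_of_set q K \<le> ennreal (C * a)"
    unfolding norm_of_set_def
  proof (intro SUP_least ennreal_leI)
    fix v assume "v \<in> K"
    then have "C * norm v \<le> C * a"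
      by (intro mult_left_mono a) (simp_all add: C_def sum_nonneg is_normD(1)[OF q])
    then show "q v \<le> C * a" using is_norm_le_axis[OF q, of v] by (simp add: C_def)
  qed
  then show "norm_of_set q K < \<infinity>" by (rule order.strict_trans1) simp
qed

section \<open>From averages over cubes to polar bodies of grid cells\<close>

context Ap_setting
begin

text \<open>For a selection \<open>f\<close> one has
  \<open>\<bar>f y \<bullet> w\<bar> \<le> \<rho> y (f y) * D y w\<close>; integrating puts every
  average over \<open>Q\<close> into the polar body.\<close>

lemma avg_inner_le:
  assumes Q: "Q \<in> cubes" "x \<in> Q" and u: "u \<in> avg_op Q F x"
    and h: "AE y in lebesgue. \<forall>v\<in>F y. \<rho> y v \<le> h y"
  shows "ennreal \<bar>u \<bullet> w\<bar> * emeasure lebesgue Q \<le> (\<integral>\<^sup>+y\<in>Q. ennreal (h y * D y w) \<partial>lebesgue)"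
proof -
  obtain f where f: "set_integrable lebesgue Q f" "AE y in lebesgue. y \<in> Q \<longrightarrow> f y \<in> F y"
    "u = (1 / measure lebesgue Q) *\<^sub>R (LINT y:Q|lebesgue. f y)"
    using u Q by (auto simp: avg_op_def set_scale_def aumann_integral_def)
  define g where "g y = indicator Q y *\<^sub>R f y" for y
  have g: "integrable lebesgue g" using f(1) by (simp add: g_def[abs_def] set_integrable_def)
  define m where "m = measure lebesgue Q"
  have m: "emeasure lebesgue Q = ennreal m" "0 < m" using cubes_emeasure[OF Q(1)] by (simp_all add: m_def)
  have "(LINT y|lebesgue. g y \<bullet> w) = (LINT y|lebesgue. g y) \<bullet> w" using g by simp
  then have "u \<bullet> w * m = (LINT y|lebesgue. g y \<bullet> w)"
    using m by (simp add: f(3) set_lebesgue_integral_def g_def[symmetric] m_def[symmetric])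
  then have "ennreal \<bar>u \<bullet> w\<bar> * emeasure lebesgue Q = ennreal (norm (LINT y|lebesgue. g y \<bullet> w))"
    using m by (metis abs_ge_zero abs_mult abs_of_pos ennreal_mult real_norm_def)
  also have "\<dots> \<le> (\<integral>\<^sup>+y. ennreal (norm (g y \<bullet> w)) \<partial>lebesgue)"
    using g by (intro integral_norm_bound_ennreal) simp
  also have "\<dots> \<le> (\<integral>\<^sup>+y\<in>Q. ennreal (h y * D y w) \<partial>lebesgue)"
  proof (rule nn_integral_mono_AE)
    show "AE y in lebesgue. ennreal (norm (g y \<bullet> w)) \<le> ennreal (h y * D y w) * indicator Q y"
      using f(2) h
    proof eventually_elim
      case (elim y)
      show ?case
      proof (cases "y \<in> Q")
        case True
        have "\<bar>f y \<bullet> w\<bar> \<le> \<rho> y (f y) * D y w" by (rule inner_le)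
        also have "\<dots> \<le> h y * D y w" using elim True by (intro mult_right_mono) auto
        finally show ?thesis using True by (simp add: g_def ennreal_leI)
      qed (simp add: g_def)
    qed
  qed
  finally show ?thesis .
qed

lemma avg_in_cell:
  assumes Q: "Q \<in> cubes" "x \<in> Q" and u: "u \<in> avg_op Q F x"
    and h: "AE y in lebesgue. \<forall>v\<in>F y. \<rho> y v \<le> h y"
    and sub: "Q \<subseteq> T" and T: "emeasure lebesgue T \<le> ennreal a * emeasure lebesgue Q" and a: "0 < a"
  shows "ennreal \<bar>((1 / a) *\<^sub>R u) \<bullet> w\<bar> * emeasure lebesgue T \<le> (\<integral>\<^sup>+y\<in>T. ennreal (h y * D y w) \<partial>lebesgue)"
proof -
  have "ennreal \<bar>((1 / a) *\<^sub>R u) \<bullet> w\<bar> * emeasure lebesgue T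
    \<le> ennreal \<bar>((1 / a) *\<^sub>R u) \<bullet> w\<bar> * (ennreal a * emeasure lebesgue Q)"
    by (intro mult_left_mono T) simp
  also have "\<dots> = ennreal \<bar>u \<bullet> w\<bar> * emeasure lebesgue Q"
    using a by (simp add: abs_mult flip: mult.assoc ennreal_mult)
  also have "\<dots> \<le> (\<integral>\<^sup>+y\<in>Q. ennreal (h y * D y w) \<partial>lebesgue)"
    by (rule avg_inner_le[OF Q u h])
  also have "\<dots> \<le> (\<integral>\<^sup>+y\<in>T. ennreal (h y * D y w) \<partial>lebesgue)"
    using sub by (intro nn_integral_mono) (auto split: split_indicator)
  finally show ?thesis .
qed

text \<open>The cell has mesh at most six times the side of the cube, hence the factor 6 to the
  power of the dimension. Only large \<open>N\<close> work, since the mesh at level 0 must exceed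
  three times the side.\<close>

lemma avg_in_some_cell:
  assumes Q: "Q \<in> cubes" "x \<in> Q" and u: "u \<in> avg_op Q F x"
    and h: "AE y in lebesgue. \<forall>v\<in>F y. \<rho> y v \<le> h y"
  shows "\<forall>\<^sub>F N in sequentially. \<exists>\<tau> k. polar (gcell (real (Suc N)) \<tau> k x) h ((1 / 6 ^ CARD('n)) *\<^sub>R u)"
proof -
  obtain b l where Qb: "Q = box b (\<chi> i. b $ i + l)" and l: "0 < l"
    using Q(1) by (auto simp: cubes_def)
  obtain N0 :: nat where N0: "3 * l < real N0" using reals_Archimedean2 by blast
  show ?thesis
  proof (rule eventually_sequentiallyI)
    fix N assume "N0 \<le> N"
    then have "3 * l < real (Suc N)" using N0 by simp
    then obtain \<tau> k where \<tau>: "\<And>x. x \<in> box b (\<chi> i. b $ i + l) \<Longrightarrow> box b (\<chi> i. b $ i + l) \<subseteq> gcell (real (Suc N)) \<tau> k x"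
      "real (Suc N) / 2 ^ k \<le> 6 * l"
      by (rule cube_in_cell[OF l]) blast
    have "emeasure lebesgue (gcell (real (Suc N)) \<tau> k x) = ennreal ((real (Suc N) / 2 ^ k) ^ CARD('n))"
      by (rule gix_emeasure) simp
    also have "\<dots> \<le> ennreal ((6 * l) ^ CARD('n))"
      using \<tau>(2) by (intro ennreal_leI power_mono) auto
    also have "\<dots> = ennreal (6 ^ CARD('n)) * emeasure lebesgue Q"
      unfolding Qb emeasure_cube[OF less_imp_le[OF l]] using l by (simp add: power_mult_distrib ennreal_mult)
    finally have "emeasure lebesgue (gcell (real (Suc N)) \<tau> k x) \<le> ennreal (6 ^ CARD('n)) * emeasure lebesgue Q" .
    from avg_in_cell[OF Q u h _ this] \<tau>(1)[of x] Q(2)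
    show "\<exists>\<tau> k. polar (gcell (real (Suc N)) \<tau> k x) h ((1 / 6 ^ CARD('n)) *\<^sub>R u)"
      unfolding Qb by (intro exI[of _ \<tau>] exI[of _ k]) simp
  qed
qed

text \<open>Each cube is caught by a grid for all large \<open>N\<close>, so the lower limit of the
  bounds for the single \<open>N\<close> dominates the maximal function, and Fatou's lemma preserves
  a constant that is free of \<open>N\<close>. The factors are \<open>a powr P\<close> for enlarging
  cubes to cells and \<open>m\<close> for the number of shifts.\<close>

lemma maximal_bound_fin:
  assumes fin: "p \<noteq> top"
  obtains K where "\<And>F h. h \<in> borel_measurable lebesgue \<Longrightarrow> (\<And>x. 0 < h x) \<Longrightarrow>
    (\<integral>\<^sup>+x. ennreal (h x powr P) \<partial>lebesgue) < \<infinity> \<Longrightarrow> AE y in lebesgue. \<forall>v\<in>F y. \<rho> y v \<le> h y \<Longrightarrow>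
    (\<integral>\<^sup>+x. ennreal_powr (norm_of_set (\<rho> x) (maximal_op F x)) P \<partial>lebesgue)
      \<le> ennreal K * (\<integral>\<^sup>+x. ennreal (h x powr P) \<partial>lebesgue)"
proof -
  note P = P_gt[OF fin]
  obtain K where K: "\<And>h L \<tau>. h \<in> borel_measurable lebesgue \<Longrightarrow> (\<And>x. 0 < h x) \<Longrightarrow>
    (\<integral>\<^sup>+x. ennreal (h x powr P) \<partial>lebesgue) < \<infinity> \<Longrightarrow> 0 < L \<Longrightarrow>
    \<exists>B\<in>borel_measurable lebesgue.
      (\<forall>x k u. polar (gcell L \<tau> k x) h u \<longrightarrow> ennreal (\<rho> x u powr P) \<le> B x) \<and>
      (\<integral>\<^sup>+x. B x \<partial>lebesgue) \<le> ennreal K * (\<integral>\<^sup>+x. ennreal (h x powr P) \<partial>lebesgue)"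
    by (rule grid_maximal[OF fin]) blast
  define a :: real where "a = 6 ^ CARD('n)"
  have a: "0 < a" by (simp add: a_def)
  define m where "m = real (card (UNIV :: ('n \<Rightarrow> bool) set))"
  show ?thesis
  proof
    fix F and h :: "real^'n \<Rightarrow> real"
    assume h: "h \<in> borel_measurable lebesgue" "\<And>x. 0 < h x" "(\<integral>\<^sup>+x. ennreal (h x powr P) \<partial>lebesgue) < \<infinity>"
      and F: "AE y in lebesgue. \<forall>v\<in>F y. \<rho> y v \<le> h y"
    define H where "H = (\<integral>\<^sup>+x. ennreal (h x powr P) \<partial>lebesgue)"
    define good where "good N \<tau> B \<longleftrightarrow> B \<in> borel_measurable lebesgue \<and>
      (\<forall>x k u. polar (gcell (real (Suc N)) \<tau> k x) h u \<longrightarrow> ennreal (\<rho> x u powr P) \<le> B x) \<and> (\<integral>\<^sup>+x. B x \<partial>lebesgue) \<le> ennreal K * H" for N \<tau> B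
    have "\<exists>B. good N \<tau> B" for N \<tau>
      using K[OF h, of "real (Suc N)" \<tau>, OF of_nat_0_less_iff[THEN iffD2, OF zero_less_Suc]]
      unfolding good_def H_def Bex_def .
    then obtain B where good: "\<And>N \<tau>. good N \<tau> (B N \<tau>)" by metis
    then have B: "\<And>N \<tau>. B N \<tau> \<in> borel_measurable lebesgue"
      "\<And>N \<tau> x k u. (\<And>w. ennreal \<bar>u \<bullet> w\<bar> * emeasure lebesgue (gcell (real (Suc N)) \<tau> k x) \<le> (\<integral>\<^sup>+y\<in>gcell (real (Suc N)) \<tau> k x. ennreal (h y * D y w) \<partial>lebesgue))
          \<Longrightarrow> ennreal (\<rho> x u powr P) \<le> B N \<tau> x"
      "\<And>N \<tau>. (\<integral>\<^sup>+x. B N \<tau> x \<partial>lebesgue) \<le> ennreal K * H"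
      unfolding good_def by blast+
    note B(1) [measurable]
    define S where "S N x = (\<Sum>\<tau>\<in>UNIV. B N \<tau> x)" for N x
    have [measurable]: "S N \<in> borel_measurable lebesgue" for N unfolding S_def by measurable
    have le: "ennreal_powr (norm_of_set (\<rho> x) (maximal_op F x)) P \<le> ennreal (a powr P) * liminf (\<lambda>N. S N x)" for x
    proof -
      have "norm_of_set (\<rho> x) (maximal_op F x) \<le> ennreal_powr (ennreal (a powr P) * liminf (\<lambda>N. S N x)) (1 / P)"
        unfolding maximal_op_def
      proof (rule norm_of_set_closure_hull[OF \<rho>_norm])
        fix u assume "u \<in> (\<Union>Q\<in>cubes. avg_op Q F x)"
        then obtain Q where Q: "Q \<in> cubes" "u \<in> avg_op Q F x" by blast
        show "ennreal (\<rho> x u) \<le> ennreal_powr (ennreal (a powr P) * liminf (\<lambda>N. S N x)) (1 / P)"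
        proof (cases "x \<in> Q")
          case False
          then have "u = 0" using Q by (simp add: avg_op_def)
          then show ?thesis by (simp add: is_normD(5)[OF \<rho>_norm])
        next
          case True
          have "\<forall>\<^sub>F N in sequentially. ennreal (\<rho> x ((1 / a) *\<^sub>R u) powr P) \<le> S N x"
            using avg_in_some_cell[OF Q(1) True Q(2) F]
          proof eventually_elim
            case (elim N)
            then obtain \<tau> k where "\<And>w. ennreal \<bar>((1 / a) *\<^sub>R u) \<bullet> w\<bar> * emeasure lebesgue (gcell (real (Suc N)) \<tau> k x)
              \<le> (\<integral>\<^sup>+y\<in>gcell (real (Suc N)) \<tau> k x. ennreal (h y * D y w) \<partial>lebesgue)"
              unfolding a_def by blast
            then have "ennreal (\<rho> x ((1 / a) *\<^sub>R u) powr P) \<le> B N \<tau> x" by (rule B(2))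
            also have "\<dots> \<le> S N x" unfolding S_def by (rule member_le_sum) auto
            finally show ?case .
          qed
          then have "ennreal (\<rho> x ((1 / a) *\<^sub>R u) powr P) \<le> liminf (\<lambda>N. S N x)" by (rule Liminf_bounded)
          then have "ennreal (a powr P) * ennreal (\<rho> x ((1 / a) *\<^sub>R u) powr P) \<le> ennreal (a powr P) * liminf (\<lambda>N. S N x)"
            by (rule mult_left_mono) simp
          also have "ennreal (a powr P) * ennreal (\<rho> x ((1 / a) *\<^sub>R u) powr P) = ennreal (\<rho> x u powr P)"
            using a by (simp add: is_normD(3)[OF \<rho>_norm] powr_divide flip: ennreal_mult)
          finally have "ennreal_powr (ennreal (\<rho> x u)) P \<le> ennreal (a powr P) * liminf (\<lambda>N. S N x)"
            by (simp add: ennreal_powr_ennreal)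
          then show ?thesis using P by (subst (asm) ennreal_powr_le_iff) auto
        qed
      qed
      then show ?thesis using P by (subst ennreal_powr_le_iff) auto
    qed
    have "(\<integral>\<^sup>+x. ennreal_powr (norm_of_set (\<rho> x) (maximal_op F x)) P \<partial>lebesgue)
      \<le> (\<integral>\<^sup>+x. ennreal (a powr P) * liminf (\<lambda>N. S N x) \<partial>lebesgue)"
      by (intro nn_integral_mono le)
    also have "\<dots> = ennreal (a powr P) * (\<integral>\<^sup>+x. liminf (\<lambda>N. S N x) \<partial>lebesgue)"
      by (rule nn_integral_cmult) measurable
    also have "\<dots> \<le> ennreal (a powr P) * liminf (\<lambda>N. \<integral>\<^sup>+x. S N x \<partial>lebesgue)"
      by (intro mult_left_mono nn_integral_liminf) auto
    also have "\<dots> \<le> ennreal (a powr P) * (ennreal m * (ennreal K * H))"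
    proof (rule mult_left_mono)
      have "(\<integral>\<^sup>+x. S N x \<partial>lebesgue) \<le> ennreal m * (ennreal K * H)" for N
      proof -
        have "(\<integral>\<^sup>+x. S N x \<partial>lebesgue) = (\<Sum>\<tau>\<in>UNIV. \<integral>\<^sup>+x. B N \<tau> x \<partial>lebesgue)"
          unfolding S_def by (rule nn_integral_sum) auto
        also have "\<dots> \<le> (\<Sum>\<tau>\<in>(UNIV :: ('n \<Rightarrow> bool) set). ennreal K * H)" by (intro sum_mono B)
        also have "\<dots> = ennreal m * (ennreal K * H)" by (simp add: m_def ennreal_of_nat_eq_real_of_nat)
        finally show ?thesis .
      qed
      then show "liminf (\<lambda>N. \<integral>\<^sup>+x. S N x \<partial>lebesgue) \<le> ennreal m * (ennreal K * H)"
        by (intro order.trans[OF Liminf_le_Limsup] Limsup_bounded) auto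
    qed simp
    also have "\<dots> = ennreal (a powr P * m * max 0 K) * H"
      by (simp add: ennreal_mult m_def mult.assoc max_def ennreal_neg)
    finally show "(\<integral>\<^sup>+x. ennreal_powr (norm_of_set (\<rho> x) (maximal_op F x)) P \<partial>lebesgue)
      \<le> ennreal (a powr P * m * max 0 K) * (\<integral>\<^sup>+x. ennreal (h x powr P) \<partial>lebesgue)"
      by (simp add: H_def)
  qed
qed

text \<open>Almost every point is good for all \<open>N\<close> and \<open>\<tau>\<close> at once,
  so a single suitable grid per cube is enough and no limit is taken.\<close>

lemma maximal_bound_top:
  assumes top: "p = top"
  obtains K where "0 \<le> K" "\<And>F H. 0 \<le> H \<Longrightarrow> AE y in lebesgue. \<forall>v\<in>F y. \<rho> y v \<le> H \<Longrightarrow>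
    AE x in lebesgue. norm_of_set (\<rho> x) (maximal_op F x) \<le> ennreal (K * H)"
proof -
  obtain K where K: "0 \<le> K" "\<And>H L \<tau>. 0 \<le> H \<Longrightarrow> 0 < L \<Longrightarrow>
    AE x in lebesgue. \<forall>k u. polar (gcell L \<tau> k x) (\<lambda>_. H) u \<longrightarrow> \<rho> x u \<le> K * H"
    by (rule grid_maximal_top[OF top]) blast
  define a :: real where "a = 6 ^ CARD('n)"
  have a: "0 < a" by (simp add: a_def)
  show ?thesis
  proof
    show "0 \<le> a * K" using a K(1) by simp
    fix F and H :: real assume H: "0 \<le> H" and F: "AE y in lebesgue. \<forall>v\<in>F y. \<rho> y v \<le> H"
    have "AE x in lebesgue. \<forall>k u. polar (gcell (real (Suc N)) \<tau> k x) (\<lambda>_. H) u \<longrightarrow> \<rho> x u \<le> K * H" for N \<tau>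
      by (rule K(2)[OF H]) simp
    then have "AE x in lebesgue. \<forall>N \<tau> k u. polar (gcell (real (Suc N)) \<tau> k x) (\<lambda>_. H) u \<longrightarrow> \<rho> x u \<le> K * H"
      by (subst AE_all_countable, intro allI, subst AE_all_countable, intro allI)
    then show "AE x in lebesgue. norm_of_set (\<rho> x) (maximal_op F x) \<le> ennreal (a * K * H)"
    proof eventually_elim
      case (elim x)
      show ?case unfolding maximal_op_def
      proof (rule norm_of_set_closure_hull[OF \<rho>_norm])
        fix u assume "u \<in> (\<Union>Q\<in>cubes. avg_op Q F x)"
        then obtain Q where Q: "Q \<in> cubes" "u \<in> avg_op Q F x" by blast
        show "ennreal (\<rho> x u) \<le> ennreal (a * K * H)"
        proof (cases "x \<in> Q")
          case False
          then have "u = 0" using Q by (simp add: avg_op_def)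
          then show ?thesis by (simp add: is_normD(5)[OF \<rho>_norm])
        next
          case True
          obtain N \<tau> k where "polar (gcell (real (Suc N)) \<tau> k x) (\<lambda>_. H) ((1 / a) *\<^sub>R u)"
            using eventually_happens[OF avg_in_some_cell[OF Q(1) True Q(2) F]] unfolding a_def by auto
          then have "\<rho> x ((1 / a) *\<^sub>R u) \<le> K * H" using elim by blast
          then show ?thesis using a by (intro ennreal_leI) (simp add: is_normD(3)[OF \<rho>_norm] field_simps)
        qed
      qed
    qed
  qed
qed

end

section \<open>Finiteness of the operator norm\<close>

lemma norm_of_set_scale: 
  fixes q :: "real^'d \<Rightarrow> real"
  assumes "\<And>v. q (c *\<^sub>R v) = \<bar>c\<bar> * q v"
  shows "norm_of_set q (set_scale c K) = ennreal \<bar>c\<bar> * norm_of_set q K"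
  unfolding norm_of_set_def set_scale_def image_image assms SUP_mult_left_ennreal
  by (simp add: ennreal_mult')

lemma norm_of_set_plus:
  fixes q :: "real^'d \<Rightarrow> real"
  assumes "\<And>v w. q (v + w) \<le> q v + q w" "\<And>v. 0 \<le> q v"
  shows "norm_of_set q (K + L) \<le> norm_of_set q K + norm_of_set q L"
  unfolding norm_of_set_def[of q "K + L"]
proof (rule SUP_least)
  fix v assume "v \<in> K + L"
  then obtain a b where ab: "v = a + b" "a \<in> K" "b \<in> L" by (auto simp: set_plus_def)
  have "ennreal (q v) \<le> ennreal (q a + q b)" unfolding ab(1) by (intro ennreal_leI assms)
  also have "\<dots> = ennreal (q a) + ennreal (q b)" by (simp add: assms)
  also have "\<dots> \<le> norm_of_set q K + norm_of_set q L" by (intro add_mono norm_of_set_upper ab)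
  finally show "ennreal (q v) \<le> norm_of_set q K + norm_of_set q L" .
qed

lemma is_norm_norm: "is_norm (norm :: real^'d \<Rightarrow> real)"
  by (auto simp: is_norm_def norm_triangle_ineq)

context Ap_setting
begin

lemma norm_meas: "set_measurable F \<Longrightarrow> (\<lambda>x. norm_of_set (\<rho> x) (F x)) \<in> borel_measurable lebesgue"
  by (rule measurable_norm_of_set) (use \<rho>_norm in auto)

lemma LpK_norm_cong:
  assumes "AE x in lebesgue. F x = G x" and G: "set_measurable G"
  shows "(\<lambda>x. norm_of_set (\<rho> x) (F x)) \<in> borel_measurable lebesgue" "LpK_norm p \<rho> F = LpK_norm p \<rho> G"
proof -
  have ae: "AE x in lebesgue. norm_of_set (\<rho> x) (G x) = norm_of_set (\<rho> x) (F x)"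
    using assms(1) by eventually_elim simp
  then show m: "(\<lambda>x. norm_of_set (\<rho> x) (F x)) \<in> borel_measurable lebesgue"
    by (rule measurable_lebesgue_AE[OF norm_meas[OF G]])
  show "LpK_norm p \<rho> F = LpK_norm p \<rho> G"
    unfolding LpK_norm_def using ae by (intro Lp_norm_cong_AE p m norm_meas G) (auto elim: eventually_mono)
qed

lemma LpKE:
  assumes "F \<in> LpK p \<rho>"
  obtains F' where "Kbcs_measurable F'" "AE x in lebesgue. F x = F' x"
    "LpK_norm p \<rho> F' = LpK_norm p \<rho> F" "LpK_norm p \<rho> F < \<infinity>"
proof -
  obtain F' where "Kbcs_measurable F'" "AE x in lebesgue. F x = F' x" "LpK_norm p \<rho> F < \<infinity>"
    using assms by (auto simp: LpK_def)
  then show ?thesis using that[of F'] LpK_norm_cong[of F F'] by (simp add: Kbcs_measurable_iff)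
qed

lemma LpKI:
  assumes "Kbcs_measurable F'" "AE x in lebesgue. F x = F' x" "LpK_norm p \<rho> F' < \<infinity>"
  shows "F \<in> LpK p \<rho>"
  using assms LpK_norm_cong[of F F'] by (auto simp: LpK_def Kbcs_measurable_iff)

text \<open>Supplies the small perturbation that makes the majorant \<open>h\<close> strictly
  positive everywhere.\<close>

lemma positive_integrable:
  obtains g :: "real^'n \<Rightarrow> real" where "g \<in> borel_measurable lebesgue" "\<And>x. 0 < g x"
    "(\<integral>\<^sup>+x. ennreal (g x) \<partial>lebesgue) < \<infinity>"
proof -
  obtain h where h: "h \<in> borel_measurable (lborel :: (real^'n) measure)" "integral\<^sup>N lborel h \<noteq> \<infinity>"
      "\<And>x. 0 < h x \<and> h x < \<infinity>"
    using sigma_finite_measure.Ex_finite_integrable_function[OF sigma_finite_lborel] by auto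
  have e: "ennreal (enn2real (h x)) = h x" for x using h(3)[of x] by simp
  show ?thesis
  proof
    show "(\<lambda>x. enn2real (h x)) \<in> borel_measurable lebesgue" using h(1) by (intro measurable_completion) simp
    show "0 < enn2real (h x)" for x using h(3)[of x] by (simp add: enn2real_positive_iff)
    show "(\<integral>\<^sup>+x. ennreal (enn2real (h x)) \<partial>lebesgue) < \<infinity>"
      using h(1,2) by (simp only: e nn_integral_completion less_top infinity_ennreal_def)
  qed
qed

theorem maximal_bounded:
  obtains K where "\<And>F. F \<in> LpK p \<rho> \<Longrightarrow> LpK_norm p \<rho> (maximal_op F) \<le> ennreal K * LpK_norm p \<rho> F"
proof (cases "p = top")
  case True
  obtain K where K: "0 \<le> K" "\<And>F H. 0 \<le> H \<Longrightarrow> AE y in lebesgue. \<forall>v\<in>F y. \<rho> y v \<le> H \<Longrightarrow>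
    AE x in lebesgue. norm_of_set (\<rho> x) (maximal_op F x) \<le> ennreal (K * H)"
    by (rule maximal_bound_top[OF True]) blast
  show ?thesis
  proof
    fix F assume "F \<in> LpK p \<rho>"
    then obtain F' where F': "Kbcs_measurable F'" "AE x in lebesgue. F x = F' x"
      "LpK_norm p \<rho> F' = LpK_norm p \<rho> F" "LpK_norm p \<rho> F < \<infinity>" by (rule LpKE)
    define H where "H = enn2real (LpK_norm p \<rho> F)"
    have H: "LpK_norm p \<rho> F = ennreal H" "0 \<le> H" using F'(4) by (simp_all add: H_def)
    have "AE x in lebesgue. norm_of_set (\<rho> x) (F' x) \<le> ennreal H"
      using esssup_AE[of "\<lambda>x. norm_of_set (\<rho> x) (F' x)" lebesgue] True F'(3)
      by (simp add: LpK_norm_def Lp_norm_def H(1)[symmetric])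
    then have "AE y in lebesgue. \<forall>v\<in>F' y. \<rho> y v \<le> H"
    proof eventually_elim
      case (elim x)
      show ?case
      proof
        fix v assume "v \<in> F' x"
        then have "ennreal (\<rho> x v) \<le> ennreal H" using norm_of_set_upper elim by (metis order.trans)
        then show "\<rho> x v \<le> H" using H(2) by simp
      qed
    qed
    then have "AE x in lebesgue. norm_of_set (\<rho> x) (maximal_op F' x) \<le> ennreal (K * H)"
      by (rule K(2)[OF H(2)])
    moreover have "set_measurable (maximal_op F')"
      using F'(1) by (intro maximal_op_set_measurable) (auto simp: Kbcs_measurable_iff KbcsD)
    ultimately have "LpK_norm p \<rho> (maximal_op F') \<le> ennreal (K * H)"
      unfolding LpK_norm_def Lp_norm_def using True norm_meas by (simp add: esssup_I)
    then show "LpK_norm p \<rho> (maximal_op F) \<le> ennreal K * LpK_norm p \<rho> F"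
      using maximal_op_cong[OF F'(2)] H K(1) by (simp add: ennreal_mult)
  qed
next
  case fin: False
  note P = P_gt[OF fin]
  obtain K where K: "\<And>F h. h \<in> borel_measurable lebesgue \<Longrightarrow> (\<And>x. 0 < h x) \<Longrightarrow>
    (\<integral>\<^sup>+x. ennreal (h x powr P) \<partial>lebesgue) < \<infinity> \<Longrightarrow> AE y in lebesgue. \<forall>v\<in>F y. \<rho> y v \<le> h y \<Longrightarrow>
    (\<integral>\<^sup>+x. ennreal_powr (norm_of_set (\<rho> x) (maximal_op F x)) P \<partial>lebesgue)
      \<le> ennreal K * (\<integral>\<^sup>+x. ennreal (h x powr P) \<partial>lebesgue)"
    by (rule maximal_bound_fin[OF fin]) blast
  define K2 where "K2 = max 0 K * 2 powr P"
  have K2: "0 \<le> K2" by (simp add: K2_def)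
  obtain g :: "real^'n \<Rightarrow> real" where g: "g \<in> borel_measurable lebesgue" "\<And>x. 0 < g x"
    "(\<integral>\<^sup>+x. ennreal (g x) \<partial>lebesgue) < \<infinity>" by (rule positive_integrable) blast
  define G where "G = enn2real (\<integral>\<^sup>+x. ennreal (g x) \<partial>lebesgue)"
  have G: "(\<integral>\<^sup>+x. ennreal (g x) \<partial>lebesgue) = ennreal G" "0 \<le> G" using g(3) by (simp_all add: G_def)
  show ?thesis
  proof
    fix F assume "F \<in> LpK p \<rho>"
    then obtain F' where F': "Kbcs_measurable F'" "AE x in lebesgue. F x = F' x"
      "LpK_norm p \<rho> F' = LpK_norm p \<rho> F" "LpK_norm p \<rho> F < \<infinity>" by (rule LpKE)
    define N where "N x = norm_of_set (\<rho> x) (F' x)" for x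
    have N [measurable]: "N \<in> borel_measurable lebesgue"
      using norm_meas F'(1) by (simp add: N_def[abs_def] Kbcs_measurable_iff)
    have Nfin: "N x < \<infinity>" for x
      using F'(1) norm_of_set_finite_iff[OF \<rho>_norm] KbcsD(3) by (auto simp: N_def Kbcs_measurable_def)
    then have Ne: "ennreal (enn2real (N x)) = N x" for x by simp
    define X where "X = (\<integral>\<^sup>+x. ennreal_powr (N x) P \<partial>lebesgue)"
    have LX: "LpK_norm p \<rho> F = ennreal_powr X (1 / P)"
    proof -
      have "LpK_norm p \<rho> F' = ennreal_powr X (1 / P)"
        using fin unfolding LpK_norm_def Lp_norm_def X_def N_def P_def by simp
      then show ?thesis using F'(3) by simp
    qed
    then have Xfin: "X < top" using F'(4) by simp
    have eps: "(\<integral>\<^sup>+x. ennreal_powr (norm_of_set (\<rho> x) (maximal_op F' x)) P \<partial>lebesgue)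
       \<le> ennreal K2 * (X + ennreal (e * G))" if e: "0 < e" for e
    proof -
      \<comment> \<open>The second summand makes \<open>h\<close> positive; its exponent is chosen
        so that its \<open>P\<close>-th power is the integrable function
        \<open>e * g\<close>.\<close>
      define h where "h x = enn2real (N x) + (e * g x) powr (1 / P)" for x
      have h_meas: "h \<in> borel_measurable lebesgue" unfolding h_def using g(1) by measurable
      have h_pos: "0 < h x" for x
        using g(2)[of x] e by (simp add: h_def add_nonneg_pos)
      have hX: "(\<integral>\<^sup>+x. ennreal (h x powr P) \<partial>lebesgue) \<le> ennreal (2 powr P) * (X + ennreal (e * G))"
      proof -
        have "ennreal (h x powr P) \<le> ennreal (2 powr P) * (ennreal_powr (N x) P + ennreal (e * g x))" for x
        proof -
          have "ennreal (h x powr P) = ennreal_powr (N x + ennreal ((e * g x) powr (1 / P))) P"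
            using h_pos[of x] Ne[of x]
            by (metis ennreal_powr_ennreal h_def less_imp_le ennreal_plus enn2real_nonneg powr_ge_zero)
          also have "\<dots> \<le> ennreal_powr 2 P * (ennreal_powr (N x) P + ennreal_powr (ennreal ((e * g x) powr (1 / P))) P)"
            using P by (intro ennreal_powr_add_le) simp
          also have "ennreal_powr (ennreal ((e * g x) powr (1 / P))) P = ennreal (e * g x)"
            using P e g(2)[of x] by (simp add: ennreal_powr_ennreal powr_powr)
          also have "ennreal_powr 2 P = ennreal (2 powr P)"
            using ennreal_powr_ennreal[of 2 P] by simp
          finally show ?thesis .
        qed
        then have "(\<integral>\<^sup>+x. ennreal (h x powr P) \<partial>lebesgue)
          \<le> (\<integral>\<^sup>+x. ennreal (2 powr P) * (ennreal_powr (N x) P + ennreal (e * g x)) \<partial>lebesgue)"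
          by (intro nn_integral_mono)
        also have "\<dots> = ennreal (2 powr P) * (X + ennreal e * ennreal G)"
          unfolding X_def G(1)[symmetric] using g e
          by (simp add: nn_integral_cmult nn_integral_add ennreal_mult' less_imp_le)
        finally show ?thesis using e G(2) by (simp add: ennreal_mult)
      qed
      also have "\<dots> < top" using Xfin by (simp add: ennreal_mult_less_top)
      finally have h_fin: "(\<integral>\<^sup>+x. ennreal (h x powr P) \<partial>lebesgue) < \<infinity>" by simp
      have "\<rho> y v \<le> h y" if "v \<in> F' y" for y v
      proof -
        have "ennreal (\<rho> y v) \<le> ennreal (enn2real (N y))"
          using norm_of_set_upper[OF that, of "\<rho> y"] unfolding Ne by (simp add: N_def)
        then have "\<rho> y v \<le> enn2real (N y)" by simp
        then show ?thesis by (simp add: h_def add_increasing2)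
      qed
      then have "(\<integral>\<^sup>+x. ennreal_powr (norm_of_set (\<rho> x) (maximal_op F' x)) P \<partial>lebesgue)
        \<le> ennreal K * (\<integral>\<^sup>+x. ennreal (h x powr P) \<partial>lebesgue)"
        by (intro K h_meas h_pos h_fin) simp
      also have "\<dots> \<le> ennreal (max 0 K) * (ennreal (2 powr P) * (X + ennreal (e * G)))"
        by (intro mult_mono hX) (auto intro: ennreal_leI)
      finally show ?thesis by (simp add: K2_def ennreal_mult mult.assoc)
    qed
    \<comment> \<open>Letting \<open>e\<close> tend to 0 removes the perturbation; otherwise the
      bound would not be a multiple of the norm of \<open>F\<close>.\<close>
    have "(\<integral>\<^sup>+x. ennreal_powr (norm_of_set (\<rho> x) (maximal_op F' x)) P \<partial>lebesgue) \<le> ennreal K2 * X"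
    proof (rule ennreal_le_epsilon)
      fix e :: real assume e: "0 < e"
      have pos: "0 < K2 * G + 1" using K2 G(2) by (simp add: add_nonneg_pos)
      define d where "d = e / (K2 * G + 1)"
      have d: "0 < d" "K2 * (d * G) \<le> e"
        using e pos K2 G(2) by (auto simp: d_def field_simps)
      have "(\<integral>\<^sup>+x. ennreal_powr (norm_of_set (\<rho> x) (maximal_op F' x)) P \<partial>lebesgue)
        \<le> ennreal K2 * (X + ennreal (d * G))" by (rule eps[OF d(1)])
      also have "\<dots> = ennreal K2 * X + ennreal (K2 * (d * G))"
        using K2 d(1) G(2) by (simp add: distrib_left ennreal_mult)
      also have "\<dots> \<le> ennreal K2 * X + ennreal e" by (intro add_left_mono ennreal_leI d)
      finally show "(\<integral>\<^sup>+x. ennreal_powr (norm_of_set (\<rho> x) (maximal_op F' x)) P \<partial>lebesgue)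
        \<le> ennreal K2 * X + ennreal e" .
    qed
    then have "ennreal_powr (\<integral>\<^sup>+x. ennreal_powr (norm_of_set (\<rho> x) (maximal_op F' x)) P \<partial>lebesgue) (1 / P)
      \<le> ennreal_powr (ennreal K2 * X) (1 / P)"
      using P by (intro ennreal_powr_mono) auto
    also have "\<dots> = ennreal (K2 powr (1 / P)) * LpK_norm p \<rho> F"
      using K2 by (simp add: ennreal_powr_mult LX ennreal_powr_ennreal)
    finally show "LpK_norm p \<rho> (maximal_op F) \<le> ennreal (K2 powr (1 / P)) * LpK_norm p \<rho> F"
      using fin maximal_op_cong[OF F'(2)] unfolding LpK_norm_def[of p \<rho> "maximal_op F"] Lp_norm_def P_def by simp
  qed
qed

definition c\<^sub>M :: real where "c\<^sub>M = enn2real (maximal_op_norm p \<rho>)"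

lemma c\<^sub>M_nonneg: "0 \<le> c\<^sub>M" by (simp add: c\<^sub>M_def)

lemma maximal_op_norm_eq: "maximal_op_norm p \<rho> = ennreal c\<^sub>M"
proof -
  obtain K where "\<And>F. F \<in> LpK p \<rho> \<Longrightarrow> LpK_norm p \<rho> (maximal_op F) \<le> ennreal K * LpK_norm p \<rho> F"
    by (rule maximal_bounded) blast
  then have "maximal_op_norm p \<rho> \<le> ennreal K" unfolding maximal_op_norm_def by (intro Inf_lower) auto
  then have "maximal_op_norm p \<rho> < top" by (rule order.strict_trans1) simp
  then show ?thesis by (simp add: c\<^sub>M_def)
qed

text \<open>The infimum of the admissible constants is itself admissible, by approximation.\<close>

lemma maximal_norm_le:
  assumes "F \<in> LpK p \<rho>" shows "LpK_norm p \<rho> (maximal_op F) \<le> ennreal c\<^sub>M * LpK_norm p \<rho> F"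
proof -
  define A where "A = {C. \<forall>F\<in>LpK p \<rho>. LpK_norm p \<rho> (maximal_op F) \<le> C * LpK_norm p \<rho> F}"
  define a where "a = LpK_norm p \<rho> F"
  have a: "a < top" using assms by (simp add: LpK_def a_def)
  have le: "LpK_norm p \<rho> (maximal_op F) \<le> C * a" if "C \<in> A" for C
    using that assms by (simp add: A_def a_def)
  have c: "Inf A = ennreal c\<^sub>M" using maximal_op_norm_eq by (simp add: maximal_op_norm_def A_def)
  have "LpK_norm p \<rho> (maximal_op F) \<le> ennreal c\<^sub>M * a"
  proof (rule ennreal_le_epsilon)
    fix e :: real assume e: "0 < e"
    define a' where "a' = enn2real a"
    have a': "a = ennreal a'" "0 \<le> a'" using a by (simp_all add: a'_def)
    \<comment> \<open>The denominator turns the excess of the constant into an error of at most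
      \<open>e\<close> after multiplication by \<open>a'\<close>, also when \<open>a'\<close> is
      0.\<close>
    have "Inf A < ennreal (c\<^sub>M + e / (a' + 1))"
      unfolding c using e a'(2) c\<^sub>M_nonneg by (intro ennreal_lessI) (auto simp: add_nonneg_pos)
    then obtain C where C: "C \<in> A" "C < ennreal (c\<^sub>M + e / (a' + 1))" by (auto simp: Inf_less_iff)
    have "LpK_norm p \<rho> (maximal_op F) \<le> ennreal (c\<^sub>M + e / (a' + 1)) * a"
      using le[OF C(1)] C(2) by (meson less_imp_le mult_right_mono order_trans zero_le)
    also have "\<dots> = ennreal (c\<^sub>M * a' + e * (a' / (a' + 1)))"
      using a' e c\<^sub>M_nonneg by (simp add: distrib_right flip: ennreal_mult)
    also have "\<dots> \<le> ennreal (c\<^sub>M * a' + e)"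
      using e a'(2) by (intro ennreal_leI add_left_mono) (simp add: field_simps)
    finally show "LpK_norm p \<rho> (maximal_op F) \<le> ennreal c\<^sub>M * a + ennreal e"
      using a' e c\<^sub>M_nonneg by (simp add: ennreal_mult)
  qed
  then show ?thesis by (simp add: a_def)
qed

text \<open>A finite norm makes the maximal function bounded almost everywhere. On the measurable
  exceptional set it is replaced by \<open>{0}\<close>, which gives a representative with values in
  \<open>Kbcs\<close>.\<close>

lemma maximal_LpK:
  assumes "F \<in> LpK p \<rho>" shows "maximal_op F \<in> LpK p \<rho>"
proof -
  obtain F' where F': "Kbcs_measurable F'" "AE x in lebesgue. F x = F' x"
      "LpK_norm p \<rho> F' = LpK_norm p \<rho> F" "LpK_norm p \<rho> F < \<infinity>" by (rule LpKE[OF assms])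
  have M: "maximal_op F = maximal_op F'" by (rule maximal_op_cong[OF F'(2)])
  have K: "AE y in lebesgue. F' y \<in> Kbcs" using F'(1) by (simp add: Kbcs_measurable_def)
  then have "AE y in lebesgue. 0 \<in> F' y" by eventually_elim (rule KbcsD)
  then have meas: "set_measurable (maximal_op F)" unfolding M by (rule maximal_op_set_measurable)
  define A where "A = {x. bounded (maximal_op F x)}"
  have A: "A \<in> sets lebesgue" unfolding A_def by (rule bounded_set_measurable[OF meas])
  define M' where "M' x = (if x \<in> A then maximal_op F x else {0})" for x
  have fin: "LpK_norm p \<rho> (maximal_op F) < \<infinity>"
    using maximal_norm_le[OF assms] F'(4) by (auto intro: order.strict_trans1 simp: ennreal_mult_less_top)
  have "AE x in lebesgue. norm_of_set (\<rho> x) (maximal_op F x) < top"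
    using fin by (intro Lp_norm_finite_AE[OF p norm_meas[OF meas]]) (simp add: LpK_norm_def)
  then have ae: "AE x in lebesgue. maximal_op F x = M' x"
  proof eventually_elim
    case (elim x)
    then have "bounded (maximal_op F x)" using norm_of_set_finite_iff[OF \<rho>_norm, of x] by simp
    then show ?case by (simp add: M'_def A_def)
  qed
  have "Kbcs_measurable M'"
    unfolding Kbcs_measurable_iff
  proof
    show "\<forall>x. M' x \<in> Kbcs"
      using maximal_op_Kbcs[OF K] by (simp add: M'_def A_def M Kbcs_zero)
    show "set_measurable M'"
      unfolding M'_def by (intro set_measurable_If meas set_measurable_const A)
  qed
  moreover then have "LpK_norm p \<rho> M' < \<infinity>" using LpK_norm_cong[OF ae] fin by (simp add: Kbcs_measurable_iff)
  ultimately show ?thesis using ae by (intro LpKI)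
qed

lemma maximal_iterate:
  assumes "G \<in> LpK p \<rho>"
  shows "(maximal_op ^^ k) G \<in> LpK p \<rho>" "LpK_norm p \<rho> ((maximal_op ^^ k) G) \<le> ennreal (c\<^sub>M ^ k) * LpK_norm p \<rho> G"
proof (induction k)
  case (Suc k)
  case 1 then show ?case using Suc by (simp add: maximal_LpK)
next
  case (Suc k)
  case 2
  have "LpK_norm p \<rho> (maximal_op ((maximal_op ^^ k) G)) \<le> ennreal c\<^sub>M * LpK_norm p \<rho> ((maximal_op ^^ k) G)"
    by (rule maximal_norm_le[OF Suc(1)])
  also have "\<dots> \<le> ennreal c\<^sub>M * (ennreal (c\<^sub>M ^ k) * LpK_norm p \<rho> G)"
    by (intro mult_left_mono Suc) simp
  finally show ?case using c\<^sub>M_nonneg by (simp add: ennreal_mult mult.assoc)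
qed (use assms in auto)

text \<open>Every coordinate of \<open>v\<close> is at most
  \<open>\<rho> y v * D y (axis i 1)\<close>, and \<open>D\<close> has an integrable
  \<open>q\<close>-th power on cubes; Hoelder's inequality does the rest. Thus Euclidean size is
  controlled although \<open>\<rho>\<close> has no uniform lower bound.\<close>

lemma locally_integrable:
  assumes F: "set_measurable F" and fin: "LpK_norm p \<rho> F < \<infinity>" and Q: "Q \<in> cubes"
  shows "(\<integral>\<^sup>+y\<in>Q. norm_of_set norm (F y) \<partial>lebesgue) < \<infinity>"
proof -
  define N where "N x = norm_of_set (\<rho> x) (F x)" for x
  have N [measurable]: "N \<in> borel_measurable lebesgue" unfolding N_def by (rule norm_meas[OF F])
  have [measurable]: "Q \<in> sets lebesgue" using Q by simp
  have cae: "cube_ae Q" using Q by (auto simp: cube_ae_def)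
  have int: "(\<integral>\<^sup>+y. N y * (ennreal (D y v) * indicator Q y) \<partial>lebesgue) < \<infinity>" for v
  proof (cases "p = top")
    case True
    define H where "H = LpK_norm p \<rho> F"
    have "AE x in lebesgue. N x \<le> H"
      using esssup_AE[of N lebesgue] True by (simp add: H_def LpK_norm_def Lp_norm_def N_def[abs_def])
    then have "(\<integral>\<^sup>+y. N y * (ennreal (D y v) * indicator Q y) \<partial>lebesgue) \<le> (\<integral>\<^sup>+y. H * (ennreal (D y v) * indicator Q y) \<partial>lebesgue)"
      by (intro nn_integral_mono_AE) (auto elim!: eventually_mono intro: mult_right_mono)
    also have "\<dots> = H * (\<sigma> Q v)"
      using q_top[OF True] by (simp add: nn_integral_cmult)
    also have "\<dots> < \<infinity>" using D_int_fin[OF cae, of v] fin by (simp add: ennreal_mult_less_top H_def)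
    finally show ?thesis .
  next
    case False
    note P = P_gt[OF False] and q = conj_finite[OF False]
    have "(\<integral>\<^sup>+y. N y * (ennreal (D y v) * indicator Q y) \<partial>lebesgue)
      \<le> ennreal_powr (\<integral>\<^sup>+y. ennreal_powr (N y) P \<partial>lebesgue) (1 / P)
       * ennreal_powr (\<integral>\<^sup>+y. ennreal_powr (ennreal (D y v) * indicator Q y) q \<partial>lebesgue) (1 / q)"
      by (intro nn_integral_Hoelder P q) auto
    also have "(\<integral>\<^sup>+y. ennreal_powr (ennreal (D y v) * indicator Q y) q \<partial>lebesgue) = (\<sigma> Q v)"
      by (intro nn_integral_cong) (auto simp: ennreal_powr_ennreal split: split_indicator)
    also have "ennreal_powr (\<integral>\<^sup>+y. ennreal_powr (N y) P \<partial>lebesgue) (1 / P) = LpK_norm p \<rho> F"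
      using False unfolding LpK_norm_def Lp_norm_def P_def N_def by simp
    also have "LpK_norm p \<rho> F * ennreal_powr (\<sigma> Q v) (1 / q) < \<infinity>"
      using D_int_fin[OF cae, of v] fin by (simp add: ennreal_mult_less_top)
    finally show ?thesis .
  qed
  have le: "norm_of_set norm (F y) \<le> (\<Sum>i\<in>UNIV. N y * ennreal (D y (axis i 1)))" for y
    unfolding norm_of_set_def
  proof (rule SUP_least)
    fix v assume v: "v \<in> F y"
    have "norm v \<le> (\<Sum>i\<in>UNIV. \<bar>v $ i\<bar>)" by (rule norm_le_l1_cart)
    also have "\<dots> = (\<Sum>i\<in>UNIV. \<bar>v \<bullet> axis i 1\<bar>)" by (simp add: inner_axis)
    also have "\<dots> \<le> (\<Sum>i\<in>UNIV. \<rho> y v * D y (axis i 1))" by (intro sum_mono inner_le)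
    finally have "ennreal (norm v) \<le> ennreal (\<Sum>i\<in>UNIV. \<rho> y v * D y (axis i 1))" by (rule ennreal_leI)
    also have "\<dots> = (\<Sum>i\<in>UNIV. ennreal (\<rho> y v) * ennreal (D y (axis i 1)))"
      by (subst sum_ennreal[symmetric]) (auto simp: ennreal_mult)
    also have "\<dots> \<le> (\<Sum>i\<in>UNIV. N y * ennreal (D y (axis i 1)))"
      unfolding N_def by (intro sum_mono mult_right_mono norm_of_set_upper v) simp
    finally show "ennreal (norm v) \<le> (\<Sum>i\<in>UNIV. N y * ennreal (D y (axis i 1)))" .
  qed
  have "(\<integral>\<^sup>+y\<in>Q. norm_of_set norm (F y) \<partial>lebesgue) \<le> (\<integral>\<^sup>+y. (\<Sum>i\<in>UNIV. N y * (ennreal (D y (axis i 1)) * indicator Q y)) \<partial>lebesgue)"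
    using le by (intro nn_integral_mono) (auto split: split_indicator)
  also have "\<dots> = (\<Sum>i\<in>UNIV. \<integral>\<^sup>+y. N y * (ennreal (D y (axis i 1)) * indicator Q y) \<partial>lebesgue)"
    by (rule nn_integral_sum) measurable
  also have "\<dots> < \<infinity>" using int by simp
  finally show ?thesis .
qed

end

section \<open>Selections\<close>

text \<open>The nearest point of \<open>F y\<close> to \<open>z\<close> lies in a closed set \<open>C\<close> iff there are points of \<open>F y\<close> that are
  almost nearest to \<open>z\<close> and almost in \<open>C\<close>.\<close>

lemma measurable_closest_point:
  fixes F :: "'x::euclidean_space \<Rightarrow> ('a::euclidean_space) set"
  assumes F: "Kbcs_measurable F"
  shows "(\<lambda>y. closest_point (F y) z) \<in> borel_measurable lebesgue"
proof (rule borel_measurableI)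
  fix U :: "'a set" assume "open U"
  define C where "C = - U"
  have C: "closed C" unfolding C_def using \<open>open U\<close> by (rule closed_Compl)
  have Fm: "set_measurable F" and K: "\<And>y. F y \<in> Kbcs" using F by (auto simp: Kbcs_measurable_iff)
  define d where "d y = dist z (closest_point (F y) z)" for y
  have cp: "closest_point (F y) z \<in> F y" "\<And>w. w \<in> F y \<Longrightarrow> d y \<le> dist z w" for y
    unfolding d_def using closest_point_exists[OF KbcsD(2)[OF K] KbcsD(1)[OF K], of y z] by auto
  have d_meas: "d \<in> borel_measurable lebesgue"
  proof (rule borel_measurableI_less)
    fix a
    have "d y < a \<longleftrightarrow> (\<exists>w\<in>F y. dist z w < a)" for y
    proof
      assume "d y < a"
      then show "\<exists>w\<in>F y. dist z w < a" using cp(1)[of y] unfolding d_def by blast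
    next
      assume "\<exists>w\<in>F y. dist z w < a"
      then show "d y < a" using cp(2)[of _ y] by (auto intro: le_less_trans)
    qed
    then have "{y \<in> space lebesgue. d y < a} = {y. F y \<inter> ball z a \<noteq> {}}" by auto
    then show "{y \<in> space lebesgue. d y < a} \<in> sets lebesgue" using set_measurableD[OF Fm open_ball] by simp
  qed
  have "(\<lambda>y. closest_point (F y) z) -` C \<inter> space lebesgue \<in> sets lebesgue"
  proof (cases "C = {}")
    case False
    \<comment> \<open>The minimum packs being almost in \<open>C\<close> and being almost nearest
      into one function that is continuous in \<open>w\<close> and measurable in \<open>y\<close>.
      Compactness of \<open>F y\<close> then produces a limit point satisfying both exactly.\<close>
    define \<phi> where "\<phi> n y w = min (1 / real (Suc n) - infdist w C) (d y + 1 / real (Suc n) - dist z w)" for n y w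
    have "(\<lambda>y. closest_point (F y) z) -` C \<inter> space lebesgue = (\<Inter>n. {y. \<exists>w\<in>F y. 0 < \<phi> n y w})"
    proof (intro set_eqI iffI)
      fix y assume y: "y \<in> (\<lambda>y. closest_point (F y) z) -` C \<inter> space lebesgue"
      then have "infdist (closest_point (F y) z) C = 0" by simp
      then have "0 < \<phi> n y (closest_point (F y) z)" for n by (simp add: \<phi>_def d_def)
      then show "y \<in> (\<Inter>n. {y. \<exists>w\<in>F y. 0 < \<phi> n y w})" using cp(1) by blast
    next
      fix y assume "y \<in> (\<Inter>n. {y. \<exists>w\<in>F y. 0 < \<phi> n y w})"
      then have "\<forall>n. \<exists>w. w \<in> F y \<and> 0 < \<phi> n y w" by blast
      then obtain w where w: "\<And>n. w n \<in> F y" "\<And>n. 0 < \<phi> n y (w n)" by metis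
      obtain l r where l: "l \<in> F y" "strict_mono r" "(w \<circ> r) \<longlonglongrightarrow> l"
        using KbcsD(6)[OF K[of y]] w(1) unfolding compact_def by metis
      have r0: "(\<lambda>n. 1 / real (Suc (r n))) \<longlonglongrightarrow> 0"
        using LIMSEQ_subseq_LIMSEQ[OF LIMSEQ_inverse_real_of_nat l(2)] by (simp add: o_def inverse_eq_divide)
      have "infdist l C \<le> 0"
      proof (rule LIMSEQ_le)
        show "(\<lambda>n. infdist ((w \<circ> r) n) C) \<longlonglongrightarrow> infdist l C" by (intro tendsto_infdist l)
        show "\<exists>N. \<forall>n\<ge>N. infdist ((w \<circ> r) n) C \<le> 1 / real (Suc (r n))"
          using w(2) by (auto simp: \<phi>_def less_imp_le)
      qed (rule r0)
      then have lC: "l \<in> C" using C False in_closed_iff_infdist_zero[of C l] infdist_nonneg[of l C] by simp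
      have "dist z l \<le> d y + 0"
      proof (rule LIMSEQ_le)
        show "(\<lambda>n. dist z ((w \<circ> r) n)) \<longlonglongrightarrow> dist z l" by (intro tendsto_intros l)
        show "(\<lambda>n. d y + 1 / real (Suc (r n))) \<longlonglongrightarrow> d y + 0" by (intro tendsto_intros r0)
        show "\<exists>N. \<forall>n\<ge>N. dist z ((w \<circ> r) n) \<le> d y + 1 / real (Suc (r n))"
          using w(2) by (auto simp: \<phi>_def less_imp_le)
      qed
      then have "l = closest_point (F y) z"
        using cp(2)[of _ y] l(1) by (intro closest_point_unique KbcsD(4)[OF K] KbcsD(2)[OF K]) (auto intro: order.trans)
      then show "y \<in> (\<lambda>y. closest_point (F y) z) -` C \<inter> space lebesgue" using lC by simp
    qed
    also have "\<dots> \<in> sets lebesgue"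
    proof (intro sets.countable_INT' image_subsetI)
      fix n
      show "{y. \<exists>w\<in>F y. 0 < \<phi> n y w} \<in> sets lebesgue"
      proof (rule measurable_Caratheodory_greater[OF Fm])
        show "(\<lambda>y. \<phi> n y w) \<in> borel_measurable lebesgue" for w
          unfolding \<phi>_def using d_meas by measurable
        show "continuous_on UNIV (\<phi> n y)" for y
          unfolding \<phi>_def by (intro continuous_intros)
      qed
    qed auto
    finally show ?thesis .
  qed simp
  then have "space lebesgue - (\<lambda>y. closest_point (F y) z) -` C \<inter> space lebesgue \<in> sets lebesgue"
    by (rule sets.compl_sets)
  also have "space lebesgue - (\<lambda>y. closest_point (F y) z) -` C \<inter> space lebesgue
      = (\<lambda>y. closest_point (F y) z) -` U \<inter> space lebesgue"
    by (auto simp: C_def)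
  finally show "(\<lambda>y. closest_point (F y) z) -` U \<inter> space lebesgue \<in> sets lebesgue" .
qed

text \<open>The support function of a symmetric set; the absolute value allows extended nonnegative
  values and reuse of \<open>norm_of_set\<close>.\<close>

definition support :: "real^'d \<Rightarrow> (real^'d) set \<Rightarrow> ennreal" where
  "support v K = norm_of_set (\<lambda>w. \<bar>w \<bullet> v\<bar>) K"

text \<open>Expanding the squares in the comparison of distances from \<open>n *\<^sub>R v\<close>
  leaves \<open>2 * n\<close> times the inner products, up to the squared norm of \<open>w\<close>;
  this is the error term. The second claim is the variational inequality for the projection tested
  at 0.\<close>

lemma closest_point_inner_ge:
  fixes K :: "(real^'d) set"
  assumes K: "K \<in> Kbcs" and w: "w \<in> K" and n: "0 < n"
  shows "w \<bullet> v - (norm w)\<^sup>2 / (2 * n) \<le> closest_point K (n *\<^sub>R v) \<bullet> v" "0 \<le> closest_point K (n *\<^sub>R v) \<bullet> v"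
proof -
  define c where "c = closest_point K (n *\<^sub>R v)"
  have "dist (n *\<^sub>R v) c \<le> dist (n *\<^sub>R v) w"
    unfolding c_def using closest_point_exists(2)[OF KbcsD(2)[OF K] KbcsD(1)[OF K]] w by blast
  then have "(norm (n *\<^sub>R v - c))\<^sup>2 \<le> (norm (n *\<^sub>R v - w))\<^sup>2" by (intro power_mono) (auto simp: dist_norm)
  then have "c \<bullet> c - 2 * n * (c \<bullet> v) \<le> w \<bullet> w - 2 * n * (w \<bullet> v)"
    by (simp add: power2_norm_eq_inner inner_diff_left inner_diff_right inner_commute algebra_simps)
  moreover have "0 \<le> c \<bullet> c" by simp
  ultimately have "2 * n * (w \<bullet> v) - w \<bullet> w \<le> 2 * n * (c \<bullet> v)" by linarith
  then show "w \<bullet> v - (norm w)\<^sup>2 / (2 * n) \<le> closest_point K (n *\<^sub>R v) \<bullet> v"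
    using n by (simp add: c_def[symmetric] power2_norm_eq_inner field_simps)
  have "(n *\<^sub>R v - c) \<bullet> (0 - c) \<le> 0"
    unfolding c_def by (rule closest_point_dot[OF KbcsD(4)[OF K] KbcsD(2)[OF K] KbcsD(7)[OF K]])
  then have "c \<bullet> c \<le> n * (c \<bullet> v)" by (simp add: inner_diff_left inner_diff_right inner_commute)
  then have "0 \<le> n * (c \<bullet> v)" using inner_ge_zero[of c] by linarith
  then show "0 \<le> closest_point K (n *\<^sub>R v) \<bullet> v" using n by (simp add: c_def zero_le_mult_iff)
qed

text \<open>The projections of \<open>n v\<close> onto \<open>F y\<close> are selections whose inner products with \<open>v\<close> converge to the support function as \<open>n\<close> tends to infinity.\<close>

lemma support_avg_ge:
  fixes F :: "real^'n \<Rightarrow> (real^'d) set"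
  assumes F: "Kbcs_measurable F" and Q: "Q \<in> cubes" "x \<in> Q"
    and fin: "(\<integral>\<^sup>+y\<in>Q. norm_of_set norm (F y) \<partial>lebesgue) < \<infinity>"
  shows "(\<integral>\<^sup>+y\<in>Q. support v (F y) \<partial>lebesgue) \<le> emeasure lebesgue Q * support v (avg_op Q F x)"
proof -
  have K: "\<And>y. F y \<in> Kbcs" using F by (auto simp: Kbcs_measurable_iff)
  have [measurable]: "Q \<in> sets lebesgue" using Q by simp
  define m where "m = measure lebesgue Q"
  have m: "emeasure lebesgue Q = ennreal m" "0 < m" using cubes_emeasure[OF Q(1)] by (simp_all add: m_def)
  define f where "f n y = closest_point (F y) (real (Suc n) *\<^sub>R v)" for n y
  have f_meas [measurable]: "f n \<in> borel_measurable lebesgue" for n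
    unfolding f_def by (rule measurable_closest_point[OF F])
  have fF: "f n y \<in> F y" for n y
    unfolding f_def by (intro closest_point_in_set KbcsD(2)[OF K] KbcsD(1)[OF K])
  \<comment> \<open>Without this, \<open>ennreal\<close> would truncate negative parts and the
    nonnegative integral would no longer equal the integral of the inner product.\<close>
  have nn: "0 \<le> f n y \<bullet> v" for n y
    unfolding f_def by (rule closest_point_inner_ge(2)[OF K KbcsD(7)[OF K]]) simp
  have int: "set_integrable lebesgue Q (f n)" for n
    unfolding set_integrable_def
  proof (rule integrableI_bounded)
    have "(\<integral>\<^sup>+y. ennreal (norm (indicator Q y *\<^sub>R f n y)) \<partial>lebesgue) \<le> (\<integral>\<^sup>+y\<in>Q. norm_of_set norm (F y) \<partial>lebesgue)"
      using norm_of_set_upper[OF fF, of norm] by (intro nn_integral_mono) (auto split: split_indicator)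
    also have "\<dots> < \<infinity>" by (rule fin)
    finally show "(\<integral>\<^sup>+y. ennreal (norm (indicator Q y *\<^sub>R f n y)) \<partial>lebesgue) < \<infinity>" .
  qed measurable
  have le: "(\<integral>\<^sup>+y\<in>Q. ennreal (f n y \<bullet> v) \<partial>lebesgue) \<le> emeasure lebesgue Q * support v (avg_op Q F x)" for n
  proof -
    define u where "u = (1 / m) *\<^sub>R (LINT y:Q|lebesgue. f n y)"
    have "(LINT y:Q|lebesgue. f n y) \<in> aumann_integral Q F"
      unfolding aumann_integral_def using int fF by blast
    then have u: "u \<in> avg_op Q F x"
      unfolding avg_op_def set_scale_def if_P[OF Q(2)] u_def m_def by (rule imageI)
    have i: "integrable lebesgue (\<lambda>y. indicator Q y *\<^sub>R f n y)" using int by (simp add: set_integrable_def)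
    have "(\<integral>\<^sup>+y\<in>Q. ennreal (f n y \<bullet> v) \<partial>lebesgue) = (\<integral>\<^sup>+y. ennreal ((indicator Q y *\<^sub>R f n y) \<bullet> v) \<partial>lebesgue)"
      by (intro nn_integral_cong) (auto split: split_indicator)
    also have "\<dots> = ennreal (LINT y|lebesgue. (indicator Q y *\<^sub>R f n y) \<bullet> v)"
      using i nn by (intro nn_integral_eq_integral integrable_inner_left) (auto split: split_indicator)
    also have "(LINT y|lebesgue. (indicator Q y *\<^sub>R f n y) \<bullet> v) = (LINT y|lebesgue. indicator Q y *\<^sub>R f n y) \<bullet> v"
      by (rule integral_inner_left) (rule i)
    also have "\<dots> = m * (u \<bullet> v)"
      using m(2) by (simp add: u_def set_lebesgue_integral_def)
    also have "ennreal (m * (u \<bullet> v)) \<le> ennreal (m * \<bar>u \<bullet> v\<bar>)"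
      using m(2) by (intro ennreal_leI mult_left_mono) auto
    also have "\<dots> = ennreal m * ennreal \<bar>u \<bullet> v\<bar>" using m(2) by (simp add: ennreal_mult)
    also have "\<dots> \<le> ennreal m * support v (avg_op Q F x)"
      unfolding support_def by (intro mult_left_mono norm_of_set_upper[of u _ "\<lambda>w. \<bar>w \<bullet> v\<bar>"] u) simp
    finally show ?thesis by (simp only: m(1))
  qed
  have lim: "support v (F y) \<le> liminf (\<lambda>n. ennreal (f n y \<bullet> v))" for y
    unfolding support_def norm_of_set_def
  proof (rule SUP_least)
    fix w assume w: "w \<in> F y"
    have *: "ennreal (w \<bullet> v) \<le> liminf (\<lambda>n. ennreal (f n y \<bullet> v))" if w: "w \<in> F y" for w
    proof -
      have "(\<lambda>n. (norm w)\<^sup>2 / 2 * (1 / real (Suc n))) \<longlonglongrightarrow> (norm w)\<^sup>2 / 2 * 0"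
        using LIMSEQ_inverse_real_of_nat by (intro tendsto_intros) (simp add: inverse_eq_divide)
      then have "(\<lambda>n. w \<bullet> v - (norm w)\<^sup>2 / 2 * (1 / real (Suc n))) \<longlonglongrightarrow> w \<bullet> v - (norm w)\<^sup>2 / 2 * 0"
        by (rule tendsto_diff[OF tendsto_const])
      then have "(\<lambda>n. ennreal (w \<bullet> v - (norm w)\<^sup>2 / 2 * (1 / real (Suc n)))) \<longlonglongrightarrow> ennreal (w \<bullet> v)"
        by (intro tendsto_ennrealI) simp
      then have "ennreal (w \<bullet> v) = liminf (\<lambda>n. ennreal (w \<bullet> v - (norm w)\<^sup>2 / 2 * (1 / real (Suc n))))"
        by (simp add: lim_imp_Liminf)
      also have "\<dots> \<le> liminf (\<lambda>n. ennreal (f n y \<bullet> v))"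
      proof (intro Liminf_mono always_eventually allI ennreal_leI)
        fix n
        show "w \<bullet> v - (norm w)\<^sup>2 / 2 * (1 / real (Suc n)) \<le> f n y \<bullet> v"
          using closest_point_inner_ge(1)[OF K[of y] w, of "real (Suc n)" v] by (simp add: f_def)
      qed
      finally show ?thesis .
    qed
    show "ennreal \<bar>w \<bullet> v\<bar> \<le> liminf (\<lambda>n. ennreal (f n y \<bullet> v))"
      using *[OF w] *[OF KbcsD(8)[OF K w]] by (auto simp: abs_if)
  qed
  have "(\<integral>\<^sup>+y\<in>Q. support v (F y) \<partial>lebesgue) \<le> (\<integral>\<^sup>+y. liminf (\<lambda>n. ennreal (f n y \<bullet> v) * indicator Q y) \<partial>lebesgue)"
    using lim by (intro nn_integral_mono) (auto split: split_indicator)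
  also have "\<dots> \<le> liminf (\<lambda>n. \<integral>\<^sup>+y\<in>Q. ennreal (f n y \<bullet> v) \<partial>lebesgue)"
    by (rule nn_integral_liminf) measurable
  also have "\<dots> \<le> emeasure lebesgue Q * support v (avg_op Q F x)"
    by (intro order.trans[OF Liminf_le_Limsup] Limsup_bounded always_eventually allI le) auto
  finally show ?thesis .
qed

section \<open>Hausdorff distance and support functions\<close>

lemma norm_of_set_closure:
  assumes cont: "continuous_on UNIV q" and le: "\<And>v. v \<in> S \<Longrightarrow> ennreal (q v) \<le> a" and nn: "\<And>v. 0 \<le> q v"
  shows "norm_of_set q (closure S) \<le> a"
proof (cases a)
  case (real r)
  have "closure S \<subseteq> {v. q v \<le> r}"
    using le real by (intro closure_minimal closed_Collect_le cont continuous_intros) auto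
  then show ?thesis using real by (auto simp: norm_of_set_def intro!: SUP_least ennreal_leI)
qed simp

definition excess :: "(real^'d \<Rightarrow> real) \<Rightarrow> (real^'d) set \<Rightarrow> (real^'d) set \<Rightarrow> ennreal" where
  "excess q K L = (SUP v\<in>K. INF w\<in>L. ennreal (q (v - w)))"

lemma hausdorff_dist_excess: "hausdorff_dist q K L = max (excess q K L) (excess q L K)"
  by (simp add: hausdorff_dist_def excess_def)

lemma excess_triangle:
  fixes q :: "real^'d \<Rightarrow> real"
  assumes q: "is_norm q" and ne: "B \<noteq> {}"
  shows "excess q A C \<le> excess q A B + excess q B C"
  unfolding excess_def[of q A C]
proof (rule SUP_least)
  fix v assume v: "v \<in> A"
  define I where "I = (INF w\<in>B. ennreal (q (v - w)))"
  have "(INF w\<in>C. ennreal (q (v - w))) \<le> I + excess q B C"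
  proof (rule ennreal_le_epsilon)
    fix e :: real assume fin: "I + excess q B C < top" and e: "0 < e"
    then have "I < I + ennreal e"
      by (cases I) (auto simp: ennreal_less_iff simp flip: ennreal_plus)
    then obtain w where w: "w \<in> B" "ennreal (q (v - w)) < I + ennreal e"
      unfolding I_def by (auto simp: INF_less_iff)
    have *: "ennreal (q (v - z)) \<le> ennreal (q (v - w)) + ennreal (q (w - z))" for z
      using is_normD(4)[OF q, of "v - w" "w - z"] is_normD(1)[OF q]
      by (simp add: ennreal_leI flip: ennreal_plus)
    define J where "J = (INF z\<in>C. ennreal (q (w - z)))"
    have J: "J \<le> excess q B C" unfolding J_def excess_def using w(1) by (rule SUP_upper)
    have "(INF w\<in>C. ennreal (q (v - w))) \<le> ennreal (q (v - w)) + J"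
    proof (rule ennreal_le_epsilon)
      fix e :: real assume "ennreal (q (v - w)) + J < top" and e: "0 < e"
      then have "J < J + ennreal e"
        by (cases J) (auto simp: ennreal_less_iff simp flip: ennreal_plus)
      then obtain z where z: "z \<in> C" "ennreal (q (w - z)) < J + ennreal e"
        unfolding J_def by (auto simp: INF_less_iff)
      have "(INF w\<in>C. ennreal (q (v - w))) \<le> ennreal (q (v - z))" using z(1) by (rule INF_lower)
      also have "\<dots> \<le> ennreal (q (v - w)) + ennreal (q (w - z))" by (rule *)
      also have "\<dots> \<le> ennreal (q (v - w)) + (J + ennreal e)" using z(2) by (intro add_left_mono) simp
      finally show "(INF w\<in>C. ennreal (q (v - w))) \<le> ennreal (q (v - w)) + J + ennreal e" by (simp add: add.assoc)
    qed
    also have "\<dots> \<le> (I + ennreal e) + excess q B C" using w(2) J by (intro add_mono) auto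
    finally show "(INF w\<in>C. ennreal (q (v - w))) \<le> I + excess q B C + ennreal e" by (simp add: ac_simps)
  qed
  also have "\<dots> \<le> excess q A B + excess q B C"
    unfolding I_def excess_def[of q A B] using v by (intro add_right_mono SUP_upper)
  finally show "(INF w\<in>C. ennreal (q (v - w))) \<le> excess q A B + excess q B C" .
qed

lemma hausdorff_dist_commute: "hausdorff_dist q A B = hausdorff_dist q B A"
  by (simp add: hausdorff_dist_excess max.commute)

lemma hausdorff_dist_triangle:
  fixes q :: "real^'d \<Rightarrow> real"
  assumes "is_norm q" "B \<noteq> {}"
  shows "hausdorff_dist q A C \<le> hausdorff_dist q A B + hausdorff_dist q B C"
  unfolding hausdorff_dist_excess
proof (rule max.boundedI)
  show "excess q A C \<le> max (excess q A B) (excess q B A) + max (excess q B C) (excess q C B)"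
    by (rule order.trans[OF excess_triangle[OF assms]]) (intro add_mono max.cobounded1)
  have "excess q C A \<le> excess q B A + excess q C B"
    using excess_triangle[OF assms, of C A] by (simp add: add.commute)
  also have "\<dots> \<le> max (excess q A B) (excess q B A) + max (excess q B C) (excess q C B)"
    by (intro add_mono max.cobounded2)
  finally show "excess q C A \<le> max (excess q A B) (excess q B A) + max (excess q B C) (excess q C B)" .
qed

lemma excess_0_subset:
  fixes q :: "real^'d \<Rightarrow> real"
  assumes q: "is_norm q" and L: "closed L" and z: "excess q K L = 0"
  shows "K \<subseteq> L"
proof
  fix v assume v: "v \<in> K"
  obtain c where c: "0 < c" "\<And>v. c * norm v \<le> q v" by (rule is_norm_ge[OF q]) blast
  have "(INF w\<in>L. ennreal (q (v - w))) \<le> excess q K L" unfolding excess_def using v by (rule SUP_upper)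
  then have I: "(INF w\<in>L. ennreal (q (v - w))) = 0" using z by simp
  have "v \<in> closure L"
    unfolding closure_approachable
  proof (intro allI impI)
    fix e :: real assume e: "0 < e"
    then have "(INF w\<in>L. ennreal (q (v - w))) < ennreal (c * e)" unfolding I using c(1) by simp
    then obtain w where w: "w \<in> L" "ennreal (q (v - w)) < ennreal (c * e)" by (auto simp: INF_less_iff)
    then have "q (v - w) < c * e" using is_normD(1)[OF q] by (simp add: ennreal_less_iff)
    then have "c * norm (v - w) < c * e" using c(2)[of "v - w"] by simp
    then show "\<exists>w\<in>L. dist w v < e" using w(1) c(1) by (auto simp: dist_norm norm_minus_commute)
  qed
  then show "v \<in> L" using L by simp
qed

lemma hausdorff_dist_0_eq:
  fixes q :: "real^'d \<Rightarrow> real"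
  assumes "is_norm q" "closed K" "closed L" "hausdorff_dist q K L = 0"
  shows "K = L"
  using assms excess_0_subset[of q L K] excess_0_subset[of q K L]
  by (auto simp: hausdorff_dist_excess max_def split: if_splits)

lemma support_attained:
  assumes K: "K \<in> Kbcs" obtains a where "a \<in> K" "support v K = ennreal (a \<bullet> v)" "0 \<le> a \<bullet> v"
proof -
  obtain a where a: "a \<in> K" "\<And>w. w \<in> K \<Longrightarrow> w \<bullet> v \<le> a \<bullet> v"
  proof -
    have "continuous_on K (\<lambda>w. w \<bullet> v)" by (intro continuous_intros)
    from continuous_attains_sup[OF KbcsD(6)[OF K] KbcsD(1)[OF K] this] show ?thesis using that by blast
  qed
  have nn: "0 \<le> a \<bullet> v" using a(2)[OF KbcsD(7)[OF K]] by simp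
  have "\<bar>w \<bullet> v\<bar> \<le> a \<bullet> v" if "w \<in> K" for w
    using a(2)[OF that] a(2)[OF KbcsD(8)[OF K that]] by (simp add: abs_le_iff)
  then have "support v K \<le> ennreal (a \<bullet> v)"
    unfolding support_def norm_of_set_def by (intro SUP_least ennreal_leI)
  moreover have "ennreal (a \<bullet> v) \<le> support v K"
    unfolding support_def using norm_of_set_upper[OF a(1), of "\<lambda>w. \<bar>w \<bullet> v\<bar>"] nn by simp
  ultimately show ?thesis using that[OF a(1) _ nn] by simp
qed

text \<open>Maximisers for the two sets add up to a point of the sum, with no cancellation since
  both inner products are nonnegative.\<close>

lemma support_plus:
  assumes K: "K \<in> Kbcs" and L: "L \<in> Kbcs"
  shows "support v K + support v L \<le> support v (K + L)"
proof -
  obtain a where a: "a \<in> K" "support v K = ennreal (a \<bullet> v)" "0 \<le> a \<bullet> v" by (rule support_attained[OF K])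
  obtain b where b: "b \<in> L" "support v L = ennreal (b \<bullet> v)" "0 \<le> b \<bullet> v" by (rule support_attained[OF L])
  have "support v K + support v L = ennreal \<bar>(a + b) \<bullet> v\<bar>"
    using a b by (simp add: inner_add_left)
  also have "\<dots> \<le> support v (K + L)"
    unfolding support_def by (rule norm_of_set_upper[of "a + b" _ "\<lambda>w. \<bar>w \<bullet> v\<bar>"]) (intro set_plus_intro a b)
  finally show ?thesis .
qed

lemma support_mono: "K \<subseteq> L \<Longrightarrow> support v K \<le> support v L"
  unfolding support_def by (rule norm_of_set_mono)

text \<open>A hyperplane separating \<open>u\<close> from \<open>K\<close> would violate the bound
  in its normal direction.\<close>

lemma mem_if_support:
  assumes K: "K \<in> Kbcs" and le: "\<And>v. ennreal \<bar>u \<bullet> v\<bar> \<le> support v K" shows "u \<in> K"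
proof (rule ccontr)
  assume "u \<notin> K"
  then obtain a b where ab: "a \<bullet> u < b" "\<And>w. w \<in> K \<Longrightarrow> b < a \<bullet> w"
    using separating_hyperplane_closed_point[OF KbcsD(4)[OF K] KbcsD(2)[OF K]] by blast
  obtain w where w: "w \<in> K" "support a K = ennreal (w \<bullet> a)" "0 \<le> w \<bullet> a" by (rule support_attained[OF K])
  have "b < - (w \<bullet> a)" using ab(2)[OF KbcsD(8)[OF K w(1)]] by (simp add: inner_commute)
  moreover have "\<bar>u \<bullet> a\<bar> \<le> w \<bullet> a" using le[of a] w by simp
  ultimately show False using ab(1) by (simp add: inner_commute)
qed

lemma set_scale_scale: "set_scale a (set_scale b K) = set_scale (a * b) K"
  by (simp add: set_scale_def image_image)

lemma set_scale_one: "set_scale 1 K = K"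
  by (simp add: set_scale_def)

lemma set_scale_zero: "K \<noteq> {} \<Longrightarrow> set_scale 0 K = {0}"
  by (auto simp: set_scale_def)

text \<open>Scaling a selection gives one inclusion; the reverse one is the same inclusion for the
  inverse factor.\<close>

lemma aumann_integral_scale:
  "aumann_integral Q (\<lambda>x. set_scale a (F x)) = set_scale a (aumann_integral Q F)" if "a \<noteq> 0"
proof -
  have sub: "set_scale a (aumann_integral Q F) \<subseteq> aumann_integral Q (\<lambda>x. set_scale a (F x))" for a F
  proof
    fix v assume "v \<in> set_scale a (aumann_integral Q F)"
    then obtain f where f: "v = a *\<^sub>R (LINT y:Q|lebesgue. f y)" "set_integrable lebesgue Q f"
      "AE y in lebesgue. y \<in> Q \<longrightarrow> f y \<in> F y"
      by (auto simp: set_scale_def aumann_integral_def)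
    have "set_integrable lebesgue Q (\<lambda>y. a *\<^sub>R f y)"
      using f(2) unfolding set_integrable_def by (subst scaleR_left_commute) (rule integrable_scaleR_right)
    moreover have "AE y in lebesgue. y \<in> Q \<longrightarrow> a *\<^sub>R f y \<in> set_scale a (F y)"
      using f(3) by eventually_elim (auto simp: set_scale_def)
    moreover have "v = (LINT y:Q|lebesgue. a *\<^sub>R f y)"
      unfolding f(1) by (rule set_integral_scaleR_right[symmetric])
    ultimately show "v \<in> aumann_integral Q (\<lambda>x. set_scale a (F x))" unfolding aumann_integral_def by blast
  qed
  have "aumann_integral Q (\<lambda>x. set_scale a (F x)) = set_scale a (set_scale (1 / a) (aumann_integral Q (\<lambda>x. set_scale a (F x))))"
    using that by (simp add: set_scale_scale set_scale_one)
  also have "\<dots> \<subseteq> set_scale a (aumann_integral Q (\<lambda>x. set_scale (1 / a) (set_scale a (F x))))"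
    unfolding set_scale_def[of a "set_scale _ _"] set_scale_def[of a "aumann_integral _ _"] by (intro image_mono sub)
  also have "\<dots> = set_scale a (aumann_integral Q F)"
    using that by (simp add: set_scale_scale set_scale_one)
  finally show ?thesis using sub[of a F] by blast
qed

lemma maximal_op_scale:
  assumes "a \<noteq> 0" shows "maximal_op (\<lambda>x. set_scale a (F x)) x = set_scale a (maximal_op F x)"
proof -
  have "avg_op Q (\<lambda>x. set_scale a (F x)) x = set_scale a (avg_op Q F x)" for Q
    by (simp add: avg_op_def aumann_integral_scale[OF assms] set_scale_scale mult.commute)
       (simp add: set_scale_def)
  then have "(\<Union>Q\<in>cubes. avg_op Q (\<lambda>x. set_scale a (F x)) x) = (\<lambda>v. a *\<^sub>R v) ` (\<Union>Q\<in>cubes. avg_op Q F x)"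
    by (simp add: image_UN set_scale_def)
  then show ?thesis
    unfolding maximal_op_def set_scale_def
    by (simp add: closure_scaleR convex_hull_scaling)
qed

section \<open>The Rubio de Francia iteration\<close>

lemma (in Ap_setting) LpK_scale:
  assumes "F \<in> LpK p \<rho>"
  shows "(\<lambda>x. set_scale a (F x)) \<in> LpK p \<rho>"
    "LpK_norm p \<rho> (\<lambda>x. set_scale a (F x)) \<le> ennreal \<bar>a\<bar> * LpK_norm p \<rho> F"
proof -
  obtain F' where F': "Kbcs_measurable F'" "AE x in lebesgue. F x = F' x"
      "LpK_norm p \<rho> F' = LpK_norm p \<rho> F" "LpK_norm p \<rho> F < \<infinity>" by (rule LpKE[OF assms])
  have K: "Kbcs_measurable (\<lambda>x. set_scale a (F' x))"
    using F'(1) by (auto simp: Kbcs_measurable_iff Kbcs_scale KbcsD(1) intro!: set_measurable_scale)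
  have ae: "AE x in lebesgue. set_scale a (F x) = set_scale a (F' x)" using F'(2) by eventually_elim simp
  have "LpK_norm p \<rho> (\<lambda>x. set_scale a (F' x)) = Lp_norm p (\<lambda>x. ennreal \<bar>a\<bar> * norm_of_set (\<rho> x) (F' x))"
    unfolding LpK_norm_def by (subst norm_of_set_scale) (auto simp: is_normD(3)[OF \<rho>_norm])
  also have "\<dots> \<le> ennreal \<bar>a\<bar> * LpK_norm p \<rho> F'"
    unfolding LpK_norm_def using F'(1) by (intro Lp_norm_cmult_le p norm_meas) (simp add: Kbcs_measurable_iff)
  finally have le: "LpK_norm p \<rho> (\<lambda>x. set_scale a (F' x)) \<le> ennreal \<bar>a\<bar> * LpK_norm p \<rho> F" by (simp add: F'(3))
  then show "LpK_norm p \<rho> (\<lambda>x. set_scale a (F x)) \<le> ennreal \<bar>a\<bar> * LpK_norm p \<rho> F"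
    using LpK_norm_cong(2)[OF ae] K by (simp add: Kbcs_measurable_iff)
  have "LpK_norm p \<rho> (\<lambda>x. set_scale a (F' x)) < \<infinity>"
    using le F'(4) by (auto intro: order.strict_trans1 simp: ennreal_mult_less_top)
  then show "(\<lambda>x. set_scale a (F x)) \<in> LpK p \<rho>" using K ae by (intro LpKI)
qed

locale RdF = Ap_setting \<rho> p for \<rho> :: "real^'n \<Rightarrow> real^'d \<Rightarrow> real" and p +
  fixes G :: "real^'n \<Rightarrow> (real^'d) set"
  assumes G: "G \<in> LpK p \<rho>"
begin

abbreviation T :: "nat \<Rightarrow> real^'n \<Rightarrow> (real^'d) set" where "T \<equiv> rdf_term p \<rho> G"
abbreviation g :: ennreal where "g \<equiv> LpK_norm p \<rho> G"

lemma g_fin: "g < \<infinity>" using G by (simp add: LpK_def)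

lemma T_eq: "T k = (\<lambda>x. set_scale (1 / (2 ^ k * c\<^sub>M ^ k)) ((maximal_op ^^ k) G x))"
  by (simp add: rdf_term_def c\<^sub>M_def fun_eq_iff)

lemma T_LpK: "T k \<in> LpK p \<rho>" and T_norm: "LpK_norm p \<rho> (T k) \<le> ennreal ((1 / 2) ^ k) * g"
proof -
  show "T k \<in> LpK p \<rho>" unfolding T_eq by (intro LpK_scale maximal_iterate G)
  have nn: "0 \<le> 1 / (2 ^ k * c\<^sub>M ^ k)" using c\<^sub>M_nonneg by simp
  have "LpK_norm p \<rho> (T k) \<le> ennreal \<bar>1 / (2 ^ k * c\<^sub>M ^ k)\<bar> * LpK_norm p \<rho> ((maximal_op ^^ k) G)"
    unfolding T_eq by (intro LpK_scale maximal_iterate G)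
  also have "\<dots> \<le> ennreal \<bar>1 / (2 ^ k * c\<^sub>M ^ k)\<bar> * (ennreal (c\<^sub>M ^ k) * g)"
    by (intro mult_left_mono maximal_iterate G) simp
  also have "\<dots> = ennreal (1 / (2 ^ k * c\<^sub>M ^ k) * c\<^sub>M ^ k) * g"
    by (simp only: abs_of_nonneg[OF nn] ennreal_mult[OF nn zero_le_power[OF c\<^sub>M_nonneg]] mult.assoc)
  \<comment> \<open>Only an inequality: for \<open>c\<^sub>M = 0\<close> and \<open>k > 0\<close>
    the coefficient is 0, because division by 0 yields 0.\<close>
  also have "\<dots> \<le> ennreal ((1 / 2) ^ k) * g"
    by (intro mult_right_mono ennreal_leI) (auto simp: power_one_over divide_simps)
  finally show "LpK_norm p \<rho> (T k) \<le> ennreal ((1 / 2) ^ k) * g" .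
qed

text \<open>Representatives with values in \<open>Kbcs\<close> at every point, so that Minkowski
  sums, closures and projections need no exceptional sets.\<close>

definition T' :: "nat \<Rightarrow> real^'n \<Rightarrow> (real^'d) set" where
  "T' k = (SOME F. Kbcs_measurable F \<and> (AE x in lebesgue. T k x = F x))"

lemma T': "Kbcs_measurable (T' k)" "AE x in lebesgue. T k x = T' k x"
proof -
  have "\<exists>F. Kbcs_measurable F \<and> (AE x in lebesgue. T k x = F x)"
    using T_LpK[of k] by (auto simp: LpK_def)
  from someI_ex[OF this] show "Kbcs_measurable (T' k)" "AE x in lebesgue. T k x = T' k x"
    by (simp_all add: T'_def)
qed

lemma T'_meas: "set_measurable (T' k)" and T'_Kbcs: "T' k x \<in> Kbcs"
  using T'(1) by (auto simp: Kbcs_measurable_iff)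

lemma T'_AE: "AE x in lebesgue. \<forall>k. T k x = T' k x"
  using T'(2) by (simp add: AE_all_countable)

definition N :: "nat \<Rightarrow> real^'n \<Rightarrow> ennreal" where
  "N k x = norm_of_set (\<rho> x) (T' k x)"

lemma N_meas [measurable]: "N k \<in> borel_measurable lebesgue"
  unfolding N_def by (rule norm_meas[OF T'_meas])

lemma N_norm: "Lp_norm p (N k) \<le> ennreal ((1 / 2) ^ k) * g"
  using T_norm[of k] LpK_norm_cong(2)[OF T'(2) T'_meas, of k] by (simp add: LpK_norm_def N_def[abs_def])

text \<open>The pointwise bound for the Hausdorff distance between the partial sum and the limit;
  its norm decays geometrically.\<close>

definition tail :: "nat \<Rightarrow> real^'n \<Rightarrow> ennreal" where "tail n x = (\<Sum>k. N (k + n) x)"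

lemma tail_meas [measurable]: "tail n \<in> borel_measurable lebesgue"
  unfolding tail_def by measurable

lemma tail_norm: "Lp_norm p (tail n) \<le> ennreal (2 * (1 / 2) ^ n) * g"
proof -
  have "Lp_norm p (tail n) \<le> (\<Sum>k. Lp_norm p (N (k + n)))"
    unfolding tail_def by (intro Lp_norm_suminf_le p) measurable
  also have "\<dots> \<le> (\<Sum>k. ennreal ((1 / 2) ^ (k + n)) * g)"
    by (intro suminf_le N_norm) auto
  also have "\<dots> = (\<Sum>k. ennreal ((1 / 2) ^ (k + n))) * g"
    by (rule ennreal_suminf_multc)
  also have "(\<Sum>k. ennreal ((1 / 2) ^ (k + n))) = ennreal (2 * (1 / 2) ^ n)"
  proof (rule suminf_ennreal_eq)
    have "(\<lambda>k. (1 / 2) ^ k * (1 / 2) ^ n) sums (1 / (1 - 1 / 2) * (1 / 2 :: real) ^ n)"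
      by (intro sums_mult2 geometric_sums) simp
    then show "(\<lambda>k. (1 / 2) ^ (k + n)) sums (2 * (1 / 2 :: real) ^ n)" by (simp add: power_add)
  qed simp
  finally show ?thesis .
qed

section \<open>Partial sums and their limit\<close>

definition S :: "nat \<Rightarrow> real^'n \<Rightarrow> (real^'d) set" where "S n x = (\<Sum>k<n. T' k x)"

lemma S_Suc: "S (Suc n) x = S n x + T' n x" by (simp add: S_def)

lemma S_0: "S 0 x = {0}" by (simp add: S_def set_zero)

lemma S_Kbcs: "S n x \<in> Kbcs"
  by (induction n) (auto simp: S_0 S_Suc Kbcs_zero intro: Kbcs_plus T'_Kbcs)

lemma S_meas: "set_measurable (S n)"
proof (induction n)
  case 0
  then show ?case using set_measurable_const by (simp add: S_def set_zero)
next
  case (Suc n)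
  have "S (Suc n) = (\<lambda>x. S n x + T' n x)" by (simp add: S_Suc fun_eq_iff)
  then show ?case using set_measurable_plus[OF Suc T'_meas] by simp
qed

lemma S_AE: "AE x in lebesgue. \<forall>n. (\<Sum>k<n. T k x) = S n x"
  using T'_AE by eventually_elim (simp add: S_def)

lemma S_mono: "n \<le> m \<Longrightarrow> S n x \<subseteq> S m x"
proof (induction m rule: dec_induct)
  case (step m)
  have "S m x \<subseteq> S (Suc m) x"
    unfolding S_Suc using set_zero_plus2[OF KbcsD(7)[OF T'_Kbcs]] by (simp add: add.commute)
  then show ?case using step by blast
qed simp

text \<open>Omit the last \<open>m\<close> summands in a decomposition of \<open>v\<close>.\<close>

lemma S_near:
  assumes "v \<in> S (n + m) x"
  shows "\<exists>w\<in>S n x. ennreal (\<rho> x (v - w)) \<le> (\<Sum>k<m. N (k + n) x)"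
  using assms
proof (induction m arbitrary: v)
  case 0
  then show ?case by (auto simp: is_normD(5)[OF \<rho>_norm] intro!: bexI[of _ v])
next
  case (Suc m)
  then obtain a b where ab: "v = a + b" "a \<in> S (n + m) x" "b \<in> T' (n + m) x"
    by (auto simp: S_Suc set_plus_def)
  obtain w where w: "w \<in> S n x" "ennreal (\<rho> x (a - w)) \<le> (\<Sum>k<m. N (k + n) x)" using Suc.IH[OF ab(2)] by blast
  have "ennreal (\<rho> x (v - w)) \<le> ennreal (\<rho> x (a - w) + \<rho> x b)"
    using is_normD(4)[OF \<rho>_norm, of x "a - w" b] by (intro ennreal_leI) (simp add: ab(1) algebra_simps)
  also have "\<dots> = ennreal (\<rho> x (a - w)) + ennreal (\<rho> x b)" by simp
  also have "\<dots> \<le> (\<Sum>k<m. N (k + n) x) + N (m + n) x"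
    using norm_of_set_upper[OF ab(3), of "\<rho> x"] by (intro add_mono w) (simp add: N_def add.commute)
  finally show ?case using w(1) by auto
qed

text \<open>The partial sums increase, because each summand contains 0; the closure of their union
  is thus the candidate for the limit.\<close>

definition R0 :: "real^'n \<Rightarrow> (real^'d) set" where "R0 x = closure (\<Union>n. S n x)"

text \<open>The union may be unbounded on a null set, where the value \<open>{0}\<close> restores
  membership in \<open>Kbcs\<close>.\<close>

definition RG :: "real^'n \<Rightarrow> (real^'d) set" where "RG x = (if x \<in> {x. bounded (R0 x)} then R0 x else {0})"

lemma S_subset_R0: "S n x \<subseteq> R0 x"
  unfolding R0_def using closure_subset[of "\<Union>n. S n x"] by blast

lemma R0_meas: "set_measurable R0"
  unfolding R0_def by (rule set_measurable_closure_UN[OF S_meas])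

lemma R0_Kbcs: "bounded (R0 x) \<Longrightarrow> R0 x \<in> Kbcs"
proof -
  assume b: "bounded (R0 x)"
  have "convex (\<Union>n. S n x)"
  proof (rule convexI)
    fix v w :: "real^'d" and s t :: real
    assume vw: "v \<in> (\<Union>n. S n x)" "w \<in> (\<Union>n. S n x)" and st: "0 \<le> s" "0 \<le> t" "s + t = 1"
    then obtain n m where "v \<in> S n x" "w \<in> S m x" by blast
    then have "v \<in> S (max n m) x" "w \<in> S (max n m) x"
      using S_mono[of n "max n m" x] S_mono[of m "max n m" x] by auto
    then have "s *\<^sub>R v + t *\<^sub>R w \<in> S (max n m) x" using st by (intro convexD KbcsD(4)[OF S_Kbcs])
    then show "s *\<^sub>R v + t *\<^sub>R w \<in> (\<Union>n. S n x)" by blast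
  qed
  then have "convex (R0 x)" unfolding R0_def by (rule convex_closure)
  moreover have "uminus ` R0 x = R0 x"
  proof -
    have "(\<lambda>v. (- 1) *\<^sub>R v) ` (\<Union>n. S n x) = (\<Union>n. S n x)"
      using KbcsD(5)[OF S_Kbcs] by (simp add: image_UN)
    then have "(\<lambda>v. (- 1) *\<^sub>R v) ` R0 x = R0 x"
      unfolding R0_def by (simp only: closure_scaleR)
    then show ?thesis by simp
  qed
  moreover have "R0 x \<noteq> {}" using S_subset_R0[of 0 x] by (auto simp: S_0)
  ultimately show ?thesis using b by (simp add: Kbcs_def R0_def)
qed

lemma RG_Kbcs_measurable: "Kbcs_measurable RG"
  unfolding Kbcs_measurable_iff
proof
  show "\<forall>x. RG x \<in> Kbcs" using R0_Kbcs by (simp add: RG_def Kbcs_zero)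
  show "set_measurable RG"
    unfolding RG_def by (intro set_measurable_If R0_meas set_measurable_const bounded_set_measurable)
qed

lemma RG_meas: "set_measurable RG" and RG_Kbcs: "RG x \<in> Kbcs"
  using RG_Kbcs_measurable by (auto simp: Kbcs_measurable_iff)

lemma norm_R0_le: "norm_of_set (\<rho> x) (R0 x) \<le> tail 0 x"
  unfolding R0_def
proof (rule norm_of_set_closure[OF is_norm_continuous_on[OF \<rho>_norm]])
  fix v assume "v \<in> (\<Union>n. S n x)"
  then obtain n where "v \<in> S (0 + n) x" by auto
  then have "ennreal (\<rho> x v) \<le> (\<Sum>k<n. N (k + 0) x)" using S_near[of v 0 n x] by (auto simp: S_0)
  also have "\<dots> \<le> tail 0 x" unfolding tail_def by (rule sum_le_suminf) auto
  finally show "ennreal (\<rho> x v) \<le> tail 0 x" .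
qed simp

lemma tail_0_norm: "Lp_norm p (tail 0) \<le> 2 * g"
  using tail_norm[of 0] by simp

lemma RG_R0: "AE x in lebesgue. RG x = R0 x"
proof -
  have "Lp_norm p (tail 0) < top"
    using tail_0_norm g_fin by (auto intro: order.strict_trans1 simp: ennreal_mult_less_top)
  then have "AE x in lebesgue. tail 0 x < top" by (rule Lp_norm_finite_AE[OF p tail_meas])
  then show ?thesis
  proof eventually_elim
    case (elim x)
    then have "norm_of_set (\<rho> x) (R0 x) < top" by (rule order.strict_trans1[OF norm_R0_le])
    then have "bounded (R0 x)" using norm_of_set_finite_iff[OF \<rho>_norm, of x] by simp
    then show ?case by (simp add: RG_def)
  qed
qed

lemma RG_norm: "LpK_norm p \<rho> RG \<le> 2 * g"
proof -
  have "LpK_norm p \<rho> RG \<le> Lp_norm p (tail 0)"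
    unfolding LpK_norm_def using RG_R0
    by (intro Lp_norm_mono_AE p norm_meas RG_meas) (auto elim!: eventually_mono intro: norm_R0_le)
  then show ?thesis using tail_0_norm by (rule order.trans)
qed

lemma RG_fin: "LpK_norm p \<rho> RG < \<infinity>"
  using RG_norm g_fin by (auto intro: order.strict_trans1 simp: ennreal_mult_less_top)

lemma RG_LpK: "RG \<in> LpK p \<rho>"
  using RG_Kbcs_measurable RG_fin by (intro LpKI) auto

text \<open>One excess is 0 by inclusion. For the other, a point of the closure is approximated by a
  point of some later partial sum, and then the later summands are dropped.\<close>

lemma hausdorff_S_R0: "hausdorff_dist (\<rho> x) (S n x) (R0 x) \<le> tail n x"
proof -
  have "excess (\<rho> x) (S n x) (R0 x) \<le> 0"
    unfolding excess_def
  proof (rule SUP_least)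
    fix v assume "v \<in> S n x"
    then have "(INF w\<in>R0 x. ennreal (\<rho> x (v - w))) \<le> ennreal (\<rho> x (v - v))"
      using S_subset_R0 by (intro INF_lower) auto
    then show "(INF w\<in>R0 x. ennreal (\<rho> x (v - w))) \<le> 0" by (simp add: is_normD(5)[OF \<rho>_norm])
  qed
  moreover have "excess (\<rho> x) (R0 x) (S n x) \<le> tail n x"
    unfolding excess_def
  proof (rule SUP_least)
    fix v assume v: "v \<in> R0 x"
    show "(INF w\<in>S n x. ennreal (\<rho> x (v - w))) \<le> tail n x"
    proof (rule ennreal_le_epsilon)
      fix e :: real assume e: "0 < e"
      have "open {w. \<rho> x (v - w) < e}"
      proof (rule open_Collect_less)
        show "continuous_on UNIV (\<lambda>w. \<rho> x (v - w))"
          by (rule continuous_on_compose2[OF is_norm_continuous_on[OF \<rho>_norm, of UNIV]]) (auto intro!: continuous_intros)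
      qed auto
      moreover have "v \<in> {w. \<rho> x (v - w) < e}" using e by (simp add: is_normD(5)[OF \<rho>_norm])
      ultimately have "{w. \<rho> x (v - w) < e} \<inter> (\<Union>n. S n x) \<noteq> {}"
        using v open_Int_closure_eq_empty[of "{w. \<rho> x (v - w) < e}" "\<Union>n. S n x"] unfolding R0_def by blast
      then obtain m z where z: "z \<in> S m x" "\<rho> x (v - z) < e" by auto
      then have "z \<in> S (n + m) x" using S_mono[of m "n + m" x] by auto
      then obtain w where w: "w \<in> S n x" "ennreal (\<rho> x (z - w)) \<le> (\<Sum>k<m. N (k + n) x)" using S_near by blast
      have "(INF w\<in>S n x. ennreal (\<rho> x (v - w))) \<le> ennreal (\<rho> x (v - w))" using w(1) by (rule INF_lower)
      also have "\<dots> \<le> ennreal (\<rho> x (z - w) + \<rho> x (v - z))"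
        using is_normD(4)[OF \<rho>_norm, of x "z - w" "v - z"] by (intro ennreal_leI) simp
      also have "\<dots> = ennreal (\<rho> x (z - w)) + ennreal (\<rho> x (v - z))" by simp
      also have "\<dots> \<le> (\<Sum>k<m. N (k + n) x) + ennreal e"
        using z(2) by (intro add_mono w ennreal_leI) auto
      also have "(\<Sum>k<m. N (k + n) x) \<le> tail n x" unfolding tail_def by (rule sum_le_suminf) auto
      finally show "(INF w\<in>S n x. ennreal (\<rho> x (v - w))) \<le> tail n x + ennreal e" by (simp add: add_right_mono)
    qed
  qed
  ultimately show ?thesis by (simp add: hausdorff_dist_excess)
qed

lemma hausdorff_meas:
  assumes "Kbcs_measurable F" "Kbcs_measurable H"
  shows "(\<lambda>x. hausdorff_dist (\<rho> x) (F x) (H x)) \<in> borel_measurable lebesgue"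
  using assms by (intro measurable_hausdorff_dist \<rho>_norm \<rho>_meas) (auto simp: Kbcs_measurable_iff KbcsD(1))

lemma S_Kbcs_measurable: "Kbcs_measurable (S n)"
  using S_Kbcs S_meas by (simp add: Kbcs_measurable_iff)

lemma LpK_dist_partial_sum:
  assumes F: "Kbcs_measurable F"
  shows "LpK_dist p \<rho> (\<lambda>x. \<Sum>k<n. T k x) F = Lp_norm p (\<lambda>x. hausdorff_dist (\<rho> x) (S n x) (F x))"
proof -
  have m: "(\<lambda>x. hausdorff_dist (\<rho> x) (S n x) (F x)) \<in> borel_measurable lebesgue"
    by (rule hausdorff_meas[OF S_Kbcs_measurable F])
  have ae: "AE x in lebesgue. hausdorff_dist (\<rho> x) (S n x) (F x) = hausdorff_dist (\<rho> x) (\<Sum>k<n. T k x) (F x)"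
    using S_AE by eventually_elim simp
  show ?thesis unfolding LpK_dist_def
    by (intro Lp_norm_cong_AE p m measurable_lebesgue_AE[OF m ae]) (use ae in \<open>auto elim: eventually_mono\<close>)
qed

lemma partial_sum_LpK: "(\<lambda>x. \<Sum>k<n. T k x) \<in> LpK p \<rho>"
proof (rule LpKI[OF S_Kbcs_measurable])
  show "AE x in lebesgue. (\<Sum>k<n. T k x) = S n x" using S_AE by eventually_elim simp
  have "LpK_norm p \<rho> (S n) \<le> Lp_norm p (tail 0)"
    unfolding LpK_norm_def
    using order.trans[OF norm_of_set_mono[OF S_subset_R0] norm_R0_le]
    by (intro Lp_norm_mono_AE p norm_meas S_meas) auto
  then have "LpK_norm p \<rho> (S n) \<le> 2 * g" using tail_0_norm by (rule order.trans)
  then show "LpK_norm p \<rho> (S n) < \<infinity>" using g_fin by (auto intro: order.strict_trans1 simp: ennreal_mult_less_top)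
qed

lemma RG_sums: "LpK_sums p \<rho> T RG"
  unfolding LpK_sums_def
proof (intro conjI allI partial_sum_LpK RG_LpK)
  have le: "LpK_dist p \<rho> (\<lambda>x. \<Sum>k<n. T k x) RG \<le> ennreal (2 * (1 / 2) ^ n) * g" for n
  proof -
    have "Lp_norm p (\<lambda>x. hausdorff_dist (\<rho> x) (S n x) (RG x)) \<le> Lp_norm p (tail n)"
      using RG_R0 by (intro Lp_norm_mono_AE p hausdorff_meas S_Kbcs_measurable RG_Kbcs_measurable)
        (auto elim!: eventually_mono intro: hausdorff_S_R0)
    then show ?thesis
      unfolding LpK_dist_partial_sum[OF RG_Kbcs_measurable] using tail_norm by (rule order.trans)
  qed
  have "(\<lambda>n. 2 * (1 / 2 :: real) ^ n * enn2real g) \<longlonglongrightarrow> 2 * 0 * enn2real g"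
    by (intro tendsto_intros LIMSEQ_realpow_zero) auto
  then have "(\<lambda>n. ennreal (2 * (1 / 2) ^ n * enn2real g)) \<longlonglongrightarrow> ennreal (2 * 0 * enn2real g)"
    by (rule tendsto_ennrealI)
  moreover have "ennreal (2 * (1 / 2) ^ n * enn2real g) = ennreal (2 * (1 / 2) ^ n) * g" for n
    using g_fin by (simp add: ennreal_mult)
  ultimately have "(\<lambda>n. ennreal (2 * (1 / 2) ^ n) * g) \<longlonglongrightarrow> 0" by simp
  then show "(\<lambda>n. LpK_dist p \<rho> (\<lambda>x. \<Sum>k<n. T k x) RG) \<longlonglongrightarrow> 0"
    by (rule tendsto_sandwich[OF _ _ tendsto_const, rotated 2]) (auto intro!: always_eventually le)
qed

text \<open>The theorem concerns every limit of the series. The triangle inequality and definiteness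
  of the Hausdorff distance on closed sets reduce it to the limit constructed here.\<close>

lemma sums_unique:
  assumes F: "Kbcs_measurable F" and sums: "LpK_sums p \<rho> T F"
  shows "AE x in lebesgue. F x = RG x"
proof -
  let ?h = "\<lambda>x. hausdorff_dist (\<rho> x) (F x) (RG x)"
  have m: "?h \<in> borel_measurable lebesgue" by (rule hausdorff_meas[OF F RG_Kbcs_measurable])
  have le: "Lp_norm p ?h \<le> LpK_dist p \<rho> (\<lambda>x. \<Sum>k<n. T k x) F + LpK_dist p \<rho> (\<lambda>x. \<Sum>k<n. T k x) RG" for n
  proof -
    have "?h x \<le> hausdorff_dist (\<rho> x) (S n x) (F x) + hausdorff_dist (\<rho> x) (S n x) (RG x)" for x
      using hausdorff_dist_triangle[OF \<rho>_norm KbcsD(1)[OF S_Kbcs], of x "F x" "RG x" n x]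
      by (simp add: hausdorff_dist_commute[of "\<rho> x" "F x" "S n x"])
    then have "Lp_norm p ?h \<le> Lp_norm p (\<lambda>x. hausdorff_dist (\<rho> x) (S n x) (F x) + hausdorff_dist (\<rho> x) (S n x) (RG x))"
      by (intro Lp_norm_mono_AE p m) auto
    also have "\<dots> \<le> Lp_norm p (\<lambda>x. hausdorff_dist (\<rho> x) (S n x) (F x)) + Lp_norm p (\<lambda>x. hausdorff_dist (\<rho> x) (S n x) (RG x))"
      by (intro Lp_norm_triangle p hausdorff_meas S_Kbcs_measurable F RG_Kbcs_measurable)
    finally show ?thesis by (simp add: LpK_dist_partial_sum F RG_Kbcs_measurable)
  qed
  have "(\<lambda>n. LpK_dist p \<rho> (\<lambda>x. \<Sum>k<n. T k x) F + LpK_dist p \<rho> (\<lambda>x. \<Sum>k<n. T k x) RG) \<longlonglongrightarrow> 0 + 0"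
    using sums RG_sums unfolding LpK_sums_def by (intro tendsto_add) auto
  then have "Lp_norm p ?h \<le> 0 + 0" using le by (intro LIMSEQ_le_const) auto
  then have "AE x in lebesgue. ?h x = 0" by (intro Lp_norm_eq_0_AE[OF p m]) simp
  then show ?thesis
  proof eventually_elim
    case (elim x)
    then show ?case
      using F by (intro hausdorff_dist_0_eq[OF \<rho>_norm]) (auto simp: Kbcs_measurable_iff KbcsD(2) RG_Kbcs)
  qed
qed

section \<open>Inclusions satisfied by the limit\<close>

lemma G_subset_RG: "AE x in lebesgue. G x \<subseteq> RG x"
  using RG_R0 T'_AE
proof eventually_elim
  case (elim x)
  have "T 0 x = G x" by (simp add: rdf_term_def set_scale_one)
  moreover have "S (Suc 0) x = T' 0 x" unfolding S_def by simp
  ultimately show ?case using elim S_subset_R0[of "Suc 0" x] by simp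
qed

text \<open>The normalisations of consecutive terms differ by the factor
  \<open>2 * c\<^sub>M\<close>, which must be nonzero here for scaling to commute with the operator;
  this factor is the constant of the final inclusion.\<close>

lemma T_step:
  assumes "c\<^sub>M \<noteq> 0" shows "maximal_op (T k) x = set_scale (2 * c\<^sub>M) (T (Suc k) x)"
  unfolding T_eq using assms by (subst maximal_op_scale) (simp_all add: set_scale_scale)

lemma support_S: "(\<Sum>k<n. support v (T' k x)) \<le> support v (S n x)"
proof (induction n)
  case (Suc n)
  then have "(\<Sum>k<Suc n. support v (T' k x)) \<le> support v (S n x) + support v (T' n x)" by (simp add: add_right_mono)
  also have "\<dots> \<le> support v (S (Suc n) x)" unfolding S_Suc by (intro support_plus S_Kbcs T'_Kbcs)
  finally show ?case .
qed simp

lemma support_R0_le: "support v (R0 x) \<le> (\<Sum>k. support v (T' k x))"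
  unfolding R0_def support_def[of v "closure _"]
proof (rule norm_of_set_closure)
  fix w assume "w \<in> (\<Union>n. S n x)"
  then obtain n where "w \<in> S n x" by blast
  then have "ennreal \<bar>w \<bullet> v\<bar> \<le> support v (S n x)" unfolding support_def by (rule norm_of_set_upper[of w _ "\<lambda>w. \<bar>w \<bullet> v\<bar>"])
  also have "\<dots> \<le> (\<Sum>k<n. support v (T' k x))"
  proof (induction n)
    case (Suc n)
    have "support v (S n x + T' n x) \<le> support v (S n x) + support v (T' n x)"
      unfolding support_def by (rule norm_of_set_plus) (auto simp: inner_add_left)
    then show ?case using Suc by (simp add: S_Suc add_right_mono order.trans)
  qed (simp add: S_0 support_def norm_of_set_def)
  also have "\<dots> \<le> (\<Sum>k. support v (T' k x))" by (rule sum_le_suminf) auto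
  finally show "ennreal \<bar>w \<bullet> v\<bar> \<le> (\<Sum>k. support v (T' k x))" .
qed (auto intro!: continuous_intros)

lemma support_measurable:
  assumes "set_measurable F" shows "(\<lambda>y. support v (F y)) \<in> borel_measurable lebesgue"
  unfolding support_def norm_of_set_def
  by (rule measurable_SUP_Caratheodory[OF assms]) (auto intro!: continuous_intros)

text \<open>For support functions, \<open>M (\<Sum>T\<^sub>k) \<subseteq> \<Sum>M T\<^sub>k\<close> is the countable additivity of the integral.\<close>

lemma maximal_RG_subset: "AE x in lebesgue. maximal_op RG x \<subseteq> set_scale (2 * c\<^sub>M) (RG x)"
proof (cases "c\<^sub>M = 0")
  \<comment> \<open>Here the coefficients of the series degenerate, but the norm bound alone makes
    the maximal function of the limit equal to \<open>{0}\<close> almost everywhere.\<close>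
  case True
  have "AE y in lebesgue. 0 \<in> RG y" using KbcsD(7)[OF RG_Kbcs] by simp
  then have m: "set_measurable (maximal_op RG)" by (rule maximal_op_set_measurable)
  have "LpK_norm p \<rho> (maximal_op RG) \<le> 0" using maximal_norm_le[OF RG_LpK] True by simp
  then have "AE x in lebesgue. norm_of_set (\<rho> x) (maximal_op RG x) = 0"
    by (intro Lp_norm_eq_0_AE[OF p norm_meas[OF m]]) (simp add: LpK_norm_def)
  then show ?thesis
  proof eventually_elim
    case (elim x)
    have "v = 0" if "v \<in> maximal_op RG x" for v
    proof -
      have "ennreal (\<rho> x v) \<le> 0" using norm_of_set_upper[OF that, of "\<rho> x"] elim by simp
      then have "\<rho> x v = 0" using \<rho>_nn[of x v] by (simp add: ennreal_eq_0_iff)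
      then show ?thesis by (simp add: is_normD(2)[OF \<rho>_norm])
    qed
    then show ?case using True KbcsD(1)[OF RG_Kbcs] by (auto simp: set_scale_zero)
  qed
next
  case False
  then have c: "0 < c\<^sub>M" using c\<^sub>M_nonneg by simp
  \<comment> \<open>The exceptional null set for \<open>x\<close> is fixed here, before the
    uncountably many cubes, averages and directions are introduced.\<close>
  show ?thesis using RG_R0 T'_AE
  proof eventually_elim
    case (elim x)
    let ?C = "set_scale (2 * c\<^sub>M) (RG x)"
    have C: "?C \<in> Kbcs" by (rule Kbcs_scale[OF RG_Kbcs])
    have "u \<in> ?C" if Q: "Q \<in> cubes" and u: "u \<in> avg_op Q RG x" for Q u
    proof (cases "x \<in> Q")
      case out: False
      then show ?thesis using u KbcsD(7)[OF C] by (simp add: avg_op_def)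
    next
      case x: True
      have [measurable]: "Q \<in> sets lebesgue" using Q by simp
      have [measurable]: "(\<lambda>y. support v (T' k y)) \<in> borel_measurable lebesgue" for v k
        by (rule support_measurable[OF T'_meas])
      define m where "m = measure lebesgue Q"
      have m: "emeasure lebesgue Q = ennreal m" "0 < m" using cubes_emeasure[OF Q] by (simp_all add: m_def)
      obtain f where f: "set_integrable lebesgue Q f" "AE y in lebesgue. y \<in> Q \<longrightarrow> f y \<in> RG y"
        "u = (1 / measure lebesgue Q) *\<^sub>R (LINT y:Q|lebesgue. f y)"
        using u x by (auto simp: avg_op_def set_scale_def aumann_integral_def)
      have i: "integrable lebesgue (\<lambda>y. indicator Q y *\<^sub>R f y)" using f(1) by (simp add: set_integrable_def)
      show ?thesis
      proof (rule mem_if_support[OF C])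
        fix v
        have Tk: "(\<integral>\<^sup>+y\<in>Q. support v (T' k y) \<partial>lebesgue) \<le> ennreal m * (ennreal (2 * c\<^sub>M) * support v (T' (Suc k) x))" for k
        proof -
          have fin: "LpK_norm p \<rho> (T' k) < \<infinity>"
            using LpK_norm_cong(2)[OF T'(2) T'_meas, of k] T_LpK[of k] by (simp add: LpK_def)
          have "(\<integral>\<^sup>+y\<in>Q. support v (T' k y) \<partial>lebesgue) \<le> emeasure lebesgue Q * support v (avg_op Q (T' k) x)"
            by (intro support_avg_ge T' Q x locally_integrable T'_meas fin)
          also have "\<dots> \<le> emeasure lebesgue Q * support v (maximal_op (T' k) x)"
          proof (intro mult_left_mono support_mono)
            have "avg_op Q (T' k) x \<subseteq> (\<Union>Q\<in>cubes. avg_op Q (T' k) x)" using Q by blast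
            also have "\<dots> \<subseteq> maximal_op (T' k) x"
              unfolding maximal_op_def by (meson closure_subset hull_subset order_trans)
            finally show "avg_op Q (T' k) x \<subseteq> maximal_op (T' k) x" .
          qed simp
          \<comment> \<open>The maximal operator ignores null sets, so \<open>T' k\<close> may be
            replaced by \<open>T k\<close> inside it; on the right-hand side the two families agree
            at this particular \<open>x\<close>.\<close>
          also have "maximal_op (T' k) x = set_scale (2 * c\<^sub>M) (T' (Suc k) x)"
            using maximal_op_cong[OF T'(2), of k] T_step[OF False, of k x] elim(2) by simp
          also have "support v (set_scale (2 * c\<^sub>M) (T' (Suc k) x)) = ennreal (2 * c\<^sub>M) * support v (T' (Suc k) x)"
            unfolding support_def using c by (subst norm_of_set_scale) (auto simp: abs_mult)
          finally show ?thesis by (simp only: m(1))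
        qed
        have "(LINT y|lebesgue. (indicator Q y *\<^sub>R f y) \<bullet> v) = (LINT y|lebesgue. indicator Q y *\<^sub>R f y) \<bullet> v"
          by (rule integral_inner_left) (rule i)
        then have "m * (u \<bullet> v) = (LINT y|lebesgue. (indicator Q y *\<^sub>R f y) \<bullet> v)"
          using m(2) by (simp add: f(3) set_lebesgue_integral_def m_def[symmetric])
        then have "ennreal (m * \<bar>u \<bullet> v\<bar>) = ennreal (norm (LINT y|lebesgue. (indicator Q y *\<^sub>R f y) \<bullet> v))"
          using m(2) by (metis abs_mult abs_of_pos real_norm_def)
        also have "\<dots> \<le> (\<integral>\<^sup>+y. ennreal (norm ((indicator Q y *\<^sub>R f y) \<bullet> v)) \<partial>lebesgue)"
          by (intro integral_norm_bound_ennreal integrable_inner_left i)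
        also have "\<dots> \<le> (\<integral>\<^sup>+y. (\<Sum>k. support v (T' k y) * indicator Q y) \<partial>lebesgue)"
        proof (rule nn_integral_mono_AE)
          show "AE y in lebesgue. ennreal (norm ((indicator Q y *\<^sub>R f y) \<bullet> v)) \<le> (\<Sum>k. support v (T' k y) * indicator Q y)"
            using f(2) RG_R0
          proof eventually_elim
            case (elim y)
            show ?case
            proof (cases "y \<in> Q")
              case True
              then have "ennreal \<bar>f y \<bullet> v\<bar> \<le> support v (R0 y)"
                unfolding support_def using elim by (intro norm_of_set_upper[of "f y" _ "\<lambda>w. \<bar>w \<bullet> v\<bar>"]) simp
              also have "\<dots> \<le> (\<Sum>k. support v (T' k y))" by (rule support_R0_le)
              finally show ?thesis using True by simp
            qed simp
          qed
        qed
        also have "\<dots> = (\<Sum>k. \<integral>\<^sup>+y\<in>Q. support v (T' k y) \<partial>lebesgue)"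
          by (rule nn_integral_suminf) measurable
        also have "\<dots> \<le> (\<Sum>k. ennreal m * (ennreal (2 * c\<^sub>M) * support v (T' (Suc k) x)))"
          by (intro suminf_le Tk) auto
        also have "\<dots> = ennreal m * (ennreal (2 * c\<^sub>M) * (\<Sum>k. support v (T' (Suc k) x)))"
          by simp
        \<comment> \<open>The shifted series lacks the term with index 0, and adding this
          nonnegative term gives the series for the limit itself.\<close>
        also have "(\<Sum>k. support v (T' (Suc k) x)) \<le> support v (R0 x)"
          unfolding suminf_eq_SUP
        proof (rule SUP_least)
          fix n
          have "(\<Sum>k<n. support v (T' (Suc k) x)) \<le> (\<Sum>k<Suc n. support v (T' k x))"
            by (subst sum.lessThan_Suc_shift) simp
          also have "\<dots> \<le> support v (S (Suc n) x)" by (rule support_S)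
          also have "\<dots> \<le> support v (R0 x)" by (rule support_mono[OF S_subset_R0])
          finally show "(\<Sum>k<n. support v (T' (Suc k) x)) \<le> support v (R0 x)" .
        qed
        also have "ennreal (2 * c\<^sub>M) * support v (R0 x) = support v ?C"
          unfolding support_def using c elim(1) by (subst norm_of_set_scale) (auto simp: abs_mult)
        finally have "ennreal m * ennreal \<bar>u \<bullet> v\<bar> \<le> ennreal m * support v ?C"
          using m(2) by (simp add: ennreal_mult mult_left_mono)
        then show "ennreal \<bar>u \<bullet> v\<bar> \<le> support v ?C"
          using m(2) by (subst (asm) ennreal_mult_le_mult_iff) auto
      qed
    qed
    then have "(\<Union>Q\<in>cubes. avg_op Q RG x) \<subseteq> ?C" by blast
    then show ?case unfolding maximal_op_def
      by (intro closure_minimal hull_minimal KbcsD(2)[OF C] KbcsD(4)[OF C])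
  qed
qed

lemma RG_locally_integrably_bounded: "locally_integrably_bounded RG"
proof -
  define n where "n x = norm_of_set norm (RG x)" for x
  have n_meas: "n \<in> borel_measurable lebesgue"
    unfolding n_def by (rule measurable_norm_of_set[OF is_norm_norm _ RG_meas]) simp
  have n_fin: "n x < \<infinity>" for x
    unfolding n_def norm_of_set_finite_iff[OF is_norm_norm] by (rule KbcsD(3)[OF RG_Kbcs])
  \<comment> \<open>The summand 1 gives the strict inequality required by the open ball and keeps
    \<open>k\<close> positive; it is integrable on compact sets.\<close>
  define k where "k x = enn2real (n x) + 1" for x
  have [measurable]: "k \<in> borel_measurable lebesgue" unfolding k_def using n_meas by measurable
  have k_pos: "0 < k x" for x by (simp add: k_def add_nonneg_pos)
  have k_eq: "ennreal (k x) = n x + 1" for x using n_fin[of x] by (simp add: k_def)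
  have "set_integrable lebesgue A k" if A: "compact A" for A
  proof -
    have "bounded A" using A by (rule compact_imp_bounded)
    then obtain a where a: "\<And>x. x \<in> A \<Longrightarrow> norm x \<le> a" by (auto simp: bounded_iff)
    \<comment> \<open>The margin 1 on each side lets the open cube contain the compact set even when
      it touches the bound \<open>a\<close>.\<close>
    define l where "l = 2 * \<bar>a\<bar> + 2"
    define b :: "real^'n" where "b = (\<chi> i. - \<bar>a\<bar> - 1)"
    define Q where "Q = box b (\<chi> i. b $ i + l)"
    have Q: "Q \<in> cubes" unfolding Q_def cubes_def
      by (intro CollectI exI[of _ b] exI[of _ l]) (simp add: l_def)
    have AQ: "A \<subseteq> Q"
    proof
      fix x assume "x \<in> A"
      then have "\<bar>x $ i\<bar> \<le> \<bar>a\<bar>" for i using a[of x] component_le_norm_cart[of x i] by simp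
      then have "- \<bar>a\<bar> - 1 < x $ i \<and> x $ i < \<bar>a\<bar> + 1" for i by (smt (verit))
      then show "x \<in> Q" by (auto simp: Q_def mem_box_cart b_def l_def)
    qed
    have [measurable]: "A \<in> sets lebesgue" using A by (intro lmeasurable_compact fmeasurableD)
    have [measurable]: "Q \<in> sets lebesgue" using Q by simp
    show ?thesis
      unfolding set_integrable_def
    proof (rule integrableI_bounded)
      have "(\<integral>\<^sup>+x. ennreal (norm (indicator A x *\<^sub>R k x)) \<partial>lebesgue) \<le> (\<integral>\<^sup>+x. n x * indicator Q x + indicator Q x \<partial>lebesgue)"
        using AQ k_pos less_imp_le[OF k_pos] by (intro nn_integral_mono) (auto simp: k_eq split: split_indicator)
      also have "\<dots> = (\<integral>\<^sup>+x\<in>Q. n x \<partial>lebesgue) + emeasure lebesgue Q"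
        using n_meas by (subst nn_integral_add) auto
      also have "\<dots> < \<infinity>"
        using locally_integrable[OF RG_meas RG_fin Q] cubes_emeasure(1)[OF Q] by (simp add: n_def)
      finally show "(\<integral>\<^sup>+x. ennreal (norm (indicator A x *\<^sub>R k x)) \<partial>lebesgue) < \<infinity>" .
    qed measurable
  qed
  moreover have "RG x \<subseteq> set_scale (k x) (ball 0 1)" for x
  proof
    fix v assume "v \<in> RG x"
    then have "ennreal (norm v) \<le> ennreal (enn2real (n x))"
      using norm_of_set_upper[of v "RG x" norm] n_fin[of x] by (simp add: n_def)
    then have "norm v < k x" by (simp add: k_def)
    then have "(1 / k x) *\<^sub>R v \<in> ball 0 1" using k_pos[of x] by simp
    then have "k x *\<^sub>R ((1 / k x) *\<^sub>R v) \<in> set_scale (k x) (ball 0 1)" unfolding set_scale_def by (rule imageI)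
    then show "v \<in> set_scale (k x) (ball 0 1)" using k_pos[of x] by simp
  qed
  ultimately show ?thesis
    unfolding locally_integrably_bounded_def using less_imp_le[OF k_pos] by (intro exI[of _ k]) auto
qed

theorem sums_properties:
  assumes F: "Kbcs_measurable F" and sums: "LpK_sums p \<rho> T F"
  shows "AE x in lebesgue. G x \<subseteq> F x" "LpK_norm p \<rho> F \<le> 2 * g" "F \<in> A1K"
    "AE x in lebesgue. maximal_op F x \<subseteq> set_scale (2 * c\<^sub>M) (F x)"
proof -
  have eq: "AE x in lebesgue. F x = RG x" by (rule sums_unique[OF F sums])
  show "AE x in lebesgue. G x \<subseteq> F x" using eq G_subset_RG by eventually_elim simp
  show "LpK_norm p \<rho> F \<le> 2 * g" using LpK_norm_cong(2)[OF eq RG_meas] RG_norm by simp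
  show M: "AE x in lebesgue. maximal_op F x \<subseteq> set_scale (2 * c\<^sub>M) (F x)"
    using eq maximal_RG_subset unfolding maximal_op_cong[OF eq] by eventually_elim simp
  obtain k where k: "\<And>x. 0 \<le> k x" "\<And>S. compact S \<Longrightarrow> set_integrable lebesgue S k"
    "AE x in lebesgue. RG x \<subseteq> set_scale (k x) (ball 0 1)"
    using RG_locally_integrably_bounded unfolding locally_integrably_bounded_def by blast
  have "AE x in lebesgue. F x \<subseteq> set_scale (k x) (ball 0 1)" using eq k(3) by eventually_elim simp
  then have "locally_integrably_bounded F" unfolding locally_integrably_bounded_def using k(1,2) by blast
  then show "F \<in> A1K" unfolding A1K_def using F M by blast
qed

end

theorem theorem7p5:
  fixes \<rho> :: "real^'n \<Rightarrow> real^'d \<Rightarrow> real"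
    and p :: ennreal
    and G :: "real^'n \<Rightarrow> (real^'d) set"
  assumes "1 < p"
    and "Ap_norm p \<rho>"
    and "G \<in> LpK p \<rho>"
  shows "(\<exists>RG. Kbcs_measurable RG \<and> LpK_sums p \<rho> (rdf_term p \<rho> G) RG) \<and>
    (\<forall>RG. Kbcs_measurable RG \<and> LpK_sums p \<rho> (rdf_term p \<rho> G) RG \<longrightarrow>
       (AE x in lebesgue. G x \<subseteq> RG x) \<and>
       LpK_norm p \<rho> RG \<le> 2 * LpK_norm p \<rho> G \<and>
       RG \<in> A1K \<and>
       (AE x in lebesgue.
          maximal_op RG x \<subseteq> set_scale (2 * enn2real (maximal_op_norm p \<rho>)) (RG x)))"
proof -
  interpret RdF \<rho> p G
    by unfold_locales (use assms in auto)
  show ?thesis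
    using RG_Kbcs_measurable RG_sums sums_properties unfolding c\<^sub>M_def by blast
qed

end
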